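(* Let $\mathscr M$ be a perfect-fluid space-time, i.e. a Lorentzian manifold (of dimension $n>3$) with Ricci tensor $$R_{kl}=A\,g_{kl}+B\,u_ku_l,$$ where $A$ and $B$ are scalar fields and $u$ is a time-like unit vector field, $u^ju_j=-1$. If $\nabla_ku_j-\nabla_ju_k=0$ ($u$ is closed) and if $\nabla_mC_{jkl}{}^m=0$, where $C$ is the Weyl tensor, then: (i) $u$ is a concircular vector and it is rescalable to a time-like conformal Killing vector $X$ such that $$\nabla_kX_j=\rho\,g_{kj}\quad\text{and}\quad \nabla_k\rho=\frac{A-B}{1-n}\,X_k,$$ where $\rho$ is a scalar function; (ii) $\mathscr M$ is a generalized Robertson-Walker space-time whose sub-manifold (fiber) $(\mathscr M^*,g^* )$ is a Riemannian Einstein space; (iii) $C_{jklm}u^m=0$.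
   Context: Lorentzian metrics $g$ have signature $(-,+,\dots,+)$, $\nabla$ is the Levi-Civita connection, and indices are raised and lowered with $g$ (vector fields are identified with 1-forms). Curvature conventions: $(\nabla_j\nabla_k-\nabla_k\nabla_j)X_l=R_{jkl}{}^mX_m$; the Ricci tensor is $R_{jm}=-g^{kl}R_{jklm}$; $R=g^{ij}R_{ij}$. The Weyl tensor is $$C_{jklm}=R_{jklm}+\tfrac{1}{n-2}(g_{jm}R_{kl}-g_{km}R_{jl}+R_{jm}g_{kl}-R_{km}g_{jl})-\frac{(g_{jm}g_{kl}-g_{mk}g_{jl})R}{(n-1)(n-2)}.$$ A vector field $v$ is torse-forming if $\nabla_kv_j=\omega_kv_j+f\,g_{jk}$ for some scalar function $f$ and 1-form $\omega$; it is concircular if in addition $\omega$ is a gradient (or locally a gradient). Rescaling a vector field means multiplying it by a positive scalar function; for a concircular vector with $\omega_k=\nabla_k\sigma$ (locally) the rescaled vector is $X=e^{-\sigma}v$. A conformal Killing vector is a vector field $X$ with $\nabla_iX_j+\nabla_jX_i=2\rho g_{ij}$ for some scalar function $\rho$. An $n$-dimensional Lorentzian manifold is a generalized Robertson-Walker space-time if locally the metric may take the form $$ds^2=-dt^2+q(t)^2\,g^*_{\alpha\beta}(x_2,\dots,x_n)\,dx^\alpha dx^\beta,\qquad \alpha,\beta=2,\dots,n,$$ that is, it is the warped product $(-1)\times q^2\mathscr M^*$, where $(\mathscr M^*,g^* )$ is an $(n-1)$-dimensional Riemannian manifold, called the fiber.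
   Formalization: Assumes in addition that B is nonzero on a dense set; without it the claim fails: in Minkowski space (A=B=0, C=0) on t>|x_1|, u=-d sqrt(t^2-x_1^2) is unit, time-like and closed but not concircular. *)

theory Defs
  imports "HOL-Analysis.Analysis"
begin

section \<open>Smooth functions on open subsets of coordinate space\<close>

definition pd :: "'n::finite \<Rightarrow> (real^'n \<Rightarrow> real) \<Rightarrow> real^'n \<Rightarrow> real"
  where "pd i f x = frechet_derivative f (at x) (axis i 1)"

text \<open>
  \<open>C\<^sup>\<infinity>\<close>: all iterated partial derivatives exist and are Frechet differentiable.
  Only meaningful for open \<open>S\<close>.
\<close>
definition smooth_on :: "(real^'n::finite) set \<Rightarrow> (real^'n \<Rightarrow> real) \<Rightarrow> bool"
  where "smooth_on S f \<longleftrightarrow> (\<forall>is. \<forall>x\<in>S. foldr pd is f differentiable (at x))"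

definition smooth_real_on :: "real set \<Rightarrow> (real \<Rightarrow> real) \<Rightarrow> bool"
  where "smooth_real_on I q \<longleftrightarrow> (\<forall>k. \<forall>t\<in>I. (deriv ^^ k) q differentiable (at t))"

definition smooth_map_on :: "(real^'n::finite) set \<Rightarrow> (real^'n \<Rightarrow> real^'n) \<Rightarrow> bool"
  where "smooth_map_on S F \<longleftrightarrow> (\<forall>i. smooth_on S (\<lambda>x. F x $ i))"

definition smooth_matrix_on :: "(real^'n::finite) set \<Rightarrow> (real^'n \<Rightarrow> real^'n^'n) \<Rightarrow> bool"
  where "smooth_matrix_on S g \<longleftrightarrow> (\<forall>i j. smooth_on S (\<lambda>x. g x $ i $ j))"


section \<open>Smooth manifolds\<close>

text \<open>
  A chart is a pair of its domain and its coordinate map; the values of the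
  coordinate map outside the domain are irrelevant.
\<close>
type_synonym ('a, 'n) chart = "'a set \<times> ('a \<Rightarrow> real^'n)"

definition cdom :: "('a, 'n::finite) chart \<Rightarrow> 'a set"
  where "cdom c = fst c"

definition cmap :: "('a, 'n::finite) chart \<Rightarrow> 'a \<Rightarrow> real^'n"
  where "cmap c = snd c"

definition cinv :: "('a, 'n::finite) chart \<Rightarrow> real^'n \<Rightarrow> 'a"
  where "cinv c = inv_into (cdom c) (cmap c)"

definition is_chart :: "('a::topological_space, 'n::finite) chart \<Rightarrow> bool"
  where "is_chart c \<longleftrightarrow> open (cdom c) \<and> open (cmap c ` cdom c) \<and>
    homeomorphism (cdom c) (cmap c ` cdom c) (cmap c) (cinv c)"

definition transition :: "('a, 'n::finite) chart \<Rightarrow> ('a, 'n) chart \<Rightarrow> real^'n \<Rightarrow> real^'n"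
  where "transition c c' = cmap c' \<circ> cinv c"

definition compatible :: "('a, 'n::finite) chart \<Rightarrow> ('a, 'n) chart \<Rightarrow> bool"
  where "compatible c c' \<longleftrightarrow>
    smooth_map_on (cmap c ` (cdom c \<inter> cdom c')) (transition c c') \<and>
    smooth_map_on (cmap c' ` (cdom c \<inter> cdom c')) (transition c' c)"

text \<open>Maximal smooth atlas; the manifold is the whole type \<^typ>\<open>'a\<close>.\<close>
definition smooth_structure :: "('a::topological_space, 'n::finite) chart set \<Rightarrow> bool"
  where "smooth_structure atl \<longleftrightarrow>
    (\<forall>c\<in>atl. is_chart c) \<and>
    (\<Union>c\<in>atl. cdom c) = UNIV \<and>
    (\<forall>c\<in>atl. \<forall>c'\<in>atl. compatible c c') \<and>
    (\<forall>c. is_chart c \<and> (\<forall>c'\<in>atl. compatible c c') \<longrightarrow> c \<in> atl)"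


section \<open>Fields on a manifold\<close>

text \<open>
  A scalar field is a function on the manifold. A covariant tensor field is given
  classically, by its components in every chart of the atlas, as functions of the
  coordinates, subject to the tensor transformation law on overlaps. Vector fields
  are identified with 1-forms by means of the metric.
\<close>
type_synonym ('a, 'n) one_form = "('a, 'n) chart \<Rightarrow> real^'n \<Rightarrow> real^'n"
type_synonym ('a, 'n) two_tensor = "('a, 'n) chart \<Rightarrow> real^'n \<Rightarrow> real^'n^'n"

definition jacobian :: "('a, 'n::finite) chart \<Rightarrow> ('a, 'n) chart \<Rightarrow> real^'n \<Rightarrow> real^'n^'n"
  where "jacobian c c' x = (\<chi> a i. pd i (\<lambda>y. transition c c' y $ a) x)"

definition crep :: "('a, 'n::finite) chart \<Rightarrow> ('a \<Rightarrow> real) \<Rightarrow> real^'n \<Rightarrow> real"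
  where "crep c s = s \<circ> cinv c"

definition scalar_field_on :: "('a, 'n::finite) chart set \<Rightarrow> 'a set \<Rightarrow> ('a \<Rightarrow> real) \<Rightarrow> bool"
  where "scalar_field_on atl N s \<longleftrightarrow>
    (\<forall>c\<in>atl. smooth_on (cmap c ` (cdom c \<inter> N)) (crep c s))"

definition one_form_on :: "('a, 'n::finite) chart set \<Rightarrow> 'a set \<Rightarrow> ('a, 'n) one_form \<Rightarrow> bool"
  where "one_form_on atl N w \<longleftrightarrow>
    (\<forall>c\<in>atl. smooth_map_on (cmap c ` (cdom c \<inter> N)) (w c)) \<and>
    (\<forall>c\<in>atl. \<forall>c'\<in>atl. \<forall>p \<in> cdom c \<inter> cdom c' \<inter> N.
       w c (cmap c p) = transpose (jacobian c c' (cmap c p)) *v w c' (cmap c' p))"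

definition two_tensor_on :: "('a, 'n::finite) chart set \<Rightarrow> 'a set \<Rightarrow> ('a, 'n) two_tensor \<Rightarrow> bool"
  where "two_tensor_on atl N g \<longleftrightarrow>
    (\<forall>c\<in>atl. smooth_matrix_on (cmap c ` (cdom c \<inter> N)) (g c)) \<and>
    (\<forall>c\<in>atl. \<forall>c'\<in>atl. \<forall>p \<in> cdom c \<inter> cdom c' \<inter> N.
       g c (cmap c p) = transpose (jacobian c c' (cmap c p)) ** g c' (cmap c' p)
                          ** jacobian c c' (cmap c p))"

text \<open>Signature \<open>(-,+,\<dots>,+)\<close>: congruent to \<open>diag(-1,1,\<dots>,1)\<close>.\<close>
definition lorentzian_form :: "real^'n::finite^'n \<Rightarrow> bool"
  where "lorentzian_form G \<longleftrightarrow> (\<exists>(P::real^'n^'n) (t::'n). invertible P \<and>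
    transpose P ** G ** P = (\<chi> i j. if i = j then (if i = t then -1 else 1) else 0))"

definition riemannian_form :: "real^'n::finite^'n \<Rightarrow> bool"
  where "riemannian_form G \<longleftrightarrow> transpose G = G \<and> (\<forall>v. v \<noteq> 0 \<longrightarrow> 0 < v \<bullet> (G *v v))"

definition lorentzian_manifold ::
    "('a::topological_space, 'n::finite) chart set \<Rightarrow> ('a, 'n) two_tensor \<Rightarrow> bool"
  where "lorentzian_manifold atl g \<longleftrightarrow> smooth_structure atl \<and> two_tensor_on atl UNIV g \<and>
    (\<forall>c\<in>atl. \<forall>x \<in> cmap c ` cdom c. lorentzian_form (g c x))"


section \<open>Coordinate tensor calculus\<close>

text \<open>Here \<open>g\<close> is the component matrix of a metric in one fixed coordinate system.\<close>

definition ginv :: "(real^'n::finite \<Rightarrow> real^'n^'n) \<Rightarrow> 'n \<Rightarrow> 'n \<Rightarrow> real^'n \<Rightarrow> real"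
  where "ginv g i j x = matrix_inv (g x) $ i $ j"

text \<open>\<open>christoffel g m i j = \<Gamma>\<^sup>m\<^sub>i\<^sub>j\<close>\<close>
definition christoffel :: "(real^'n::finite \<Rightarrow> real^'n^'n) \<Rightarrow> 'n \<Rightarrow> 'n \<Rightarrow> 'n \<Rightarrow> real^'n \<Rightarrow> real"
  where "christoffel g m i j x = (\<Sum>l\<in>UNIV. ginv g m l x *
    (pd i (\<lambda>y. g y $ j $ l) x + pd j (\<lambda>y. g y $ i $ l) x - pd l (\<lambda>y. g y $ i $ j) x)) / 2"

text \<open>\<open>cov1 g k w j = \<nabla>\<^sub>k w\<^sub>j\<close>\<close>
definition cov1 :: "(real^'n::finite \<Rightarrow> real^'n^'n) \<Rightarrow> 'n \<Rightarrow> (real^'n \<Rightarrow> real^'n) \<Rightarrow> 'n \<Rightarrow> real^'n \<Rightarrow> real"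
  where "cov1 g k w j x = pd k (\<lambda>y. w y $ j) x - (\<Sum>m\<in>UNIV. christoffel g m k j x * w x $ m)"

text \<open>\<open>cov4 g s T j k l m = \<nabla>\<^sub>s T\<^sub>j\<^sub>k\<^sub>l\<^sub>m\<close>\<close>
definition cov4 :: "(real^'n::finite \<Rightarrow> real^'n^'n) \<Rightarrow> 'n \<Rightarrow>
    ('n \<Rightarrow> 'n \<Rightarrow> 'n \<Rightarrow> 'n \<Rightarrow> real^'n \<Rightarrow> real) \<Rightarrow> 'n \<Rightarrow> 'n \<Rightarrow> 'n \<Rightarrow> 'n \<Rightarrow> real^'n \<Rightarrow> real"
  where "cov4 g s T j k l m x = pd s (T j k l m) x -
    (\<Sum>p\<in>UNIV. christoffel g p s j x * T p k l m x + christoffel g p s k x * T j p l m x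
            + christoffel g p s l x * T j k p m x + christoffel g p s m x * T j k l p x)"

text \<open>
  \<open>riemann_up g j k l m = R\<^sub>j\<^sub>k\<^sub>l\<^sup>m\<close>, the coefficient of \<open>X\<^sub>m\<close> in
  \<open>(\<nabla>\<^sub>j \<nabla>\<^sub>k - \<nabla>\<^sub>k \<nabla>\<^sub>j) X\<^sub>l\<close>.
\<close>
definition riemann_up :: "(real^'n::finite \<Rightarrow> real^'n^'n) \<Rightarrow> 'n \<Rightarrow> 'n \<Rightarrow> 'n \<Rightarrow> 'n \<Rightarrow> real^'n \<Rightarrow> real"
  where "riemann_up g j k l m x =
    pd k (christoffel g m j l) x - pd j (christoffel g m k l) x
    + (\<Sum>p\<in>UNIV. christoffel g p j l x * christoffel g m k p x
              - christoffel g p k l x * christoffel g m j p x)"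

definition riemann :: "(real^'n::finite \<Rightarrow> real^'n^'n) \<Rightarrow> 'n \<Rightarrow> 'n \<Rightarrow> 'n \<Rightarrow> 'n \<Rightarrow> real^'n \<Rightarrow> real"
  where "riemann g j k l m x = (\<Sum>p\<in>UNIV. riemann_up g j k l p x * g x $ p $ m)"

definition ricci :: "(real^'n::finite \<Rightarrow> real^'n^'n) \<Rightarrow> 'n \<Rightarrow> 'n \<Rightarrow> real^'n \<Rightarrow> real"
  where "ricci g j m x = - (\<Sum>k\<in>UNIV. \<Sum>l\<in>UNIV. ginv g k l x * riemann g j k l m x)"

definition scal :: "(real^'n::finite \<Rightarrow> real^'n^'n) \<Rightarrow> real^'n \<Rightarrow> real"
  where "scal g x = (\<Sum>i\<in>UNIV. \<Sum>j\<in>UNIV. ginv g i j x * ricci g i j x)"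

definition weyl :: "(real^'n::finite \<Rightarrow> real^'n^'n) \<Rightarrow> 'n \<Rightarrow> 'n \<Rightarrow> 'n \<Rightarrow> 'n \<Rightarrow> real^'n \<Rightarrow> real"
  where "weyl g j k l m x = (let n = real CARD('n) in
    riemann g j k l m x
    + (g x $ j $ m * ricci g k l x - g x $ k $ m * ricci g j l x
       + ricci g j m x * g x $ k $ l - ricci g k m x * g x $ j $ l) / (n - 2)
    - (g x $ j $ m * g x $ k $ l - g x $ m $ k * g x $ j $ l) * scal g x / ((n - 1) * (n - 2)))"

text \<open>\<open>\<nabla>\<^sub>m C\<^sub>j\<^sub>k\<^sub>l\<^sup>m = g\<^sup>m\<^sup>s \<nabla>\<^sub>s C\<^sub>j\<^sub>k\<^sub>l\<^sub>m\<close>\<close>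
definition div_weyl :: "(real^'n::finite \<Rightarrow> real^'n^'n) \<Rightarrow> 'n \<Rightarrow> 'n \<Rightarrow> 'n \<Rightarrow> real^'n \<Rightarrow> real"
  where "div_weyl g j k l x =
    (\<Sum>m\<in>UNIV. \<Sum>s\<in>UNIV. ginv g m s x * cov4 g s (weyl g) j k l m x)"

text \<open>\<open>w\<^sup>j w\<^sub>j\<close>\<close>
definition sq_norm :: "(real^'n::finite \<Rightarrow> real^'n^'n) \<Rightarrow> (real^'n \<Rightarrow> real^'n) \<Rightarrow> real^'n \<Rightarrow> real"
  where "sq_norm g w x = (\<Sum>i\<in>UNIV. \<Sum>j\<in>UNIV. ginv g i j x * w x $ i * w x $ j)"


section \<open>Special vector fields\<close>

definition closed_one_form :: "('a, 'n::finite) chart set \<Rightarrow> ('a, 'n) two_tensor \<Rightarrow> ('a, 'n) one_form \<Rightarrow> bool"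
  where "closed_one_form atl g u \<longleftrightarrow>
    (\<forall>c\<in>atl. \<forall>x \<in> cmap c ` cdom c. \<forall>k j. cov1 (g c) k (u c) j x - cov1 (g c) j (u c) k x = 0)"

definition gradient_on ::
    "('a, 'n::finite) chart set \<Rightarrow> 'a set \<Rightarrow> ('a \<Rightarrow> real) \<Rightarrow> ('a, 'n) one_form \<Rightarrow> bool"
  where "gradient_on atl N s w \<longleftrightarrow>
    (\<forall>c\<in>atl. \<forall>x \<in> cmap c ` (cdom c \<inter> N). \<forall>k. pd k (crep c s) x = w c x $ k)"

definition locally_gradient :: "('a::topological_space, 'n::finite) chart set \<Rightarrow> ('a, 'n) one_form \<Rightarrow> bool"
  where "locally_gradient atl w \<longleftrightarrow>
    (\<forall>p. \<exists>N s. open N \<and> p \<in> N \<and> scalar_field_on atl N s \<and> gradient_on atl N s w)"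

definition torse_forming :: "('a, 'n::finite) chart set \<Rightarrow> ('a, 'n) two_tensor \<Rightarrow> ('a, 'n) one_form \<Rightarrow>
    ('a, 'n) one_form \<Rightarrow> ('a \<Rightarrow> real) \<Rightarrow> bool"
  where "torse_forming atl g v \<omega> f \<longleftrightarrow> one_form_on atl UNIV v \<and>
    one_form_on atl UNIV \<omega> \<and> scalar_field_on atl UNIV f \<and>
    (\<forall>c\<in>atl. \<forall>x \<in> cmap c ` cdom c. \<forall>k j.
       cov1 (g c) k (v c) j x = \<omega> c x $ k * v c x $ j + crep c f x * g c x $ j $ k)"

text \<open>A gradient is in particular locally a gradient, so the latter covers both cases.\<close>
definition concircular :: "('a::topological_space, 'n::finite) chart set \<Rightarrow> ('a, 'n) two_tensor \<Rightarrow>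
    ('a, 'n) one_form \<Rightarrow> ('a, 'n) one_form \<Rightarrow> ('a \<Rightarrow> real) \<Rightarrow> bool"
  where "concircular atl g v \<omega> f \<longleftrightarrow> torse_forming atl g v \<omega> f \<and> locally_gradient atl \<omega>"

definition rescale :: "('a \<Rightarrow> real) \<Rightarrow> ('a, 'n::finite) one_form \<Rightarrow> ('a, 'n) one_form"
  where "rescale h v c x = crep c h x *\<^sub>R v c x"

definition timelike_on ::
    "('a, 'n::finite) chart set \<Rightarrow> ('a, 'n) two_tensor \<Rightarrow> 'a set \<Rightarrow> ('a, 'n) one_form \<Rightarrow> bool"
  where "timelike_on atl g N X \<longleftrightarrow>
    (\<forall>c\<in>atl. \<forall>x \<in> cmap c ` (cdom c \<inter> N). sq_norm (g c) (X c) x < 0)"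

definition conformal_killing_on :: "('a, 'n::finite) chart set \<Rightarrow> ('a, 'n) two_tensor \<Rightarrow> 'a set \<Rightarrow>
    ('a, 'n) one_form \<Rightarrow> ('a \<Rightarrow> real) \<Rightarrow> bool"
  where "conformal_killing_on atl g N X \<rho> \<longleftrightarrow> one_form_on atl N X \<and> scalar_field_on atl N \<rho> \<and>
    (\<forall>c\<in>atl. \<forall>x \<in> cmap c ` (cdom c \<inter> N). \<forall>i j.
       cov1 (g c) i (X c) j x + cov1 (g c) j (X c) i x = 2 * crep c \<rho> x * g c x $ i $ j)"


section \<open>Space-times\<close>

definition perfect_fluid :: "('a, 'n::finite) chart set \<Rightarrow> ('a, 'n) two_tensor \<Rightarrow>
    ('a \<Rightarrow> real) \<Rightarrow> ('a \<Rightarrow> real) \<Rightarrow> ('a, 'n) one_form \<Rightarrow> bool"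
  where "perfect_fluid atl g A B u \<longleftrightarrow>
    scalar_field_on atl UNIV A \<and> scalar_field_on atl UNIV B \<and> one_form_on atl UNIV u \<and>
    (\<forall>c\<in>atl. \<forall>x \<in> cmap c ` cdom c. sq_norm (g c) (u c) x = -1 \<and>
       (\<forall>k l. ricci (g c) k l x = crep c A x * g c x $ k $ l + crep c B x * u c x $ k * u c x $ l))"

definition div_free_weyl :: "('a, 'n::finite) chart set \<Rightarrow> ('a, 'n) two_tensor \<Rightarrow> bool"
  where "div_free_weyl atl g \<longleftrightarrow>
    (\<forall>c\<in>atl. \<forall>x \<in> cmap c ` cdom c. \<forall>j k l. div_weyl (g c) j k l x = 0)"

text \<open>
  An \<open>n\<close>-dimensional space-time is coordinatised by \<^typ>\<open>real^('m option)\<close>, where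
  \<open>n = CARD('m) + 1\<close>; in warped-product coordinates \<^term>\<open>None\<close> is the time index and
  \<open>Some \<alpha>\<close> are the space indices, so that the fiber is coordinatised by \<^typ>\<open>real^'m\<close>.
\<close>
definition space_part :: "real^('m::finite option) \<Rightarrow> real^'m"
  where "space_part x = (\<chi> \<alpha>. x $ Some \<alpha>)"

definition riemannian_metric_on :: "(real^'m::finite) set \<Rightarrow> (real^'m \<Rightarrow> real^'m^'m) \<Rightarrow> bool"
  where "riemannian_metric_on V h \<longleftrightarrow> smooth_matrix_on V h \<and> (\<forall>y\<in>V. riemannian_form (h y))"

definition einstein_on :: "(real^'m::finite) set \<Rightarrow> (real^'m \<Rightarrow> real^'m^'m) \<Rightarrow> bool"
  where "einstein_on V h \<longleftrightarrow> (\<exists>\<mu>::real. \<forall>y\<in>V. \<forall>\<alpha> \<beta>. ricci h \<alpha> \<beta> y = \<mu> * h y $ \<alpha> $ \<beta>)"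

text \<open>
  In the chart \<open>c\<close>, with coordinate range \<open>I \<times> V\<close>, the metric is
  \<open>-dt\<^sup>2 + q(t)\<^sup>2 h\<^sub>\<alpha>\<^sub>\<beta>(y) dy\<^sup>\<alpha> dy\<^sup>\<beta>\<close>.
\<close>
definition warped_chart :: "('a, 'm::finite option) two_tensor \<Rightarrow> ('a, 'm option) chart \<Rightarrow>
    real set \<Rightarrow> (real^'m) set \<Rightarrow> (real \<Rightarrow> real) \<Rightarrow> (real^'m \<Rightarrow> real^'m^'m) \<Rightarrow> bool"
  where "warped_chart g c I V q h \<longleftrightarrow>
    open I \<and> connected I \<and> open V \<and> connected V \<and>
    cmap c ` cdom c = {x. x $ None \<in> I \<and> space_part x \<in> V} \<and>
    smooth_real_on I q \<and> (\<forall>t\<in>I. 0 < q t) \<and> riemannian_metric_on V h \<and>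
    (\<forall>x \<in> cmap c ` cdom c.
       g c x $ None $ None = -1 \<and>
       (\<forall>\<alpha>. g c x $ None $ Some \<alpha> = 0 \<and> g c x $ Some \<alpha> $ None = 0) \<and>
       (\<forall>\<alpha> \<beta>. g c x $ Some \<alpha> $ Some \<beta> = (q (x $ None))\<^sup>2 * h (space_part x) $ \<alpha> $ \<beta>))"

text \<open>
  Generalized Robertson-Walker space-time: near every point the metric takes the
  warped-product form above, here moreover with a fiber \<open>(V, h)\<close> satisfying \<open>P\<close>.
\<close>
definition grw_with_fiber :: "('a, 'm::finite option) chart set \<Rightarrow> ('a, 'm option) two_tensor \<Rightarrow>
    ((real^'m) set \<Rightarrow> (real^'m \<Rightarrow> real^'m^'m) \<Rightarrow> bool) \<Rightarrow> bool"
  where "grw_with_fiber atl g P \<longleftrightarrow>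
    (\<forall>p. \<exists>c\<in>atl. p \<in> cdom c \<and> (\<exists>I V q h. warped_chart g c I V q h \<and> P V h))"

end

theory Submission
  imports Defs
begin

text \<open>
  By the second Bianchi identity, a divergence-free Weyl tensor makes the Cotton tensor vanish. For
  \<open>R\<^sub>k\<^sub>l = A g\<^sub>k\<^sub>l + B u\<^sub>k u\<^sub>l\<close> with \<open>u\<close> closed and unit, contracting the resulting equation with \<open>g\<close> and \<open>u\<close>
  gives \<open>B \<nabla>\<^sub>k u\<^sub>l = B f (g\<^sub>k\<^sub>l + u\<^sub>k u\<^sub>l)\<close>, where \<open>(n - 1) f\<close> is the divergence of \<open>u\<close>, and shows that the
  gradients of \<open>A\<close> and \<open>B\<close> are parallel to \<open>u\<close>. As \<open>B \<noteq> 0\<close> on a dense set, \<open>u\<close> is torse-forming everywhere.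
  The Ricci identity for \<open>u\<close> then yields \<open>\<nabla>f = (f\<^sup>2 + (A - B) / (1 - n)) u\<close>, so \<open>\<omega> = f u\<close> is closed, hence locally
  a gradient; it also gives the rescaled conformal Killing vector and \<open>C\<^sub>j\<^sub>k\<^sub>l\<^sub>m u\<^sup>m = 0\<close>.

  For the warped form, write \<open>u = - d\<tau>\<close> locally and straighten the vector field \<open>u\<close>: the flow is obtained by
  Picard iteration, whose iterates converge uniformly together with all derivatives. In flow coordinates with
  time \<open>\<tau>\<close> the torse-forming equation reads \<open>\<partial>\<^sub>t g\<^sub>\<alpha>\<^sub>\<beta> = 2 f g\<^sub>\<alpha>\<^sub>\<beta>\<close>, and \<open>f\<close> and \<open>A\<close> depend on \<open>t\<close> only, so that the
  metric is a warped product and the fibre, realised as the slice \<open>t = 0\<close>, is Einstein with constant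
  \<open>A - \<partial>\<^sub>t f - (n - 1) f\<^sup>2\<close>.
\<close>

section \<open>Smooth functions\<close>

text \<open>Where \<open>B\<close> vanishes on an open set the metric is Einstein, its Weyl tensor
  is automatically divergence-free, and \<open>u\<close> can be any closed unit field. Hence the
  density of the set where \<open>B\<close> is nonzero, and the passage to its closure by
  continuity. The scalar \<open>f\<close> is computed chart by chart, so its independence of the
  chart has to be shown before it can serve as a field. The warped form must hold in a chart of the
  given atlas, so the flow has to be smooth jointly in time and initial point. If the domain of the
  iteration shrank with the order of differentiation, no chart would be left; its size is therefore
  fixed by first derivatives alone. The sign in \<open>u = - d\<tau>\<close> compensates the norm
  -1: along the raised \<open>u\<close> the function \<tau> grows at unit rate. In flow coordinates
  \<open>u\<close> then has the constant components (-1, 0, ..., 0), and its covariant derivative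
  consists of Christoffel symbols only. The warping factor solves \<open>q' = f q\<close> with
  \<open>q 0 = 1\<close>.\<close>

lemma pd_eq:
  assumes "(f has_derivative f') (at x)"
  shows "pd i f x = f' (axis i 1)"
  using frechet_derivative_at[OF assms] by (simp add: pd_def)

lemma sum_axis:
  "(\<Sum>j\<in>UNIV. axis i 1 $ j * F j) = (F i :: real)" "(\<Sum>j\<in>UNIV. (h *\<^sub>R axis i 1) $ j * F j) = h * (F i :: real)"
  by (simp_all add: axis_def if_distrib[of "\<lambda>z. z * _"] if_distrib[of "\<lambda>z. _ * z"] cong: if_cong)

lemma has_derivative_pd:
  fixes f :: "real^'n::finite \<Rightarrow> real"
  assumes "f differentiable (at x)"
  shows "(f has_derivative (\<lambda>h. \<Sum>i\<in>UNIV. h $ i * pd i f x)) (at x)"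
proof -
  have d: "(f has_derivative frechet_derivative f (at x)) (at x)"
    using assms by (simp add: frechet_derivative_works)
  then have lin: "linear (frechet_derivative f (at x))"
    by (rule has_derivative_linear)
  have "frechet_derivative f (at x) h = (\<Sum>i\<in>UNIV. h $ i * pd i f x)" for h
  proof -
    have "frechet_derivative f (at x) h = frechet_derivative f (at x) (\<Sum>i\<in>UNIV. h $ i *\<^sub>R axis i 1)"
      by (metis basis_expansion scalar_mult_eq_scaleR)
    also have "\<dots> = (\<Sum>i\<in>UNIV. h $ i * pd i f x)"
      by (simp add: linear_sum[OF lin] linear_cmul[OF lin] pd_def)
    finally show ?thesis .
  qed
  then show ?thesis using d by (metis (no_types, lifting) ext)
qed

lemma has_derivative_cong_open:
  assumes "open S" "x \<in> S" "\<And>y. y \<in> S \<Longrightarrow> f y = g y"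
  shows "(f has_derivative D) (at x) \<longleftrightarrow> (g has_derivative D) (at x)"
  using assms has_derivative_transform_within_open by metis

lemma differentiable_cong_open:
  assumes "open S" "x \<in> S" "\<And>y. y \<in> S \<Longrightarrow> f y = g y"
  shows "f differentiable (at x) \<longleftrightarrow> g differentiable (at x)"
  unfolding differentiable_def using has_derivative_cong_open[OF assms] by simp

lemma pd_cong_open:
  assumes "open S" "x \<in> S" "\<And>y. y \<in> S \<Longrightarrow> f y = g y"
  shows "pd i f x = pd i g x"
  unfolding pd_def frechet_derivative_def using has_derivative_cong_open[OF assms] by simp

lemma pd_const [simp]: "pd i (\<lambda>x. c) x = 0"
  by (simp add: pd_eq[OF has_derivative_const])

lemma pd_coord: "pd i (\<lambda>x::real^'n::finite. x $ j) x = (if i = j then 1 else 0)"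
proof -
  have "((\<lambda>x::real^'n. x $ j) has_derivative (\<lambda>h. h $ j)) (at x)"
    by (intro has_derivative_bounded_linear bounded_linear_vec_nth bounded_linear_imp_has_derivative)
  from pd_eq[OF this, of i] show ?thesis by (simp add: axis_def)
qed

lemma pd_add:
  assumes "f differentiable (at x)" "g differentiable (at x)"
  shows "pd i (\<lambda>x. f x + g x) x = pd i f x + pd i g x"
  using pd_eq[OF has_derivative_add[OF has_derivative_pd[OF assms(1)] has_derivative_pd[OF assms(2)]], of i]
  by (simp add: sum_axis)

lemma pd_mult:
  assumes "f differentiable (at x)" "g differentiable (at x)"
  shows "pd i (\<lambda>x. f x * g x) x = pd i f x * g x + f x * pd i g x"
  using pd_eq[OF has_derivative_mult[OF has_derivative_pd[OF assms(1)] has_derivative_pd[OF assms(2)]], of i]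
  by (simp add: sum_axis)

lemma pd_cmult:
  assumes "f differentiable (at x)"
  shows "pd i (\<lambda>x. c * f x) x = c * pd i f x"
  using pd_mult[OF differentiable_const assms] by simp

lemma pd_minus:
  assumes "f differentiable (at x)"
  shows "pd i (\<lambda>x. - f x) x = - pd i f x"
  using pd_cmult[OF assms, of i "-1"] by simp

lemma pd_diff:
  assumes "f differentiable (at x)" "g differentiable (at x)"
  shows "pd i (\<lambda>x. f x - g x) x = pd i f x - pd i g x"
  using pd_add[OF assms(1) differentiable_minus[OF assms(2)], of i] pd_minus[OF assms(2), of i] by simp

lemma differentiable_sum_all:
  assumes "finite A" "\<And>a. a \<in> A \<Longrightarrow> f a differentiable (at x)"
  shows "(\<lambda>x. \<Sum>a\<in>A. f a x) differentiable (at x)"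
  using assms by (induction A rule: finite_induct) auto

lemma pd_sum:
  assumes "finite A" "\<And>a. a \<in> A \<Longrightarrow> f a differentiable (at x)"
  shows "pd i (\<lambda>x. \<Sum>a\<in>A. f a x) x = (\<Sum>a\<in>A. pd i (f a) x)"
  using assms
proof (induction A rule: finite_induct)
  case (insert b A)
  then have "(\<lambda>x. \<Sum>a\<in>A. f a x) differentiable (at x)"
    by (intro differentiable_sum_all) auto
  then show ?case using insert by (simp add: pd_add)
qed simp

lemma has_derivative_vec_pd:
  fixes \<psi> :: "real^'m::finite \<Rightarrow> real^'n::finite"
  assumes "\<And>a. (\<lambda>y. \<psi> y $ a) differentiable (at x)"
  shows "(\<psi> has_derivative (\<lambda>h. \<chi> a. \<Sum>i\<in>UNIV. h $ i * pd i (\<lambda>y. \<psi> y $ a) x)) (at x)"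
proof -
  have "\<forall>a. ((\<lambda>y. \<psi> y $ a) has_derivative (\<lambda>h. \<Sum>i\<in>UNIV. h $ i * pd i (\<lambda>y. \<psi> y $ a) x)) (at x)"
    by (intro allI has_derivative_pd assms)
  then show ?thesis
    by (subst has_derivative_componentwise_within)
      (auto simp: Basis_vec_def inner_axis)
qed

lemma
  fixes \<psi> :: "real^'m::finite \<Rightarrow> real^'n::finite" and f :: "real^'n \<Rightarrow> real"
  assumes "\<And>a. (\<lambda>y. \<psi> y $ a) differentiable (at x)" "f differentiable (at (\<psi> x))"
  shows differentiable_chain: "(\<lambda>y. f (\<psi> y)) differentiable (at x)"
    and pd_chain: "pd i (\<lambda>y. f (\<psi> y)) x = (\<Sum>a\<in>UNIV. pd a f (\<psi> x) * pd i (\<lambda>y. \<psi> y $ a) x)"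
proof -
  have d: "((\<lambda>y. f (\<psi> y)) has_derivative (\<lambda>h. \<Sum>a\<in>UNIV. (\<chi> a. \<Sum>i\<in>UNIV. h $ i * pd i (\<lambda>y. \<psi> y $ a) x) $ a * pd a f (\<psi> x))) (at x)"
    by (rule has_derivative_compose[OF has_derivative_vec_pd[OF assms(1)] has_derivative_pd[OF assms(2)]])
  then show "(\<lambda>y. f (\<psi> y)) differentiable (at x)" unfolding differentiable_def by blast
  show "pd i (\<lambda>y. f (\<psi> y)) x = (\<Sum>a\<in>UNIV. pd a f (\<psi> x) * pd i (\<lambda>y. \<psi> y $ a) x)"
    using pd_eq[OF d, of i] by (simp add: sum_axis mult.commute)
qed

lemma pd_real_compose:
  assumes "f differentiable (at x)" "(\<phi> has_real_derivative D) (at (f x))"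
  shows "(\<lambda>y. \<phi> (f y)) differentiable (at x)" "pd i (\<lambda>y. \<phi> (f y)) x = D * pd i f x"
proof -
  have d: "((\<lambda>y. \<phi> (f y)) has_derivative (\<lambda>h. D * (\<Sum>i\<in>UNIV. h $ i * pd i f x))) (at x)"
    using has_derivative_compose[OF has_derivative_pd[OF assms(1)] assms(2)[unfolded has_field_derivative_def]]
    by simp
  then show "(\<lambda>y. \<phi> (f y)) differentiable (at x)" unfolding differentiable_def by blast
  show "pd i (\<lambda>y. \<phi> (f y)) x = D * pd i f x"
    using pd_eq[OF d, of i] by (simp add: sum_axis)
qed

lemma pd_exp:
  assumes "f differentiable (at x)"
  shows "pd i (\<lambda>y. exp (f y)) x = exp (f x) * pd i f x"
  by (rule pd_real_compose(2)[OF assms DERIV_exp])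

lemma differentiable_exp:
  assumes "f differentiable (at x)"
  shows "(\<lambda>y. exp (f y) :: real) differentiable (at (x::real^'n::finite))"
  by (rule pd_real_compose(1)[OF assms DERIV_exp])

lemma pd_inverse:
  assumes "f differentiable (at x)" "f x \<noteq> 0"
  shows "pd i (\<lambda>y. inverse (f y)) x = - (inverse (f x) * inverse (f x)) * pd i f x"
  using pd_real_compose(2)[OF assms(1) DERIV_inverse[OF assms(2)]] by (simp add: numeral_2_eq_2)

text \<open>\<open>smooth_on\<close> quantifies over lists of indices; recursion on the order
  provides the induction by which the closure properties are proved. Already \<open>ck 0\<close>
  asks for differentiability, so \<open>ck k\<close> speaks of k + 1 differentiations.\<close>

primrec ck :: "nat \<Rightarrow> (real^'n::finite) set \<Rightarrow> (real^'n \<Rightarrow> real) \<Rightarrow> bool" where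
  "ck 0 S f = (\<forall>x\<in>S. f differentiable (at x))"
| "ck (Suc k) S f = ((\<forall>x\<in>S. f differentiable (at x)) \<and> (\<forall>i. ck k S (pd i f)))"

lemma ck_differentiable: "ck k S f \<Longrightarrow> x \<in> S \<Longrightarrow> f differentiable (at x)"
  by (cases k) auto

lemma ck_mono: "ck (Suc k) S f \<Longrightarrow> ck k S f"
  by (induction k arbitrary: f) auto

lemma ck_iff_foldr: "ck k S f \<longleftrightarrow> (\<forall>is. length is \<le> k \<longrightarrow> (\<forall>x\<in>S. foldr pd is f differentiable (at x)))"
proof (induction k arbitrary: f)
  case (Suc k)
  show ?case
  proof
    assume L: "ck (Suc k) S f"
    show "\<forall>is. length is \<le> Suc k \<longrightarrow> (\<forall>x\<in>S. foldr pd is f differentiable (at x))"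
    proof (intro allI impI)
      fix js :: "'a list" assume l: "length js \<le> Suc k"
      show "\<forall>x\<in>S. foldr pd js f differentiable (at x)"
      \<comment> \<open>\<open>foldr\<close> applies the last index of the list first, so the list
        is split at its end to match \<open>pd i f\<close> in the recursion.\<close>
      proof (cases js rule: rev_cases)
        case Nil then show ?thesis using L by simp
      next
        case (snoc ys y) then show ?thesis using L l Suc.IH[of "pd y f"] by simp
      qed
    qed
  next
    assume R: "\<forall>is. length is \<le> Suc k \<longrightarrow> (\<forall>x\<in>S. foldr pd is f differentiable (at x))"
    have "ck k S (pd i f)" for i
      unfolding Suc.IH
    proof (intro allI impI)
      fix js :: "'a list" assume "length js \<le> k"
      then show "\<forall>x\<in>S. foldr pd js (pd i f) differentiable (at x)"
        using R[rule_format, of "js @ [i]"] by simp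
    qed
    then show "ck (Suc k) S f" using R[rule_format, of "[]"] by simp
  qed
qed simp

lemma smooth_on_iff_ck: "smooth_on S f \<longleftrightarrow> (\<forall>k. ck k S f)"
  unfolding smooth_on_def ck_iff_foldr by auto

lemma smooth_on_differentiable: "smooth_on S f \<Longrightarrow> x \<in> S \<Longrightarrow> f differentiable (at x)"
  using smooth_on_iff_ck ck_differentiable by blast

lemma smooth_on_pd: "smooth_on S f \<Longrightarrow> smooth_on S (pd i f)"
  unfolding smooth_on_iff_ck using ck.simps(2) by blast

lemma smooth_on_continuous: "smooth_on S f \<Longrightarrow> continuous_on S f"
  by (meson continuous_at_imp_continuous_on differentiable_imp_continuous_within smooth_on_differentiable)

lemma smooth_on_subset: "smooth_on S f \<Longrightarrow> T \<subseteq> S \<Longrightarrow> smooth_on T f"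
  unfolding smooth_on_def by blast

lemma ck_cong:
  assumes "open S" "\<And>x. x \<in> S \<Longrightarrow> f x = g x"
  shows "ck k S f \<longleftrightarrow> ck k S g"
  using assms(2)
proof (induction k arbitrary: f g)
  case 0 then show ?case using differentiable_cong_open[OF assms(1)] by (metis ck.simps(1))
next
  case (Suc k)
  have "pd i f x = pd i g x" if "x \<in> S" for x i
    by (rule pd_cong_open[OF assms(1) that]) (use Suc.prems in auto)
  then have "ck k S (pd i f) \<longleftrightarrow> ck k S (pd i g)" for i by (intro Suc.IH) auto
  then show ?case using differentiable_cong_open[OF assms(1), of _ f g] Suc.prems by (metis ck.simps(2))
qed

lemma smooth_on_cong:
  assumes "open S" "\<And>x. x \<in> S \<Longrightarrow> f x = g x"
  shows "smooth_on S f \<longleftrightarrow> smooth_on S g"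
  unfolding smooth_on_iff_ck using ck_cong[of S f g, OF assms(1)] assms(2) by blast

text \<open>A formula \<open>f'\<close> for the partial derivatives need hold on the open set
  \<open>S\<close> only; outside nothing is known about \<open>pd i f\<close>. The closure
  properties take the rule of calculus for their operation as \<open>f'\<close>.\<close>

lemma ck_SucI:
  assumes "open S" "\<And>x. x \<in> S \<Longrightarrow> f differentiable (at x)"
    "\<And>i. ck k S (f' i)" "\<And>i x. x \<in> S \<Longrightarrow> pd i f x = f' i x"
  shows "ck (Suc k) S f"
proof -
  have "ck k S (pd i f)" for i
    using ck_cong[OF assms(1), of "pd i f" "f' i" k] assms(3,4) by blast
  then show ?thesis using assms(2) by simp
qed

lemma smooth_onI:
  assumes "open S" "\<And>x. x \<in> S \<Longrightarrow> f differentiable (at x)"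
    "\<And>i. smooth_on S (f' i)" "\<And>i x. x \<in> S \<Longrightarrow> pd i f x = f' i x"
  shows "smooth_on S f"
  unfolding smooth_on_iff_ck
proof
  fix k show "ck k S f"
    by (rule ck_mono, rule ck_SucI[OF assms(1,2) _ assms(4)]) (use assms(3) smooth_on_iff_ck in auto)
qed

lemma ck_const: "ck k S (\<lambda>x. c)"
proof -
  have "pd i (\<lambda>x::real^'a. c) = (\<lambda>x. 0)" for i c by auto
  then show ?thesis by (induction k arbitrary: c) auto
qed

lemma ck_coord:
  assumes "open S" shows "ck k S (\<lambda>x. x $ j)"
proof -
  have d: "(\<lambda>x::real^'a. x $ j) differentiable (at x)" for x
    by (metis differentiable_def bounded_linear_vec_nth bounded_linear_imp_has_derivative)
  then show ?thesis
  proof (cases k)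
    case (Suc k) show ?thesis unfolding Suc
      by (rule ck_SucI[OF assms d, where f' = "\<lambda>i x. if i = j then 1 else 0"]) (auto simp: ck_const pd_coord)
  qed auto
qed

lemma ck_add:
  assumes "open S" "ck k S f" "ck k S g"
  shows "ck k S (\<lambda>x. f x + g x)"
  using assms(2,3)
proof (induction k arbitrary: f g)
  case (Suc k)
  show ?case
    by (rule ck_SucI[OF assms(1), where f' = "\<lambda>i x. pd i f x + pd i g x"])
      (use Suc in \<open>auto simp: pd_add\<close>)
qed auto

lemma ck_mult:
  assumes "open S" "ck k S f" "ck k S g"
  shows "ck k S (\<lambda>x. f x * g x)"
  using assms(2,3)
proof (induction k arbitrary: f g)
  case (Suc k)
  show ?case
  proof (rule ck_SucI[OF assms(1), where f' = "\<lambda>i x. pd i f x * g x + f x * pd i g x"])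
    show "ck k S (\<lambda>x. pd i f x * g x + f x * pd i g x)" for i
      using Suc.prems ck_mono by (intro ck_add[OF assms(1)] Suc.IH) auto
  qed (use Suc in \<open>auto simp: pd_mult\<close>)
qed auto

lemma ck_sum:
  assumes "open S" "\<And>a. a \<in> A \<Longrightarrow> ck k S (f a)"
  shows "ck k S (\<lambda>x. \<Sum>a\<in>A. f a x)"
  using assms(2)
  by (induction A rule: infinite_finite_induct) (auto simp: ck_const intro!: ck_add[OF assms(1)])

text \<open>The chain rule gives a sum of products of \<open>pd a f\<close> composed with
  \<open>\<psi>\<close>, covered by the induction hypothesis for \<open>pd a f\<close>, and of
  derivatives of \<open>\<psi>\<close>, which have one order less.\<close>

lemma ck_compose:
  fixes \<psi> :: "real^'m::finite \<Rightarrow> real^'n::finite"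
  assumes "open T" "\<And>a. ck k T (\<lambda>y. \<psi> y $ a)" "ck k S f" "\<And>y. y \<in> T \<Longrightarrow> \<psi> y \<in> S"
  shows "ck k T (\<lambda>y. f (\<psi> y))"
  using assms(2,3)
proof (induction k arbitrary: f)
  case 0 then show ?case using differentiable_chain assms(4) by (metis ck.simps(1))
next
  case (Suc k)
  show ?case
  proof (rule ck_SucI[OF assms(1), where f' = "\<lambda>i y. \<Sum>a\<in>UNIV. pd a f (\<psi> y) * pd i (\<lambda>y. \<psi> y $ a) y"])
    show "ck k T (\<lambda>y. \<Sum>a\<in>UNIV. pd a f (\<psi> y) * pd i (\<lambda>y. \<psi> y $ a) y)" for i
    proof (intro ck_sum[OF assms(1)] ck_mult[OF assms(1)])
      fix a
      show "ck k T (\<lambda>y. pd a f (\<psi> y))"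
        using Suc.IH[of "pd a f"] ck_mono[OF Suc.prems(1)] Suc.prems(2) by simp
      show "ck k T (pd i (\<lambda>y. \<psi> y $ a))" using Suc.prems(1) by simp
    qed
  next
    fix x assume "x \<in> T"
    then have d: "(\<lambda>y. \<psi> y $ a) differentiable (at x)" "f differentiable (at (\<psi> x))" for a
      using ck_differentiable[OF Suc.prems(1)] ck_differentiable[OF Suc.prems(2)] assms(4) by blast+
    show "(\<lambda>y. f (\<psi> y)) differentiable (at x)" by (rule differentiable_chain[OF d])
    show "pd i (\<lambda>y. f (\<psi> y)) x = (\<Sum>a\<in>UNIV. pd a f (\<psi> x) * pd i (\<lambda>y. \<psi> y $ a) x)" for i
      by (rule pd_chain[OF d])
  qed
qed

lemma ck_exp:
  assumes "open S" "ck k S f"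
  shows "ck k S (\<lambda>x. exp (f x))"
  using assms(2)
proof (induction k)
  case 0 then show ?case using differentiable_exp by (metis ck.simps(1))
next
  case (Suc k)
  show ?case
    by (rule ck_SucI[OF assms(1), where f' = "\<lambda>i x. exp (f x) * pd i f x"])
      (use Suc ck_mono[OF Suc.prems] in \<open>auto simp: pd_exp intro!: differentiable_exp ck_mult[OF assms(1)]\<close>)
qed

lemma ck_inverse:
  assumes "open S" "ck k S f" "\<And>x. x \<in> S \<Longrightarrow> f x \<noteq> 0"
  shows "ck k S (\<lambda>x. inverse (f x))"
  using assms(2)
proof (induction k)
  case 0 then show ?case using assms(3) by (auto intro!: differentiable_inverse)
next
  case (Suc k)
  show ?case
  proof (rule ck_SucI[OF assms(1), where f' = "\<lambda>i x. - 1 * (inverse (f x) * inverse (f x)) * pd i f x"])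
    show "ck k S (\<lambda>x. - 1 * (inverse (f x) * inverse (f x)) * pd i f x)" for i
      using Suc ck_mono[OF Suc.prems] by (intro ck_mult[OF assms(1)] ck_const) auto
  qed (use Suc.prems assms(3) in \<open>auto simp: pd_inverse intro!: differentiable_inverse\<close>)
qed

context
  fixes S :: "(real^'n::finite) set"
  assumes op: "open S"
begin

lemma smooth_on_const: "smooth_on S (\<lambda>x. c)"
  by (simp add: smooth_on_iff_ck ck_const)

lemma smooth_on_coord: "smooth_on S (\<lambda>x. x $ j)"
  by (simp add: smooth_on_iff_ck ck_coord[OF op])

lemma smooth_on_add: "smooth_on S f \<Longrightarrow> smooth_on S g \<Longrightarrow> smooth_on S (\<lambda>x. f x + g x)"
  by (simp add: smooth_on_iff_ck ck_add[OF op])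

lemma smooth_on_mult: "smooth_on S f \<Longrightarrow> smooth_on S g \<Longrightarrow> smooth_on S (\<lambda>x. f x * g x)"
  by (simp add: smooth_on_iff_ck ck_mult[OF op])

lemma smooth_on_minus: "smooth_on S f \<Longrightarrow> smooth_on S (\<lambda>x. - f x)"
  using smooth_on_mult[OF smooth_on_const, of f "-1"] by simp

lemma smooth_on_diff: "smooth_on S f \<Longrightarrow> smooth_on S g \<Longrightarrow> smooth_on S (\<lambda>x. f x - g x)"
  using smooth_on_add[OF _ smooth_on_minus, of f g] by simp

lemma smooth_on_sum: "(\<And>a. a \<in> A \<Longrightarrow> smooth_on S (f a)) \<Longrightarrow> smooth_on S (\<lambda>x. \<Sum>a\<in>A. f a x)"
  by (simp add: smooth_on_iff_ck ck_sum[OF op])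

lemma smooth_on_prod: "(\<And>a. a \<in> A \<Longrightarrow> smooth_on S (f a)) \<Longrightarrow> smooth_on S (\<lambda>x. \<Prod>a\<in>A. f a x)"
  by (induction A rule: infinite_finite_induct) (auto simp: smooth_on_const intro!: smooth_on_mult)

lemma smooth_on_exp: "smooth_on S f \<Longrightarrow> smooth_on S (\<lambda>x. exp (f x))"
  by (simp add: smooth_on_iff_ck ck_exp[OF op])

lemma smooth_on_inverse: "smooth_on S f \<Longrightarrow> (\<And>x. x \<in> S \<Longrightarrow> f x \<noteq> 0) \<Longrightarrow> smooth_on S (\<lambda>x. inverse (f x))"
  by (simp add: smooth_on_iff_ck ck_inverse[OF op])

lemma smooth_on_divide:
  "smooth_on S f \<Longrightarrow> smooth_on S g \<Longrightarrow> (\<And>x. x \<in> S \<Longrightarrow> g x \<noteq> 0) \<Longrightarrow> smooth_on S (\<lambda>x. f x / g x)"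
  unfolding divide_inverse by (intro smooth_on_mult smooth_on_inverse)

lemma smooth_on_compose:
  fixes f :: "real^'k::finite \<Rightarrow> real"
  assumes "\<And>a. smooth_on S (\<lambda>y. \<psi> y $ a)" "smooth_on T f" "\<And>y. y \<in> S \<Longrightarrow> \<psi> y \<in> T"
  shows "smooth_on S (\<lambda>y. f (\<psi> y))"
  using assms ck_compose[OF op] unfolding smooth_on_iff_ck by blast

lemma smooth_on_det:
  fixes M :: "real^'n \<Rightarrow> real^'k::finite^'k"
  assumes "\<And>i j. smooth_on S (\<lambda>x. M x $ i $ j)"
  shows "smooth_on S (\<lambda>x. det (M x))"
  unfolding det_def by (intro smooth_on_sum smooth_on_mult smooth_on_prod smooth_on_const assms)

end

lemmas smooth_intros = smooth_on_const smooth_on_coord smooth_on_add smooth_on_mult smooth_on_minus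
  smooth_on_diff smooth_on_sum smooth_on_exp smooth_on_pd

text \<open>Cramer's rule for a unit vector on the right-hand side. It exhibits the entries of the
  inverse as quotients of polynomials in the entries of \<open>A\<close>, which is how smoothness of
  the inverse is obtained.\<close>

lemma matrix_inv_cramer:
  fixes A :: "real^'k::finite^'k"
  assumes "invertible A"
  shows "matrix_inv A $ i $ j = det (\<chi> a b. if b = i then (if a = j then 1 else 0) else A $ a $ b) / det A"
proof -
  have d: "det A \<noteq> 0" using assms invertible_det_nz by blast
  have inv: "A ** matrix_inv A = mat 1" using assms 
    unfolding matrix_inv_def invertible_def by (rule someI2_ex) auto
  let ?b = "axis j 1 :: real^'k"
  have "A *v (matrix_inv A *v ?b) = ?b"
    by (simp add: matrix_vector_mul_assoc inv)
  then have "matrix_inv A *v ?b = (\<chi> k. det (\<chi> a b. if b = k then ?b $ a else A $ a $ b) / det A)"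
    using cramer[OF d] by blast
  moreover have "(matrix_inv A *v ?b) $ i = matrix_inv A $ i $ j"
    by (simp add: matrix_vector_mult_basis column_def)
  moreover have "axis j 1 $ a = (if a = j then 1 else 0 :: real)" for a
    by (simp add: axis_def)
  ultimately show ?thesis by (simp cong: if_cong)
qed

lemma smooth_on_matrix_inv:
  fixes M :: "real^'n::finite \<Rightarrow> real^'k::finite^'k"
  assumes "open S" "\<And>i j. smooth_on S (\<lambda>x. M x $ i $ j)" "\<And>x. x \<in> S \<Longrightarrow> invertible (M x)"
  shows "smooth_on S (\<lambda>x. matrix_inv (M x) $ i $ j)"
proof -
  let ?N = "\<lambda>x. \<chi> a b. if b = i then (if a = j then 1 else 0) else M x $ a $ b"
  have "smooth_on S (\<lambda>x. ?N x $ a $ b)" for a b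
    by (cases "b = i") (auto simp: assms(2) smooth_on_const[OF assms(1)])
  then have "smooth_on S (\<lambda>x. det (?N x) / det (M x))"
    using assms by (intro smooth_on_divide smooth_on_det) (auto simp: invertible_det_nz)
  then show ?thesis
    by (subst smooth_on_cong[OF assms(1) matrix_inv_cramer[OF assms(3)]]) auto
qed

section \<open>Symmetry of second partial derivatives, and functions constant along
  directions\<close>

lemma pd_line:
  fixes f :: "real^'n::finite \<Rightarrow> real"
  assumes "f differentiable (at (x + s *\<^sub>R axis i 1))"
  shows "((\<lambda>s. f (x + s *\<^sub>R axis i 1)) has_real_derivative pd i f (x + s *\<^sub>R axis i 1)) (at s)"
proof -
  have "((\<lambda>s. x + s *\<^sub>R axis i 1) has_derivative (\<lambda>h. h *\<^sub>R axis i (1::real))) (at s)"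
    by (auto intro!: derivative_eq_intros)
  from has_derivative_compose[OF this has_derivative_pd[OF assms]]
  show ?thesis
    unfolding has_field_derivative_def
    by (simp only: sum_axis mult_commute_abs)
qed

text \<open>One inequality suffices, since exchanging \<open>i\<close> and \<open>j\<close> gives
  the other. If it failed, a number \<open>c\<close> would separate the two mixed derivatives near
  \<open>x\<close>, and the second difference of \<open>f\<close> over a small square, evaluated by
  the mean value theorem in either order of the variables, would be both below and above
  \<open>c\<close> times the area.\<close>

lemma pd_mixed_le:
  fixes f :: "real^'n::finite \<Rightarrow> real"
  assumes "open S" "x \<in> S" "smooth_on S f"
  shows "pd i (pd j f) x \<le> pd j (pd i f) x"
proof (rule ccontr)
  assume "\<not> ?thesis"
  then obtain c where c: "pd j (pd i f) x < c" "c < pd i (pd j f) x"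
    using dense by (metis not_le)
  have cont: "continuous_on S (pd j (pd i f))" "continuous_on S (pd i (pd j f))"
    using assms(3) by (auto intro!: smooth_on_continuous smooth_on_pd)
  have "open (S \<inter> pd j (pd i f) -` {..<c})" "open (S \<inter> pd i (pd j f) -` {c<..})"
    by (intro continuous_open_preimage cont assms(1); simp)+
  moreover have "S \<inter> pd j (pd i f) -` {..<c} = {y\<in>S. pd j (pd i f) y < c}"
      "S \<inter> pd i (pd j f) -` {c<..} = {y\<in>S. c < pd i (pd j f) y}"
    by auto
  ultimately have "open {y\<in>S. pd j (pd i f) y < c}" "open {y\<in>S. c < pd i (pd j f) y}" by simp_all
  then have "open ({y\<in>S. pd j (pd i f) y < c} \<inter> {y\<in>S. c < pd i (pd j f) y})" by blast
  moreover have "x \<in> {y\<in>S. pd j (pd i f) y < c} \<inter> {y\<in>S. c < pd i (pd j f) y}" using c assms(2) by simp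
  ultimately obtain e where e: "e > 0" "ball x e \<subseteq> {y\<in>S. pd j (pd i f) y < c} \<inter> {y\<in>S. c < pd i (pd j f) y}"
    by (meson openE)
  \<comment> \<open>Points of the square are at distance at most \<open>2 * h\<close> from
    \<open>x\<close>, hence inside the ball.\<close>
  define h where "h = e / 3"
  have h: "h > 0" using e by (simp add: h_def)
  define p where "p = (\<lambda>s t. x + s *\<^sub>R axis i 1 + t *\<^sub>R axis j (1::real))"
  have inb: "p s t \<in> ball x e" if "0 \<le> s" "s \<le> h" "0 \<le> t" "t \<le> h" for s t
  proof -
    have "norm (s *\<^sub>R axis i 1 + t *\<^sub>R axis j (1::real) :: real^'n) \<le> s + t"
      by (rule order_trans[OF norm_triangle_ineq]) (use that in simp)
    moreover have "s + t < e" using that e by (simp add: h_def)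
    moreover have "dist x (p s t) = norm (s *\<^sub>R axis i 1 + t *\<^sub>R axis j (1::real) :: real^'n)"
      unfolding p_def dist_norm by (metis add.assoc add_diff_cancel_left' norm_minus_commute)
    ultimately show ?thesis by (simp add: dist_commute)
  qed
  have inS: "p s t \<in> S" if "0 \<le> s" "s \<le> h" "0 \<le> t" "t \<le> h" for s t
    using inb[OF that] e by blast
  have di: "((\<lambda>s. F (p s t)) has_real_derivative pd i F (p s t)) (at s)"
    if "smooth_on S F" "0 \<le> s" "s \<le> h" "0 \<le> t" "t \<le> h" for F s t
  proof -
    have "p s t = (x + t *\<^sub>R axis j 1) + s *\<^sub>R axis i 1" for s by (simp add: p_def algebra_simps)
    then show ?thesis using pd_line[of F "x + t *\<^sub>R axis j 1" s i] smooth_on_differentiable[OF that(1)] inS[OF that(2-5)]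
      by simp
  qed
  have dj: "((\<lambda>t. F (p s t)) has_real_derivative pd j F (p s t)) (at t)"
    if "smooth_on S F" "0 \<le> s" "s \<le> h" "0 \<le> t" "t \<le> h" for F s t
    using pd_line[of F "x + s *\<^sub>R axis i 1" t j] smooth_on_differentiable[OF that(1)] inS[OF that(2-5)]
    by (simp add: p_def)
  let ?D = "f (p h h) - f (p h 0) - (f (p 0 h) - f (p 0 0))"
  have "\<exists>z. 0 < z \<and> z < h \<and> (f (p h h) - f (p h 0)) - (f (p 0 h) - f (p 0 0)) = (h - 0) * (pd i f (p z h) - pd i f (p z 0))"
    by (rule MVT2[OF h, of "\<lambda>s. f (p s h) - f (p s 0)"]) (use di[OF assms(3)] h in \<open>auto intro!: DERIV_diff\<close>)
  then obtain z where z: "0 < z" "z < h" "?D = h * (pd i f (p z h) - pd i f (p z 0))" by auto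
  have "\<exists>w. 0 < w \<and> w < h \<and> pd i f (p z h) - pd i f (p z 0) = (h - 0) * pd j (pd i f) (p z w)"
    by (rule MVT2[OF h]) (use dj[OF smooth_on_pd[OF assms(3)]] z in auto)
  then obtain w where w: "0 < w" "w < h" "pd i f (p z h) - pd i f (p z 0) = h * pd j (pd i f) (p z w)" by auto
  have "?D = h * h * pd j (pd i f) (p z w)" using z w by simp
  moreover have "pd j (pd i f) (p z w) < c" using inb[of z w] z w e by auto
  ultimately have 1: "?D < h * h * c" using h by simp
  have "\<exists>z. 0 < z \<and> z < h \<and> (f (p h h) - f (p 0 h)) - (f (p h 0) - f (p 0 0)) = (h - 0) * (pd j f (p h z) - pd j f (p 0 z))"
    by (rule MVT2[OF h, of "\<lambda>t. f (p h t) - f (p 0 t)"]) (use dj[OF assms(3)] h in \<open>auto intro!: DERIV_diff\<close>)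
  then obtain z' where z': "0 < z'" "z' < h" "?D = h * (pd j f (p h z') - pd j f (p 0 z'))" by auto
  have "\<exists>w. 0 < w \<and> w < h \<and> pd j f (p h z') - pd j f (p 0 z') = (h - 0) * pd i (pd j f) (p w z')"
    by (rule MVT2[OF h, of "\<lambda>s. pd j f (p s z')"]) (use di[OF smooth_on_pd[OF assms(3)]] z' in auto)
  then obtain w' where w': "0 < w'" "w' < h" "pd j f (p h z') - pd j f (p 0 z') = h * pd i (pd j f) (p w' z')" by auto
  have "?D = h * h * pd i (pd j f) (p w' z')" using z' w' by simp
  moreover have "c < pd i (pd j f) (p w' z')" using inb[of w' z'] z' w' e by auto
  ultimately have 2: "h * h * c < ?D" using h by simp
  show False using 1 2 by simp
qed

lemma pd_commute:
  fixes f :: "real^'n::finite \<Rightarrow> real"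
  assumes "open S" "x \<in> S" "smooth_on S f"
  shows "pd i (pd j f) x = pd j (pd i f) x"
  using pd_mixed_le[OF assms] by (simp add: order_antisym)

text \<open>The derivative along the segment from \<open>z\<close> to \<open>z'\<close> only meets
  coordinates in which the endpoints differ. This covers functions constant in one direction as well
  as functions constant on the slices transversal to it.\<close>

lemma pd_zero_imp_eq:
  fixes F :: "real^'n::finite \<Rightarrow> real"
  assumes "convex S" "open S" "z \<in> S" "z' \<in> S" "\<And>x. x \<in> S \<Longrightarrow> F differentiable (at x)"
    "\<And>i x. x \<in> S \<Longrightarrow> z $ i \<noteq> z' $ i \<Longrightarrow> pd i F x = 0"
  shows "F z = F z'"
proof -
  define l where "l = (\<lambda>s::real. z + s *\<^sub>R (z' - z))"
  have lS: "l s \<in> S" if "s \<in> {0..1}" for s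
  proof -
    have "l s = (1 - s) *\<^sub>R z + s *\<^sub>R z'" by (simp add: l_def algebra_simps)
    then show ?thesis using assms(1,3,4) that by (simp add: convex_def)
  qed
  have "((\<lambda>s. F (l s)) has_derivative (\<lambda>h. 0)) (at s within {0..1})" if "s \<in> {0..1}" for s
  proof -
    have "(l has_derivative (\<lambda>h. h *\<^sub>R (z' - z))) (at s)"
      unfolding l_def by (auto intro!: derivative_eq_intros)
    then have "((\<lambda>s. F (l s)) has_derivative (\<lambda>h. \<Sum>i\<in>UNIV. (h *\<^sub>R (z' - z)) $ i * pd i F (l s))) (at s)"
      by (rule has_derivative_compose[OF _ has_derivative_pd]) (use assms(5) lS that in auto)
    moreover have "(\<lambda>h. \<Sum>i\<in>UNIV. (h *\<^sub>R (z' - z)) $ i * pd i F (l s)) = (\<lambda>h. 0)"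
    proof
      fix h
      have "(h *\<^sub>R (z' - z)) $ i * pd i F (l s) = 0" for i
        using assms(6)[OF lS[OF that], of i] by (cases "z $ i = z' $ i") auto
      then show "(\<Sum>i\<in>UNIV. (h *\<^sub>R (z' - z)) $ i * pd i F (l s)) = 0" by (simp only: sum.neutral_const)
    qed
    ultimately show ?thesis by (metis has_derivative_at_withinI)
  qed
  then have "F (l 0) = F (l 1)"
    using has_derivative_zero_unique[of "{0..1}" "\<lambda>s. F (l s)" 1 0] by auto
  then show ?thesis by (simp add: l_def)
qed

section \<open>Integrals depending on a parameter\<close>

text \<open>Differentiation under the integral sign asks for a derivative that is jointly continuous
  as a bounded linear map; it is assembled as the sum of the partial derivatives times the
  coordinate projections \<open>B\<close>.\<close>

lemma param_integral:
  fixes F :: "real \<Rightarrow> real^'n::finite \<Rightarrow> real"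
  assumes "open U" "convex U" "x0 \<in> U"
    and d: "\<And>s x. s \<in> {0..1} \<Longrightarrow> x \<in> U \<Longrightarrow> F s differentiable (at x)"
    and c: "\<And>x. x \<in> U \<Longrightarrow> continuous_on {0..1} (\<lambda>s. F s x)"
    and cd: "\<And>i. continuous_on (U \<times> {0..1}) (\<lambda>(x, s). pd i (F s) x)"
  shows "(\<lambda>x. integral {0..1} (\<lambda>s. F s x)) differentiable (at x0)"
    and "pd i (\<lambda>x. integral {0..1} (\<lambda>s. F s x)) x0 = integral {0..1} (\<lambda>s. pd i (F s) x0)"
proof -
  define B :: "'n \<Rightarrow> (real^'n) \<Rightarrow>\<^sub>L real" where "B = (\<lambda>i. Blinfun (\<lambda>h. h $ i))"
  have B [simp]: "blinfun_apply (B i) h = h $ i" for i h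
    by (simp add: B_def bounded_linear_Blinfun_apply bounded_linear_vec_nth)
  define G where "G = (\<lambda>x s. \<Sum>i\<in>UNIV. pd i (F s) x *\<^sub>R B i)"
  have Gap: "blinfun_apply (G x s) h = (\<Sum>i\<in>UNIV. h $ i * pd i (F s) x)" for x s h
    by (simp add: G_def blinfun.sum_left blinfun.scaleR_left mult.commute)
  have contG: "continuous_on (U \<times> cbox 0 1) (\<lambda>(x, s). G x s)"
    unfolding G_def case_prod_unfold
    by (intro continuous_on_sum continuous_on_scaleR continuous_on_const)
      (use cd in \<open>simp add: case_prod_unfold\<close>)
  have "((\<lambda>x. integral (cbox 0 1) (\<lambda>s. F s x)) has_derivative integral (cbox 0 1) (G x0)) (at x0 within U)"
  proof (rule leibniz_rule[OF _ _ contG assms(3,2)])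
    show "((\<lambda>x. F t x) has_derivative blinfun_apply (G x t)) (at x within U)" if "x \<in> U" "t \<in> cbox 0 1" for x t
    proof -
      have "blinfun_apply (G x t) = (\<lambda>h. \<Sum>i\<in>UNIV. h $ i * pd i (F t) x)" by (simp add: Gap fun_eq_iff)
      then show ?thesis using has_derivative_at_withinI[OF has_derivative_pd[OF d[of t x]]] that by simp
    qed
    show "(\<lambda>s. F s x) integrable_on cbox 0 1" if "x \<in> U" for x
      using c[OF that] by (intro integrable_continuous) simp
  qed
  then have hd: "((\<lambda>x. integral {0..1} (\<lambda>s. F s x)) has_derivative integral {0..1} (G x0)) (at x0)"
    using assms(1,3) by (simp add: at_within_open[of x0 U])
  then show "(\<lambda>x. integral {0..1} (\<lambda>s. F s x)) differentiable (at x0)"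
    unfolding differentiable_def by blast
  have "continuous_on {0..1} (G x0)"
  proof -
    have "continuous_on {0..1} (\<lambda>s. case (x0, s) of (x, s) \<Rightarrow> G x s)"
      by (rule continuous_on_compose2[OF contG]) (use assms(3) in \<open>auto intro!: continuous_on_Pair continuous_intros\<close>)
    then show ?thesis by simp
  qed
  then have "G x0 integrable_on {0..1}" by (rule integrable_continuous_real)
  then have "integral {0..1} (\<lambda>s. blinfun_apply (G x0 s) (axis i 1)) = blinfun_apply (integral {0..1} (G x0)) (axis i 1)"
    using integral_linear[OF _ blinfun.bounded_linear_left, of "G x0" "{0..1}" "axis i 1"] by (simp add: o_def)
  then show "pd i (\<lambda>x. integral {0..1} (\<lambda>s. F s x)) x0 = integral {0..1} (\<lambda>s. pd i (F s) x0)"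
    using pd_eq[OF hd, of i] by (simp add: Gap sum_axis)
qed

section \<open>Integration along one coordinate\<close>

definition set_coord :: "'n \<Rightarrow> real \<Rightarrow> real^'n::finite \<Rightarrow> real^'n" where
  "set_coord ix s z = (\<chi> i. if i = ix then s else z $ i)"

lemma set_coord_nth: "set_coord ix s z $ i = (if i = ix then s else z $ i)"
  by (simp add: set_coord_def)

lemma set_coord_self: "set_coord ix (z $ ix) z = z"
  by (simp add: set_coord_def vec_eq_iff)

text \<open>The integral of \<open>f\<close> over the coordinate \<open>ix\<close> from 0 to
  \<open>z $ ix\<close>, rescaled to the unit interval so that the domain of integration does not
  depend on \<open>z\<close> and \<open>param_integral\<close> applies.\<close>

definition coord_int :: "'n \<Rightarrow> (real^'n::finite \<Rightarrow> real) \<Rightarrow> real^'n \<Rightarrow> real" where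
  "coord_int ix f z = z $ ix * integral {0..1} (\<lambda>s. f (set_coord ix (s * z $ ix) z))"

text \<open>A ball of the maximum norm: moving one coordinate towards 0 stays inside, and the set is
  a product of an interval and a lower-dimensional cube, as warped coordinates demand.\<close>

definition cube :: "real \<Rightarrow> (real^'n::finite) set" where
  "cube r = {z. \<forall>i. \<bar>z $ i\<bar> < r}"

lemma cube_box: "cube r = box (\<chi> i. - r) (\<chi> i. r)"
  by (auto simp: cube_def mem_box_cart abs_less_iff) (smt (verit))+

lemma open_cube: "open (cube r)" and convex_cube: "convex (cube r)"
  by (simp_all add: cube_box open_box)

lemma set_coord_cube: "z \<in> cube r \<Longrightarrow> s \<in> {0..1} \<Longrightarrow> set_coord ix (s * z $ ix) z \<in> cube r"
  unfolding cube_def using mult_left_le_one_le[of "\<bar>z $ ix\<bar>" s]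
  by (auto simp: set_coord_nth abs_mult intro: le_less_trans)

lemma continuous_set_coord: "continuous_on A (\<lambda>(z, s). set_coord ix (s * z $ ix) z)"
proof -
  have "continuous_on A (\<lambda>p. if i = ix then snd p * fst p $ ix else fst p $ i)" for i
    by (cases "i = ix") (auto intro!: continuous_intros)
  then show ?thesis unfolding set_coord_def case_prod_unfold by (intro continuous_on_vec_lambda) auto
qed

lemma continuous_coord_int_integrand:
  assumes "continuous_on (cube r) f" "z \<in> cube r"
  shows "continuous_on {0..1} (\<lambda>s. f (set_coord ix (s * z $ ix) z))"
proof -
  have "continuous_on {0..1} (\<lambda>s. case (z, s) of (z, s) \<Rightarrow> set_coord ix (s * z $ ix) z)"
    by (rule continuous_on_compose2[OF continuous_set_coord[of UNIV ix]]) (auto intro!: continuous_on_Pair continuous_intros)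
  then have "continuous_on {0..1} (\<lambda>s. set_coord ix (s * z $ ix) z)" by simp
  then show ?thesis
    by (rule continuous_on_compose2[OF assms(1)]) (use set_coord_cube[OF assms(2)] in auto)
qed

lemma coord_int_cong:
  assumes "\<And>z. z \<in> cube r \<Longrightarrow> f z = g z" "z \<in> cube r"
  shows "coord_int ix f z = coord_int ix g z"
  unfolding coord_int_def using assms set_coord_cube[OF assms(2)]
  by (intro arg_cong2[where f = "(*)"] integral_cong refl) auto

lemma coord_int_bound:
  assumes "continuous_on (cube r) f" "z \<in> cube r" "\<And>z. z \<in> cube r \<Longrightarrow> \<bar>f z\<bar> \<le> C"
  shows "\<bar>coord_int ix f z\<bar> \<le> r * C"
proof -
  have "C \<ge> 0" using assms(2,3) by (meson abs_ge_zero order_trans)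
  have "norm (integral {0..1} (\<lambda>s. f (set_coord ix (s * z $ ix) z))) \<le> C * (1 - 0)"
    by (rule integral_bound) (use continuous_coord_int_integrand[OF assms(1,2)] assms(3) set_coord_cube[OF assms(2)] in auto)
  moreover have "\<bar>z $ ix\<bar> \<le> r" using assms(2) by (auto simp: cube_def less_imp_le)
  ultimately show ?thesis unfolding coord_int_def abs_mult using \<open>C \<ge> 0\<close> by (intro mult_mono) auto
qed

lemma coord_int_diff:
  assumes "continuous_on (cube r) f" "continuous_on (cube r) g" "z \<in> cube r"
  shows "coord_int ix f z - coord_int ix g z = coord_int ix (\<lambda>z. f z - g z) z"
  unfolding coord_int_def
  using integral_diff[OF integrable_continuous_real[OF continuous_coord_int_integrand[OF assms(1,3), of ix]]
      integrable_continuous_real[OF continuous_coord_int_integrand[OF assms(2,3), of ix]]]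
  by (simp add: right_diff_distrib)

lemma coord_int_zero: "z $ ix = 0 \<Longrightarrow> coord_int ix f z = 0"
  by (simp add: coord_int_def)

text \<open>Transversal derivatives pass under the integral, while the derivative along
  \<open>ix\<close> undoes the integration. This dichotomy drives the inductions on the order in the
  construction of the flow.\<close>

lemma
  assumes f: "smooth_on (cube r) f" and z: "z \<in> cube r"
  shows coord_int_differentiable: "coord_int ix f differentiable (at z)"
    and pd_coord_int: "pd i (coord_int ix f) z = (if i = ix then f z else coord_int ix (pd i f) z)"
proof -
  let ?F = "\<lambda>s z. f (set_coord ix (s * z $ ix) z)"
  let ?c = "\<lambda>i s. if i = ix then s else 1 :: real"
  have comp: "(\<lambda>y. set_coord ix (s * y $ ix) y $ a) differentiable (at x)"
    "pd i (\<lambda>y. set_coord ix (s * y $ ix) y $ a) x = (if i = a then ?c i s else 0)" for s a i and x :: "real^'a"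
    using pd_cmult[of "\<lambda>y. y $ ix" x i s]
    by (cases "a = ix"; auto simp: set_coord_nth pd_coord smooth_on_differentiable[OF smooth_on_coord[OF open_UNIV]]
      intro!: differentiable_mult)+
  have fd: "f differentiable (at (set_coord ix (s * x $ ix) x))" if "s \<in> {0..1}" "x \<in> cube r" for s x
    using smooth_on_differentiable[OF f] set_coord_cube that by blast
  have Fd: "?F s differentiable (at x)" if "s \<in> {0..1}" "x \<in> cube r" for s x
    by (rule differentiable_chain[OF comp(1) fd[OF that]])
  have Fp: "pd i (?F s) x = ?c i s * pd i f (set_coord ix (s * x $ ix) x)" if "s \<in> {0..1}" "x \<in> cube r" for s x i
    unfolding pd_chain[OF comp(1) fd[OF that]] comp(2) by (simp add: if_distrib[of "\<lambda>z. _ * z"] cong: if_cong)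
  have Fc: "continuous_on {0..1} (\<lambda>s. ?F s x)" if "x \<in> cube r" for x
    by (rule continuous_coord_int_integrand[OF smooth_on_continuous[OF f] that])
  have Fcd: "continuous_on (cube r \<times> {0..1}) (\<lambda>(x, s). pd i (?F s) x)" for i
  proof -
    have "continuous_on (cube r \<times> {0..1}) (\<lambda>p. pd i f (case p of (x, s) \<Rightarrow> set_coord ix (s * x $ ix) x))"
      by (rule continuous_on_compose2[OF smooth_on_continuous[OF smooth_on_pd[OF f]] continuous_set_coord])
        (auto intro!: set_coord_cube)
    then have "continuous_on (cube r \<times> {0..1}) (\<lambda>p. ?c i (snd p) * pd i f (case p of (x, s) \<Rightarrow> set_coord ix (s * x $ ix) x))"
      by (cases "i = ix") (auto intro!: continuous_intros)
    then show ?thesis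
      by (rule continuous_on_eq) (auto simp: Fp case_prod_unfold)
  qed
  have pi: "(\<lambda>x. integral {0..1} (\<lambda>s. ?F s x)) differentiable (at z)"
    "pd i (\<lambda>x. integral {0..1} (\<lambda>s. ?F s x)) z = integral {0..1} (\<lambda>s. pd i (?F s) z)"
    by (rule param_integral[where F = ?F, OF open_cube convex_cube z Fd Fc Fcd]; assumption)+
  have zd: "(\<lambda>z. z $ ix) differentiable (at z)"
    using smooth_on_differentiable[OF smooth_on_coord[OF open_UNIV]] by blast
  have Jd: "coord_int ix f = (\<lambda>z. z $ ix * integral {0..1} (\<lambda>s. ?F s z))" by (auto simp: coord_int_def)
  show "coord_int ix f differentiable (at z)" unfolding Jd by (intro differentiable_mult zd pi)
  have p1: "pd i (coord_int ix f) z = (if i = ix then 1 else 0) * integral {0..1} (\<lambda>s. ?F s z)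
      + z $ ix * integral {0..1} (\<lambda>s. ?c i s * pd i f (set_coord ix (s * z $ ix) z))"
  proof -
    have "integral {0..1} (\<lambda>s. pd i (?F s) z) = integral {0..1} (\<lambda>s. ?c i s * pd i f (set_coord ix (s * z $ ix) z))"
      by (intro integral_cong Fp z)
    then show ?thesis unfolding Jd pd_mult[OF zd pi(1)] pd_coord pi(2) by simp
  qed
  show "pd i (coord_int ix f) z = (if i = ix then f z else coord_int ix (pd i f) z)"
  proof (cases "i = ix")
    case False then show ?thesis by (simp add: p1 coord_int_def)
  next
    case True
    have cp: "continuous_on {0..1} (\<lambda>s. pd ix f (set_coord ix (s * z $ ix) z))"
      by (rule continuous_coord_int_integrand[OF smooth_on_continuous[OF smooth_on_pd[OF f]] z])
    have line: "set_coord ix (s * z $ ix) z = set_coord ix 0 z + (s * z $ ix) *\<^sub>R axis ix 1" for s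
      by (simp add: vec_eq_iff set_coord_nth axis_def)
    \<comment> \<open>The integrand found for the derivative along \<open>ix\<close> is the total
      derivative of \<open>s * ?F s z\<close>, so its integral is the value at \<open>s = 1\<close>,
      which is \<open>f z\<close>.\<close>
    have der: "((\<lambda>s. s * ?F s z) has_real_derivative (?F s z + s * (pd ix f (set_coord ix (s * z $ ix) z) * z $ ix))) (at s)"
      if "s \<in> {0..1}" for s
    proof -
      have "((\<lambda>s. s * z $ ix) has_real_derivative z $ ix) (at s)" by (auto intro!: derivative_eq_intros)
      from DERIV_chain2[OF pd_line[of f "set_coord ix 0 z" "s * z $ ix" ix] this] fd[OF that z]
      have "((\<lambda>s. ?F s z) has_real_derivative pd ix f (set_coord ix (s * z $ ix) z) * z $ ix) (at s)"
        unfolding line by simp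
      from DERIV_mult[OF DERIV_ident this] show ?thesis by (simp add: algebra_simps)
    qed
    have "((\<lambda>s. ?F s z + s * (pd ix f (set_coord ix (s * z $ ix) z) * z $ ix)) has_integral (1 * ?F 1 z - 0 * ?F 0 z)) {0..1}"
      by (rule fundamental_theorem_of_calculus)
        (use der in \<open>auto simp: has_real_derivative_iff_has_vector_derivative[symmetric] intro: has_field_derivative_at_within\<close>)
    then have "integral {0..1} (\<lambda>s. ?F s z + s * (pd ix f (set_coord ix (s * z $ ix) z) * z $ ix)) = f z"
      by (simp add: integral_unique set_coord_self)
    moreover have "integral {0..1} (\<lambda>s. ?F s z + s * (pd ix f (set_coord ix (s * z $ ix) z) * z $ ix))
       = integral {0..1} (\<lambda>s. ?F s z) + integral {0..1} (\<lambda>s. z $ ix * (s * pd ix f (set_coord ix (s * z $ ix) z)))"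
      by (subst integral_add[symmetric])
        (auto intro!: integrable_continuous_real continuous_intros Fc z cp simp: algebra_simps)
    ultimately show ?thesis using True p1 by simp
  qed
qed

lemma smooth_coord_int:
  assumes "smooth_on (cube r) f"
  shows "smooth_on (cube r) (coord_int ix f)"
proof -
  have "ck k (cube r) (coord_int ix f)" for k
    using assms
  proof (induction k arbitrary: f)
    case 0 then show ?case using coord_int_differentiable by auto
  next
    case (Suc k)
    have "ck k (cube r) (if i = ix then f else coord_int ix (pd i f))" for i
      using Suc.IH[OF smooth_on_pd[OF Suc.prems]] Suc.prems by (simp add: smooth_on_iff_ck)
    show ?case
      by (rule ck_SucI[OF open_cube coord_int_differentiable[OF Suc.prems], where f' = "\<lambda>i. if i = ix then f else coord_int ix (pd i f)"])
        (fact | simp add: pd_coord_int[OF Suc.prems])+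
  qed
  then show ?thesis by (simp add: smooth_on_iff_ck)
qed


section \<open>Sequences converging uniformly with all derivatives\<close>

text \<open>The uniform bound is part of the notion because products of such sequences need it. No
  limit function is mentioned, so limits can be taken once, after all orders of derivatives are
  settled.\<close>

definition unif_cauchy :: "(real^'n::finite) set \<Rightarrow> (nat \<Rightarrow> real^'n \<Rightarrow> real) \<Rightarrow> bool" where
  "unif_cauchy Q f \<longleftrightarrow> (\<exists>M. \<forall>n. \<forall>z\<in>Q. \<bar>f n z\<bar> \<le> M) \<and>
     (\<forall>e>0. \<exists>N. \<forall>m\<ge>N. \<forall>n\<ge>N. \<forall>z\<in>Q. \<bar>f m z - f n z\<bar> \<le> e)"

primrec unif_cauchy_ck :: "nat \<Rightarrow> (real^'n::finite) set \<Rightarrow> (nat \<Rightarrow> real^'n \<Rightarrow> real) \<Rightarrow> bool" where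
  "unif_cauchy_ck 0 Q f = unif_cauchy Q f"
| "unif_cauchy_ck (Suc k) Q f = (unif_cauchy Q f \<and> (\<forall>i. unif_cauchy_ck k Q (\<lambda>n. pd i (f n))))"

lemma unif_cauchy_bounded: assumes "unif_cauchy Q f" obtains M where "M \<ge> 0" "\<And>n z. z \<in> Q \<Longrightarrow> \<bar>f n z\<bar> \<le> M"
proof -
  obtain M where "\<forall>n. \<forall>z\<in>Q. \<bar>f n z\<bar> \<le> M" using assms unfolding unif_cauchy_def by (elim conjE exE)
  then show ?thesis using that[of "max M 0"] by (simp add: le_max_iff_disj)
qed

lemma unif_cauchy_cauchy:
  assumes "unif_cauchy Q f" "e > 0"
  obtains N where "\<And>m n z. m \<ge> N \<Longrightarrow> n \<ge> N \<Longrightarrow> z \<in> Q \<Longrightarrow> \<bar>f m z - f n z\<bar> \<le> e"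
  using assms unfolding unif_cauchy_def by blast

lemma unif_cauchy_cauchy_family:
  fixes f :: "'i::finite \<Rightarrow> nat \<Rightarrow> real^'n::finite \<Rightarrow> real"
  assumes "\<And>i. unif_cauchy Q (f i)" "e > 0"
  obtains N where "\<And>i m n z. m \<ge> N \<Longrightarrow> n \<ge> N \<Longrightarrow> z \<in> Q \<Longrightarrow> \<bar>f i m z - f i n z\<bar> \<le> e"
proof -
  have "\<forall>i. \<exists>N. \<forall>m\<ge>N. \<forall>n\<ge>N. \<forall>z\<in>Q. \<bar>f i m z - f i n z\<bar> \<le> e"
    using assms unfolding unif_cauchy_def by blast
  then obtain N where N: "\<And>i m n z. m \<ge> N i \<Longrightarrow> n \<ge> N i \<Longrightarrow> z \<in> Q \<Longrightarrow> \<bar>f i m z - f i n z\<bar> \<le> e" by metis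
  have "N i \<le> Max (range N)" for i by simp
  then show ?thesis using that[of "Max (range N)"] N by (meson order_trans)
qed

lemma unif_cauchy_bounded_family:
  fixes f :: "'i::finite \<Rightarrow> nat \<Rightarrow> real^'n::finite \<Rightarrow> real"
  assumes "\<And>i. unif_cauchy Q (f i)"
  obtains M where "M \<ge> 0" "\<And>i n z. z \<in> Q \<Longrightarrow> \<bar>f i n z\<bar> \<le> M"
proof -
  have "\<forall>i. \<exists>M. M \<ge> 0 \<and> (\<forall>n. \<forall>z\<in>Q. \<bar>f i n z\<bar> \<le> M)" using unif_cauchy_bounded[OF assms] by metis
  then obtain M where M: "\<And>i. M i \<ge> 0" "\<And>i n z. z \<in> Q \<Longrightarrow> \<bar>f i n z\<bar> \<le> M i" by metis
  have "M i \<le> Max (range M)" for i by simp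
  then show ?thesis using that[of "Max (range M)"] M by (meson order_trans)
qed

lemma unif_cauchy_ck_uc0: "unif_cauchy_ck k Q f \<Longrightarrow> unif_cauchy Q f"
  by (cases k) auto

lemma unif_cauchy_ck_mono: "unif_cauchy_ck (Suc k) Q f \<Longrightarrow> unif_cauchy_ck k Q f"
  by (induction k arbitrary: f) auto

lemma unif_cauchy_cong: "(\<And>n z. z \<in> Q \<Longrightarrow> f n z = g n z) \<Longrightarrow> unif_cauchy Q f \<longleftrightarrow> unif_cauchy Q g"
  unfolding unif_cauchy_def by simp

lemma unif_cauchy_ck_cong:
  assumes "open Q" "\<And>n z. z \<in> Q \<Longrightarrow> f n z = g n z"
  shows "unif_cauchy_ck k Q f \<longleftrightarrow> unif_cauchy_ck k Q g"
  using assms(2)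
proof (induction k arbitrary: f g)
  case 0 then show ?case using unif_cauchy_cong[of Q f g] by simp
next
  case (Suc k)
  have "pd i (f n) z = pd i (g n) z" if "z \<in> Q" for z i n
    by (rule pd_cong_open[OF assms(1) that]) (use Suc.prems in auto)
  then have "unif_cauchy_ck k Q (\<lambda>n. pd i (f n)) \<longleftrightarrow> unif_cauchy_ck k Q (\<lambda>n. pd i (g n))" for i by (intro Suc.IH) auto
  then show ?case using unif_cauchy_cong[of Q f g] Suc.prems by simp
qed

lemma unif_cauchy_ck_SucI:
  assumes "open Q" "unif_cauchy Q f" "\<And>i. unif_cauchy_ck k Q (f' i)" "\<And>i n z. z \<in> Q \<Longrightarrow> pd i (f n) z = f' i n z"
  shows "unif_cauchy_ck (Suc k) Q f"
proof -
  have "unif_cauchy_ck k Q (\<lambda>n. pd i (f n))" for i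
    using unif_cauchy_ck_cong[OF assms(1), of "\<lambda>n. pd i (f n)" "f' i" k] assms(3,4) by blast
  then show ?thesis using assms(2) by simp
qed

lemma unif_cauchy_const: "(\<And>z. z \<in> Q \<Longrightarrow> \<bar>w z\<bar> \<le> M) \<Longrightarrow> unif_cauchy Q (\<lambda>n. w)"
  unfolding unif_cauchy_def by auto

lemma unif_cauchy_ck_const: "unif_cauchy_ck k Q (\<lambda>n x. c)"
proof -
  have "pd i (\<lambda>x::real^'a. c) = (\<lambda>x. 0)" for i c by auto
  then show ?thesis by (induction k arbitrary: c) (auto intro!: unif_cauchy_const)
qed

lemma unif_cauchy_ck_coord:
  assumes "open Q" "\<And>z. z \<in> Q \<Longrightarrow> \<bar>z $ j\<bar> \<le> M"
  shows "unif_cauchy_ck k Q (\<lambda>n z. z $ j)"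
proof (cases k)
  case (Suc k) show ?thesis unfolding Suc
    by (rule unif_cauchy_ck_SucI[OF assms(1) unif_cauchy_const, where f' = "\<lambda>i n x. if i = j then 1 else 0"])
      (use assms(2) in \<open>auto simp: unif_cauchy_ck_const pd_coord\<close>)
qed (simp add: unif_cauchy_const[OF assms(2)])

lemma unif_cauchy_add:
  assumes "unif_cauchy Q f" "unif_cauchy Q g"
  shows "unif_cauchy Q (\<lambda>n z. f n z + g n z)"
  unfolding unif_cauchy_def
proof (intro conjI allI impI)
  obtain M M' where M: "\<And>n z. z \<in> Q \<Longrightarrow> \<bar>f n z\<bar> \<le> M" "\<And>n z. z \<in> Q \<Longrightarrow> \<bar>g n z\<bar> \<le> M'"
    using unif_cauchy_bounded assms by metis
  have "\<bar>f n z + g n z\<bar> \<le> M + M'" if "z \<in> Q" for n z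
    using M(1)[OF that, of n] M(2)[OF that, of n] by (simp add: abs_le_iff)
  then show "\<exists>M. \<forall>n. \<forall>z\<in>Q. \<bar>f n z + g n z\<bar> \<le> M" by blast
  fix e :: real assume "e > 0"
  then have e: "e / 2 > 0" by simp
  obtain N where N: "\<And>m n z. m \<ge> N \<Longrightarrow> n \<ge> N \<Longrightarrow> z \<in> Q \<Longrightarrow> \<bar>f m z - f n z\<bar> \<le> e / 2"
    using unif_cauchy_cauchy[OF assms(1) e] by blast
  obtain N' where N': "\<And>m n z. m \<ge> N' \<Longrightarrow> n \<ge> N' \<Longrightarrow> z \<in> Q \<Longrightarrow> \<bar>g m z - g n z\<bar> \<le> e / 2"
    using unif_cauchy_cauchy[OF assms(2) e] by blast
  have "\<bar>f m z + g m z - (f n z + g n z)\<bar> \<le> e" if "m \<ge> max N N'" "n \<ge> max N N'" "z \<in> Q" for m n z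
  proof -
    have "\<bar>f m z - f n z\<bar> \<le> e / 2" "\<bar>g m z - g n z\<bar> \<le> e / 2" using N N' that by auto
    then show ?thesis by linarith
  qed
  then show "\<exists>N. \<forall>m\<ge>N. \<forall>n\<ge>N. \<forall>z\<in>Q. \<bar>f m z + g m z - (f n z + g n z)\<bar> \<le> e" by blast
qed

lemma unif_cauchy_mult:
  assumes "unif_cauchy Q f" "unif_cauchy Q g"
  shows "unif_cauchy Q (\<lambda>n z. f n z * g n z)"
  unfolding unif_cauchy_def
proof (intro conjI allI impI)
  obtain M where M: "M \<ge> 0" "\<And>n z. z \<in> Q \<Longrightarrow> \<bar>f n z\<bar> \<le> M" using unif_cauchy_bounded[OF assms(1)] by blast
  obtain M' where M': "M' \<ge> 0" "\<And>n z. z \<in> Q \<Longrightarrow> \<bar>g n z\<bar> \<le> M'" using unif_cauchy_bounded[OF assms(2)] by blast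
  show "\<exists>M. \<forall>n. \<forall>z\<in>Q. \<bar>f n z * g n z\<bar> \<le> M"
    by (intro exI[of _ "M * M'"]) (use M M' in \<open>auto simp: abs_mult intro!: mult_mono\<close>)
  fix e :: real assume "e > 0"
  define d where "d = e / (M + M' + 1)"
  have d: "d > 0" "d * (M + M') \<le> e" using \<open>e > 0\<close> M(1) M'(1) by (auto simp: d_def field_simps)
  obtain N where N: "\<And>m n z. m \<ge> N \<Longrightarrow> n \<ge> N \<Longrightarrow> z \<in> Q \<Longrightarrow> \<bar>f m z - f n z\<bar> \<le> d"
    using unif_cauchy_cauchy[OF assms(1) d(1)] by blast
  obtain N' where N': "\<And>m n z. m \<ge> N' \<Longrightarrow> n \<ge> N' \<Longrightarrow> z \<in> Q \<Longrightarrow> \<bar>g m z - g n z\<bar> \<le> d"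
    using unif_cauchy_cauchy[OF assms(2) d(1)] by blast
  have "\<bar>f m z * g m z - f n z * g n z\<bar> \<le> e" if h: "m \<ge> max N N'" "n \<ge> max N N'" "z \<in> Q" for m n z
  proof -
    have "f m z * g m z - f n z * g n z = (f m z - f n z) * g m z + f n z * (g m z - g n z)"
      by (simp add: algebra_simps)
    then have "\<bar>f m z * g m z - f n z * g n z\<bar> \<le> \<bar>f m z - f n z\<bar> * \<bar>g m z\<bar> + \<bar>f n z\<bar> * \<bar>g m z - g n z\<bar>"
      by (metis abs_mult abs_triangle_ineq)
    also have "\<dots> \<le> d * M' + M * d"
      by (intro add_mono mult_mono N N' M M' order_less_imp_le[OF d(1)] abs_ge_zero) (use h in auto)
    finally show ?thesis using d(2) by (simp add: algebra_simps)
  qed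
  then show "\<exists>N. \<forall>m\<ge>N. \<forall>n\<ge>N. \<forall>z\<in>Q. \<bar>f m z * g m z - f n z * g n z\<bar> \<le> e" by blast
qed

lemma unif_cauchy_ck_add:
  assumes "open Q" "\<And>n. smooth_on Q (f n)" "\<And>n. smooth_on Q (g n)" "unif_cauchy_ck k Q f" "unif_cauchy_ck k Q g"
  shows "unif_cauchy_ck k Q (\<lambda>n z. f n z + g n z)"
  using assms(2-)
proof (induction k arbitrary: f g)
  case (Suc k)
  show ?case
  proof (rule unif_cauchy_ck_SucI[OF assms(1), where f' = "\<lambda>i n z. pd i (f n) z + pd i (g n) z"])
    show "unif_cauchy_ck k Q (\<lambda>n z. pd i (f n) z + pd i (g n) z)" for i
      by (rule Suc.IH) (use Suc.prems in \<open>auto intro: smooth_on_pd\<close>)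
  qed (use Suc.prems in \<open>auto intro!: pd_add unif_cauchy_add intro: smooth_on_differentiable\<close>)
qed (auto intro: unif_cauchy_add)

lemma unif_cauchy_ck_mult:
  assumes "open Q" "\<And>n. smooth_on Q (f n)" "\<And>n. smooth_on Q (g n)" "unif_cauchy_ck k Q f" "unif_cauchy_ck k Q g"
  shows "unif_cauchy_ck k Q (\<lambda>n z. f n z * g n z)"
  using assms(2-)
proof (induction k arbitrary: f g)
  case (Suc k)
  show ?case
  proof (rule unif_cauchy_ck_SucI[OF assms(1), where f' = "\<lambda>i n z. pd i (f n) z * g n z + f n z * pd i (g n) z"])
    have "unif_cauchy_ck k Q f" "unif_cauchy_ck k Q g" using unif_cauchy_ck_mono[OF Suc.prems(3)] unif_cauchy_ck_mono[OF Suc.prems(4)] .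
    then show "unif_cauchy_ck k Q (\<lambda>n z. pd i (f n) z * g n z + f n z * pd i (g n) z)" for i
      by (intro unif_cauchy_ck_add[OF assms(1)] smooth_on_mult[OF assms(1)] Suc.IH) (use Suc.prems in \<open>auto intro: smooth_on_pd\<close>)
  qed (use Suc.prems in \<open>auto intro!: pd_mult unif_cauchy_mult intro: smooth_on_differentiable\<close>)
qed (auto intro: unif_cauchy_mult)

lemma unif_cauchy_ck_sum:
  assumes "open Q" "\<And>a n. smooth_on Q (f a n)" "\<And>a. unif_cauchy_ck k Q (f a)"
  shows "unif_cauchy_ck k Q (\<lambda>n z. \<Sum>a\<in>A. f a n z)"
  by (induction A rule: infinite_finite_induct)
    (use assms in \<open>auto simp: unif_cauchy_ck_const intro!: unif_cauchy_ck_add smooth_on_sum\<close>)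

text \<open>\<open>W\<close> is uniformly continuous on the compact set \<open>K\<close> that
  contains all values. For this reason the iterates of the flow are later kept in a closed
  ball.\<close>

lemma unif_cauchy_compose:
  fixes \<phi> :: "nat \<Rightarrow> real^'m::finite \<Rightarrow> real^'n::finite"
  assumes "\<And>j. unif_cauchy Q (\<lambda>n z. \<phi> n z $ j)" "compact K" "continuous_on K W" "\<And>n z. z \<in> Q \<Longrightarrow> \<phi> n z \<in> K"
  shows "unif_cauchy Q (\<lambda>n z. W (\<phi> n z))"
  unfolding unif_cauchy_def
proof (intro conjI allI impI)
  have "bounded (W ` K)" using compact_continuous_image[OF assms(3,2)] compact_imp_bounded by blast
  then obtain M where "\<And>x. x \<in> K \<Longrightarrow> \<bar>W x\<bar> \<le> M" unfolding bounded_iff by auto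
  then show "\<exists>M. \<forall>n. \<forall>z\<in>Q. \<bar>W (\<phi> n z)\<bar> \<le> M" using assms(4) by blast
  fix e :: real assume e: "e > 0"
  have "uniformly_continuous_on K W" by (rule compact_uniformly_continuous[OF assms(3,2)])
  then obtain d where d: "d > 0" "\<And>x y. x \<in> K \<Longrightarrow> y \<in> K \<Longrightarrow> dist y x < d \<Longrightarrow> dist (W y) (W x) < e"
    using e unfolding uniformly_continuous_on_def by metis
  \<comment> \<open>Differences of at most \<open>d'\<close> in each coordinate add up to less than
    \<open>d\<close> in the sum norm, which bounds the Euclidean norm.\<close>
  define d' where "d' = d / (2 * real CARD('n))"
  have d': "d' > 0" "real CARD('n) * d' < d" using d(1) by (simp_all add: d'_def field_simps)
  obtain N where N: "\<And>j m n z. m \<ge> N \<Longrightarrow> n \<ge> N \<Longrightarrow> z \<in> Q \<Longrightarrow> \<bar>\<phi> m z $ j - \<phi> n z $ j\<bar> \<le> d'"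
    using unif_cauchy_cauchy_family[of Q "\<lambda>j n z. \<phi> n z $ j", OF assms(1) d'(1)] by blast
  have "\<bar>W (\<phi> m z) - W (\<phi> n z)\<bar> \<le> e" if "m \<ge> N" "n \<ge> N" "z \<in> Q" for m n z
  proof -
    have "norm (\<phi> m z - \<phi> n z) \<le> (\<Sum>j\<in>UNIV. \<bar>(\<phi> m z - \<phi> n z) $ j\<bar>)" by (rule norm_le_l1_cart)
    also have "\<dots> \<le> (\<Sum>j\<in>(UNIV::'n set). d')" by (intro sum_mono) (use N that in auto)
    also have "\<dots> < d" using d'(2) by simp
    finally have "dist (\<phi> m z) (\<phi> n z) < d" by (simp add: dist_norm)
    then show ?thesis using d(2) assms(4) that(3) by (metis dist_real_def less_imp_le)
  qed
  then show "\<exists>N. \<forall>m\<ge>N. \<forall>n\<ge>N. \<forall>z\<in>Q. \<bar>W (\<phi> m z) - W (\<phi> n z)\<bar> \<le> e" by blast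
qed

lemma unif_cauchy_ck_compose:
  fixes \<phi> :: "nat \<Rightarrow> real^'m::finite \<Rightarrow> real^'n::finite"
  assumes "open Q" "open S" "compact K" "K \<subseteq> S" "\<And>n z. z \<in> Q \<Longrightarrow> \<phi> n z \<in> K"
    "\<And>n j. smooth_on Q (\<lambda>z. \<phi> n z $ j)" "\<And>j. unif_cauchy_ck k Q (\<lambda>n z. \<phi> n z $ j)" "smooth_on S W"
  shows "unif_cauchy_ck k Q (\<lambda>n z. W (\<phi> n z))"
  using assms(7,8)
proof (induction k arbitrary: W)
  case 0
  have "continuous_on K W" using 0(2) assms(4) smooth_on_continuous continuous_on_subset by blast
  then show ?case using unif_cauchy_compose[of Q \<phi> K W] 0(1) assms(3,5) by simp
next
  case (Suc k)
  have inS: "\<phi> n z \<in> S" if "z \<in> Q" for n z using assms(4,5) that by blast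
  have c: "continuous_on K W" using Suc(3) assms(4) smooth_on_continuous continuous_on_subset by blast
  show ?case
  proof (rule unif_cauchy_ck_SucI[OF assms(1), where f' = "\<lambda>i n z. \<Sum>a\<in>UNIV. pd a W (\<phi> n z) * pd i (\<lambda>z. \<phi> n z $ a) z"])
    show "unif_cauchy Q (\<lambda>n z. W (\<phi> n z))"
      by (rule unif_cauchy_compose[OF _ assms(3) c assms(5)]) (use Suc.prems unif_cauchy_ck_uc0 in auto)
    fix i
    show "unif_cauchy_ck k Q (\<lambda>n z. \<Sum>a\<in>UNIV. pd a W (\<phi> n z) * pd i (\<lambda>z. \<phi> n z $ a) z)"
    proof (intro unif_cauchy_ck_sum[OF assms(1)] unif_cauchy_ck_mult[OF assms(1)] smooth_on_mult[OF assms(1)])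
      fix a n
      show "smooth_on Q (\<lambda>z. pd a W (\<phi> n z))"
        by (rule smooth_on_compose[OF assms(1,6) smooth_on_pd[OF Suc.prems(2)] inS])
      then show "smooth_on Q (\<lambda>z. pd a W (\<phi> n z))" .
      show "smooth_on Q (pd i (\<lambda>z. \<phi> n z $ a))" by (rule smooth_on_pd[OF assms(6)])
      then show "smooth_on Q (pd i (\<lambda>z. \<phi> n z $ a))" .
      show "unif_cauchy_ck k Q (\<lambda>n z. pd a W (\<phi> n z))"
        by (rule Suc.IH[OF unif_cauchy_ck_mono[OF Suc.prems(1)] smooth_on_pd[OF Suc.prems(2)]])
      show "unif_cauchy_ck k Q (\<lambda>n. pd i (\<lambda>z. \<phi> n z $ a))" using Suc.prems(1) by simp
    qed
    fix n z assume "z \<in> Q"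
    then show "pd i (\<lambda>z. W (\<phi> n z)) z = (\<Sum>a\<in>UNIV. pd a W (\<phi> n z) * pd i (\<lambda>z. \<phi> n z $ a) z)"
      by (intro pd_chain smooth_on_differentiable[OF assms(6)] smooth_on_differentiable[OF Suc.prems(2)] inS)
  qed
qed

text \<open>The recursion of an iteration describes only the terms from index 1 on; the initial
  term, taken as a constant sequence, is joined to them here.\<close>

lemma unif_cauchy_ck_shift:
  assumes "unif_cauchy_ck k Q (\<lambda>n. f (Suc n))" "unif_cauchy_ck k Q (\<lambda>n. f 0)"
  shows "unif_cauchy_ck k Q f"
  using assms
proof -
  have u: "unif_cauchy Q f" if h: "unif_cauchy Q (\<lambda>n. f (Suc n))" "unif_cauchy Q (\<lambda>n. f 0)" for f
    unfolding unif_cauchy_def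
  proof (intro conjI allI impI)
    obtain M M' where "\<And>n z. z \<in> Q \<Longrightarrow> \<bar>f (Suc n) z\<bar> \<le> M" "\<And>z. z \<in> Q \<Longrightarrow> \<bar>f 0 z\<bar> \<le> M'"
      using unif_cauchy_bounded h by metis
    then have "\<bar>f n z\<bar> \<le> max M M'" if "z \<in> Q" for n z using that by (cases n) (auto simp: le_max_iff_disj)
    then show "\<exists>M. \<forall>n. \<forall>z\<in>Q. \<bar>f n z\<bar> \<le> M" by blast
    fix e :: real assume "e > 0"
    then obtain N where N: "\<And>m n z. m \<ge> N \<Longrightarrow> n \<ge> N \<Longrightarrow> z \<in> Q \<Longrightarrow> \<bar>f (Suc m) z - f (Suc n) z\<bar> \<le> e"
      using unif_cauchy_cauchy[OF h(1)] by metis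
    have "\<bar>f m z - f n z\<bar> \<le> e" if "m \<ge> Suc N" "n \<ge> Suc N" "z \<in> Q" for m n z
      using N[of "m - 1" "n - 1" z] that by simp
    then show "\<exists>N. \<forall>m\<ge>N. \<forall>n\<ge>N. \<forall>z\<in>Q. \<bar>f m z - f n z\<bar> \<le> e" by blast
  qed
  show ?thesis using assms
    by (induction k arbitrary: f) (use u in auto)
qed

lemma unif_cauchy_limit:
  assumes "unif_cauchy Q f" "z \<in> Q"
  shows "(\<lambda>n. f n z) \<longlonglongrightarrow> lim (\<lambda>n. f n z)"
proof -
  have "Cauchy (\<lambda>n. f n z)"
    unfolding Cauchy_def
  proof (intro allI impI)
    fix e :: real assume "e > 0"
    then have "e / 2 > 0" by simp
    from unif_cauchy_cauchy[OF assms(1) this] obtain N where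
      N: "\<And>m n. m \<ge> N \<Longrightarrow> n \<ge> N \<Longrightarrow> \<bar>f m z - f n z\<bar> \<le> e / 2" using assms(2) by metis
    show "\<exists>M. \<forall>m\<ge>M. \<forall>n\<ge>M. dist (f m z) (f n z) < e"
      using le_less_trans[OF N, of _ _ e] \<open>e > 0\<close> by (intro exI[of _ N]) (simp add: dist_real_def)
  qed
  then show ?thesis by (simp add: Cauchy_convergent_iff convergent_LIMSEQ_iff)
qed

lemma unif_cauchy_uniform_limit:
  assumes "unif_cauchy Q f" "e > 0"
  obtains N where "\<And>n z. n \<ge> N \<Longrightarrow> z \<in> Q \<Longrightarrow> \<bar>f n z - lim (\<lambda>n. f n z)\<bar> \<le> e"
proof -
  obtain N where N: "\<And>m n z. m \<ge> N \<Longrightarrow> n \<ge> N \<Longrightarrow> z \<in> Q \<Longrightarrow> \<bar>f m z - f n z\<bar> \<le> e"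
    using unif_cauchy_cauchy[OF assms] by blast
  have "\<bar>f n z - lim (\<lambda>n. f n z)\<bar> \<le> e" if "n \<ge> N" "z \<in> Q" for n z
  proof -
    have "(\<lambda>m. \<bar>f n z - f m z\<bar>) \<longlonglongrightarrow> \<bar>f n z - lim (\<lambda>n. f n z)\<bar>"
      by (intro tendsto_intros unif_cauchy_limit[OF assms(1) that(2)])
    then show ?thesis
      by (rule Lim_bounded[of _ _ N]) (use N that in auto)
  qed
  then show ?thesis using that by blast
qed

text \<open>Uniform convergence of the finitely many partial derivatives controls the Frechet
  derivatives in operator norm, which is what the theorem on sequences of derivatives over a convex
  set requires.\<close>

lemma
  fixes f :: "nat \<Rightarrow> real^'n::finite \<Rightarrow> real"
  assumes "open Q" "convex Q" "\<And>n. smooth_on Q (f n)" "unif_cauchy Q f" "\<And>i. unif_cauchy Q (\<lambda>n. pd i (f n))" "z \<in> Q"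
  shows unif_cauchy_lim_differentiable: "(\<lambda>z. lim (\<lambda>n. f n z)) differentiable (at z)"
    and unif_cauchy_lim_pd: "pd i (\<lambda>z. lim (\<lambda>n. f n z)) z = lim (\<lambda>n. pd i (f n) z)"
proof -
  let ?g' = "\<lambda>x h. \<Sum>i\<in>UNIV. h $ i * lim (\<lambda>n. pd i (f n) x)"
  have "\<exists>g. \<forall>x\<in>Q. (\<lambda>n. f n x) \<longlonglongrightarrow> g x \<and> (g has_derivative ?g' x) (at x within Q)"
  proof (rule has_derivative_sequence[OF assms(2) _ _ assms(6)])
    show "(f n has_derivative (\<lambda>h. \<Sum>i\<in>UNIV. h $ i * pd i (f n) x)) (at x within Q)" if "x \<in> Q" for n x
      by (rule has_derivative_at_withinI[OF has_derivative_pd[OF smooth_on_differentiable[OF assms(3) that]]])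
    show "(\<lambda>n. f n z) \<longlonglongrightarrow> lim (\<lambda>n. f n z)" by (rule unif_cauchy_limit[OF assms(4,6)])
    fix e :: real assume "e > 0"
    define e' where "e' = e / real CARD('n)"
    have e': "e' > 0" "real CARD('n) * e' = e" using \<open>e > 0\<close> by (simp_all add: e'_def)
    have "\<exists>N. \<forall>n\<ge>N. \<forall>x\<in>Q. \<bar>pd i (f n) x - lim (\<lambda>n. pd i (f n) x)\<bar> \<le> e'" for i
      using unif_cauchy_uniform_limit[OF assms(5) e'(1)] by metis
    then obtain N where N: "\<And>i n x. n \<ge> N i \<Longrightarrow> x \<in> Q \<Longrightarrow> \<bar>pd i (f n) x - lim (\<lambda>n. pd i (f n) x)\<bar> \<le> e'" by metis
    have Nle: "N i \<le> Max (range N)" for i by simp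
    show "\<forall>\<^sub>F n in sequentially. \<forall>x\<in>Q. \<forall>h. norm ((\<Sum>i\<in>UNIV. h $ i * pd i (f n) x) - ?g' x h) \<le> e * norm h"
      unfolding eventually_sequentially
    proof (intro exI[of _ "Max (range N)"] allI impI ballI)
      fix n x h assume n: "n \<ge> Max (range N)" and x: "x \<in> Q"
      have "norm ((\<Sum>i\<in>UNIV. h $ i * pd i (f n) x) - ?g' x h)
          = \<bar>\<Sum>i\<in>UNIV. h $ i * (pd i (f n) x - lim (\<lambda>n. pd i (f n) x))\<bar>"
        by (simp add: sum_subtractf algebra_simps)
      also have "\<dots> \<le> (\<Sum>i\<in>UNIV. \<bar>h $ i * (pd i (f n) x - lim (\<lambda>n. pd i (f n) x))\<bar>)" by (rule sum_abs)
      also have "\<dots> \<le> (\<Sum>i\<in>(UNIV::'n set). norm h * e')"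
        unfolding abs_mult
        by (intro sum_mono mult_mono N[OF order_trans[OF Nle n] x] component_le_norm_cart) auto
      also have "\<dots> = e * norm h" using e'(2) by (simp add: algebra_simps)
      finally show "norm ((\<Sum>i\<in>UNIV. h $ i * pd i (f n) x) - ?g' x h) \<le> e * norm h" .
    qed
  qed
  then obtain g where g: "\<And>x. x \<in> Q \<Longrightarrow> (\<lambda>n. f n x) \<longlonglongrightarrow> g x"
    "(g has_derivative ?g' z) (at z within Q)" using assms(6) by blast
  from g(2) have "(g has_derivative ?g' z) (at z)" unfolding at_within_open[OF assms(6,1)] .
  moreover have "g x = lim (\<lambda>n. f n x)" if "x \<in> Q" for x using g(1)[OF that] limI by metis
  ultimately have d: "((\<lambda>z. lim (\<lambda>n. f n z)) has_derivative ?g' z) (at z)"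
    by (rule has_derivative_transform_within_open[OF _ assms(1,6)])
  then show "(\<lambda>z. lim (\<lambda>n. f n z)) differentiable (at z)" unfolding differentiable_def by blast
  show "pd i (\<lambda>z. lim (\<lambda>n. f n z)) z = lim (\<lambda>n. pd i (f n) z)"
    using pd_eq[OF d, of i] by (simp add: sum_axis)
qed

lemma unif_cauchy_ck_lim_smooth:
  assumes "open Q" "convex Q" "\<And>n. smooth_on Q (f n)" "\<And>k. unif_cauchy_ck k Q f"
  shows "smooth_on Q (\<lambda>z. lim (\<lambda>n. f n z))"
proof -
  have "ck k Q (\<lambda>z. lim (\<lambda>n. f n z))" for k
    using assms(3,4)
  proof (induction k arbitrary: f)
    case 0
    have "unif_cauchy Q f" "unif_cauchy Q (\<lambda>n. pd i (f n))" for i using 0(2)[of "Suc 0"] by auto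
    then show ?case using unif_cauchy_lim_differentiable[OF assms(1,2)] 0(1) by simp
  next
    case (Suc k)
    have u: "unif_cauchy Q f" "unif_cauchy Q (\<lambda>n. pd i (f n))" for i using Suc.prems(2)[of "Suc 0"] by auto
    show ?case
    proof (rule ck_SucI[OF assms(1), where f' = "\<lambda>i z. lim (\<lambda>n. pd i (f n) z)"])
      show "ck k Q (\<lambda>z. lim (\<lambda>n. pd i (f n) z))" for i
      proof (rule Suc.IH)
        show "unif_cauchy_ck k' Q (\<lambda>n. pd i (f n))" for k' using Suc.prems(2)[of "Suc k'"] by simp
      qed (intro smooth_on_pd Suc.prems)
    qed (use unif_cauchy_lim_differentiable[OF assms(1,2) Suc.prems(1) u] unif_cauchy_lim_pd[OF assms(1,2) Suc.prems(1) u] in auto)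
  qed
  then show ?thesis by (simp add: smooth_on_iff_ck)
qed


section \<open>Flow of a smooth vector field\<close>

text \<open>The integral contributes a factor \<open>r\<close> and the sum over components a factor
  \<open>CARD('i)\<close>, so one step of the recursion multiplies the distance of two iterates by
  at most \<open>r * L * CARD('i)\<close>, that is by at most 1/2. The error \<open>e\<close> in
  \<open>dG\<close> admits integrands whose coefficients themselves still vary with
  \<open>n\<close>.\<close>

lemma unif_cauchy_contraction:
  fixes X G :: "nat \<Rightarrow> 'i::finite \<Rightarrow> real^'n::finite \<Rightarrow> real"
  assumes rec: "\<And>n i z. z \<in> cube r \<Longrightarrow> X (Suc n) i z = w i z + coord_int ix (G n i) z"
    and cG: "\<And>n i. continuous_on (cube r) (G n i)"
    and bX: "\<And>n i z. z \<in> cube r \<Longrightarrow> \<bar>X n i z\<bar> \<le> M"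
    and dG: "\<And>e. e > 0 \<Longrightarrow> \<exists>N. \<forall>m\<ge>N. \<forall>n\<ge>N. \<forall>i. \<forall>z\<in>cube r.
        \<bar>G m i z - G n i z\<bar> \<le> L * (\<Sum>j\<in>UNIV. \<bar>X m j z - X n j z\<bar>) + e"
    and r: "0 < r" "r * L * real CARD('i) \<le> 1 / 2" and L: "L \<ge> 0"
  shows "unif_cauchy (cube r) (\<lambda>n. X n i)"
proof -
  define c where "c = real CARD('i)"
  have c: "c > 0" by (simp add: c_def)
  define D where "D = (\<lambda>m n z. \<Sum>j\<in>UNIV. \<bar>X m j z - X n j z\<bar>)"
  have "\<exists>N. \<forall>m\<ge>N. \<forall>n\<ge>N. \<forall>z\<in>cube r. \<bar>X m i z - X n i z\<bar> \<le> e" if e: "e > 0" for e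
  proof -
    \<comment> \<open>Each step adds \<open>e / 4\<close>; with the ratio 1/2 the total stays below
      \<open>e / 2\<close>, and the other half is left for the shrinking initial distance.\<close>
    define e0 where "e0 = e / (4 * r * c)"
    have e0: "e0 > 0" "c * (r * e0) = e / 4" using e r(1) c by (simp_all add: e0_def field_simps)
    obtain N where N: "\<And>m n i z. m \<ge> N \<Longrightarrow> n \<ge> N \<Longrightarrow> z \<in> cube r \<Longrightarrow>
        \<bar>G m i z - G n i z\<bar> \<le> L * D m n z + e0" using dG[OF e0(1)] unfolding D_def by blast
    have step: "D m n z \<le> c * (2 * M) / 2 ^ k + e / 2" if "m \<ge> N + k" "n \<ge> N + k" "z \<in> cube r" for k m n z
      using that
    proof (induction k arbitrary: m n z)
      case 0
      have "\<bar>X m j z - X n j z\<bar> \<le> 2 * M" for j using bX[OF 0(3), of m j] bX[OF 0(3), of n j] by linarith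
      then have "D m n z \<le> (\<Sum>j\<in>(UNIV::'i set). 2 * M)" unfolding D_def by (intro sum_mono)
      then show ?case using e by (simp add: c_def)
    next
      case (Suc k)
      define B where "B = c * (2 * M) / 2 ^ k + e / 2"
      obtain m' n' where mn: "m = Suc m'" "n = Suc n'" using Suc.prems by (metis add_Suc_right Suc_le_D)
      have le: "N \<le> m'" "N \<le> n'" "N + k \<le> m'" "N + k \<le> n'" using Suc.prems mn by auto
      have GB: "\<bar>G m' j y - G n' j y\<bar> \<le> L * B + e0" if "y \<in> cube r" for j y
      proof -
        have "L * D m' n' y \<le> L * B" using Suc.IH[OF le(3,4) that] L by (intro mult_left_mono) (auto simp: B_def)
        then show ?thesis using N[OF le(1,2) that, of j] by linarith
      qed
      have "\<bar>X m j z - X n j z\<bar> \<le> r * (L * B + e0)" for j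
      proof -
        have "X m j z - X n j z = coord_int ix (\<lambda>z. G m' j z - G n' j z) z"
          unfolding mn rec[OF Suc.prems(3)] using coord_int_diff[OF cG cG Suc.prems(3), of ix m' j n' j] by simp
        then show ?thesis
          using coord_int_bound[OF continuous_on_diff[OF cG cG] Suc.prems(3) GB] by simp
      qed
      then have "D m n z \<le> (\<Sum>j\<in>(UNIV::'i set). r * (L * B + e0))" unfolding D_def by (intro sum_mono)
      also have "\<dots> = (r * L * c) * B + c * (r * e0)" by (simp add: c_def algebra_simps)
      also have "\<dots> \<le> 1 / 2 * B + e / 4"
      proof -
        have "M \<ge> 0" using bX[OF Suc.prems(3)] by (meson abs_ge_zero order_trans)
        then have "B \<ge> 0" using e c by (simp add: B_def)
        then show ?thesis using e0(2) r(2) by (intro add_mono mult_right_mono) (auto simp: c_def)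
      qed
      also have "1 / 2 * B + e / 4 = c * (2 * M) / 2 ^ Suc k + e / 2" by (simp add: B_def field_simps)
      finally show ?case .
    qed
    have "(\<lambda>k. c * (2 * M) * (1/2) ^ k) \<longlonglongrightarrow> c * (2 * M) * 0"
      by (intro tendsto_intros LIMSEQ_realpow_zero) auto
    then have "eventually (\<lambda>k. c * (2 * M) * (1/2) ^ k < e / 2) sequentially"
      by (rule order_tendstoD(2)) (use e in simp)
    then obtain k where "c * (2 * M) * (1/2) ^ k < e / 2" unfolding eventually_sequentially by blast
    then have k: "c * (2 * M) / 2 ^ k < e / 2" by (simp add: power_one_over field_simps)
    have "\<bar>X m i z - X n i z\<bar> \<le> e" if "m \<ge> N + k" "n \<ge> N + k" "z \<in> cube r" for m n z
    proof -
      have "\<bar>X m i z - X n i z\<bar> \<le> D m n z" unfolding D_def by (rule member_le_sum) auto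
      then show ?thesis using step[OF that] k by linarith
    qed
    then show ?thesis by blast
  qed
  then show ?thesis unfolding unif_cauchy_def using bX by blast
qed

text \<open>
  Every derivative of the solution transversal to \<open>ix\<close> satisfies an iteration with the same coefficient
  matrix \<open>a\<close>; hence one smallness condition on \<open>r\<close> serves all orders \<open>k\<close>.
\<close>
lemma unif_cauchy_ck_linear:
  fixes X b :: "nat \<Rightarrow> 'i::finite \<Rightarrow> real^'n::finite \<Rightarrow> real"
  assumes r: "0 < r" "r * A * real CARD('i) \<le> 1 / 2" and A: "A \<ge> 0"
    and sa: "\<And>n i j. smooth_on (cube r) (a n i j)" and ba: "\<And>n i j z. z \<in> cube r \<Longrightarrow> \<bar>a n i j z\<bar> \<le> A"
    and Ua: "\<And>i j. unif_cauchy_ck k (cube r) (\<lambda>n. a n i j)"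
    and sX: "\<And>n i. smooth_on (cube r) (X n i)" and sb: "\<And>n i. smooth_on (cube r) (b n i)"
    and sw: "\<And>i. smooth_on (cube r) (w i)"
    and Ub: "\<And>i. unif_cauchy_ck k (cube r) (\<lambda>n. b n i)" and Uw: "\<And>i. unif_cauchy_ck k (cube r) (\<lambda>n. w i)"
    and U0: "\<And>i. unif_cauchy_ck k (cube r) (\<lambda>n. X 0 i)"
    and rec: "\<And>n i z. z \<in> cube r \<Longrightarrow> X (Suc n) i z = w i z + coord_int ix (\<lambda>z. (\<Sum>j\<in>UNIV. a n i j z * X n j z) + b n i z) z"
  shows "unif_cauchy_ck k (cube r) (\<lambda>n. X n i)"
  using Ua sX sb sw Ub Uw U0 rec
proof (induction k arbitrary: X b w i)
  case 0
  note sX = 0(2) and sb = 0(3) and rec = 0(8)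
  define c where "c = real CARD('i)"
  have c: "c > 0" by (simp add: c_def)
  let ?G = "\<lambda>n i z. (\<Sum>j\<in>UNIV. a n i j z * X n j z) + b n i z"
  have ua: "unif_cauchy (cube r) (\<lambda>n. a n i j)" and ub: "unif_cauchy (cube r) (\<lambda>n. b n i)"
    and uw: "unif_cauchy (cube r) (\<lambda>n. w i)" and u0: "unif_cauchy (cube r) (\<lambda>n. X 0 i)" for i j
    using 0 by auto
  have cG: "continuous_on (cube r) (?G n i)" for n i
    by (intro smooth_on_continuous smooth_intros open_cube sa sX sb)
  obtain Mb where Mb: "Mb \<ge> 0" "\<And>i n z. z \<in> cube r \<Longrightarrow> \<bar>b n i z\<bar> \<le> Mb"
    using unif_cauchy_bounded_family[of "cube r" "\<lambda>i n. b n i", OF ub] by blast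
  obtain Mw where Mw: "Mw \<ge> 0" "\<And>i z. z \<in> cube r \<Longrightarrow> \<bar>w i z\<bar> \<le> Mw"
    using unif_cauchy_bounded_family[of "cube r" "\<lambda>i n. w i", OF uw] by metis
  obtain M0 where M0: "M0 \<ge> 0" "\<And>i z. z \<in> cube r \<Longrightarrow> \<bar>X 0 i z\<bar> \<le> M0"
    using unif_cauchy_bounded_family[of "cube r" "\<lambda>i n. X 0 i", OF u0] by metis
  \<comment> \<open>Chosen such that \<open>Mw + (M / 2 + r * Mb) \<le> M\<close>: the bound
    reproduces itself under the recursion, the smallness of \<open>r\<close> supplying the factor
    1/2.\<close>
  define M where "M = M0 + 2 * (Mw + r * Mb)"
  have M: "M \<ge> 0" using M0 Mw Mb r(1) by (simp add: M_def)
  have bX: "\<bar>X n i z\<bar> \<le> M" if "z \<in> cube r" for n i z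
    using that
  proof (induction n arbitrary: i z)
    case 0 then show ?case using M0(2)[OF 0, of i] Mw(1) Mb(1) r(1) by (simp add: M_def add_increasing2)
  next
    case (Suc n)
    have "\<bar>?G n i y\<bar> \<le> c * (A * M) + Mb" if "y \<in> cube r" for y
    proof -
      have "\<bar>\<Sum>j\<in>UNIV. a n i j y * X n j y\<bar> \<le> (\<Sum>j\<in>UNIV. \<bar>a n i j y * X n j y\<bar>)" by (rule sum_abs)
      also have "\<dots> \<le> (\<Sum>j\<in>(UNIV::'i set). A * M)"
        unfolding abs_mult by (intro sum_mono mult_mono ba Suc.IH that A) auto
      finally show ?thesis using Mb(2)[OF that, of n i] by (simp add: c_def)
    qed
    then have "\<bar>coord_int ix (?G n i) z\<bar> \<le> r * (c * (A * M) + Mb)" by (intro coord_int_bound[OF cG Suc.prems])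
    also have "\<dots> = (r * A * c) * M + r * Mb" by (simp add: algebra_simps)
    also have "\<dots> \<le> 1 / 2 * M + r * Mb" using mult_right_mono[OF r(2) M] by (simp add: c_def)
    finally have "\<bar>X (Suc n) i z\<bar> \<le> Mw + (M / 2 + r * Mb)"
      unfolding rec[OF Suc.prems] using Mw(2)[OF Suc.prems, of i] by linarith
    then show ?case using M0(1) by (simp add: M_def field_simps)
  qed
  have "unif_cauchy (cube r) (\<lambda>n. X n i)"
  proof (rule unif_cauchy_contraction[where G = ?G and X = X and w = w, OF rec cG bX _ r A])
    fix e :: real assume e: "e > 0"
    define d where "d = e / (c * M + 1)"
    have d: "d > 0" "d * (c * M + 1) = e" using e add_nonneg_pos[of "c * M" 1] c M by (simp_all add: d_def)
    obtain N1 where N1: "\<And>p m n z. m \<ge> N1 \<Longrightarrow> n \<ge> N1 \<Longrightarrow> z \<in> cube r \<Longrightarrow> \<bar>a m (fst p) (snd p) z - a n (fst p) (snd p) z\<bar> \<le> d"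
      using unif_cauchy_cauchy_family[of "cube r" "\<lambda>p n. a n (fst p) (snd p)", OF ua d(1)] by blast
    obtain N2 where N2: "\<And>i m n z. m \<ge> N2 \<Longrightarrow> n \<ge> N2 \<Longrightarrow> z \<in> cube r \<Longrightarrow> \<bar>b m i z - b n i z\<bar> \<le> d"
      using unif_cauchy_cauchy_family[of "cube r" "\<lambda>i n. b n i", OF ub d(1)] by blast
    have "\<bar>?G m i z - ?G n i z\<bar> \<le> A * (\<Sum>j\<in>UNIV. \<bar>X m j z - X n j z\<bar>) + e"
      if h: "m \<ge> max N1 N2" "n \<ge> max N1 N2" "z \<in> cube r" for m n i z
    proof -
      have t: "\<bar>a m i j z * X m j z - a n i j z * X n j z\<bar> \<le> A * \<bar>X m j z - X n j z\<bar> + d * M" for j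
      proof -
        have "a m i j z * X m j z - a n i j z * X n j z = a m i j z * (X m j z - X n j z) + (a m i j z - a n i j z) * X n j z"
          by (simp add: algebra_simps)
        then have "\<bar>a m i j z * X m j z - a n i j z * X n j z\<bar> \<le> \<bar>a m i j z\<bar> * \<bar>X m j z - X n j z\<bar> + \<bar>a m i j z - a n i j z\<bar> * \<bar>X n j z\<bar>"
          by (metis abs_mult abs_triangle_ineq)
        also have "\<dots> \<le> A * \<bar>X m j z - X n j z\<bar> + d * M"
          using N1[of m n z "(i, j)"] h order_less_imp_le[OF d(1)]
          by (intro add_mono mult_mono ba bX A abs_ge_zero) auto
        finally show ?thesis .
      qed
      have "?G m i z - ?G n i z = (\<Sum>j\<in>UNIV. a m i j z * X m j z - a n i j z * X n j z) + (b m i z - b n i z)"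
        by (simp add: sum_subtractf)
      then have "\<bar>?G m i z - ?G n i z\<bar> \<le> (\<Sum>j\<in>UNIV. \<bar>a m i j z * X m j z - a n i j z * X n j z\<bar>) + \<bar>b m i z - b n i z\<bar>"
        using sum_abs[of "\<lambda>j. a m i j z * X m j z - a n i j z * X n j z" UNIV] by linarith
      also have "\<dots> \<le> (\<Sum>j\<in>UNIV. A * \<bar>X m j z - X n j z\<bar> + d * M) + d"
        by (intro add_mono sum_mono t N2) (use h in auto)
      also have "\<dots> = A * (\<Sum>j\<in>UNIV. \<bar>X m j z - X n j z\<bar>) + d * (c * M + 1)"
        by (simp add: sum.distrib sum_distrib_left c_def algebra_simps)
      finally show ?thesis using d(2) by simp
    qed
    then show "\<exists>N. \<forall>m\<ge>N. \<forall>n\<ge>N. \<forall>i. \<forall>z\<in>cube r. \<bar>?G m i z - ?G n i z\<bar> \<le> A * (\<Sum>j\<in>UNIV. \<bar>X m j z - X n j z\<bar>) + e"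
      by blast
  qed
  then show ?case by simp
next
  case (Suc k)
  note sX = Suc.prems(2) and sb = Suc.prems(3) and sw = Suc.prems(4) and rec = Suc.prems(8)
  let ?G = "\<lambda>n i z. (\<Sum>j\<in>UNIV. a n i j z * X n j z) + b n i z"
  have UkX: "unif_cauchy_ck k (cube r) (\<lambda>n. X n i)" for i
    by (rule Suc.IH[OF unif_cauchy_ck_mono[OF Suc.prems(1)] sX sb sw unif_cauchy_ck_mono[OF Suc.prems(5)] unif_cauchy_ck_mono[OF Suc.prems(6)]
          unif_cauchy_ck_mono[OF Suc.prems(7)] rec])
  have sG: "smooth_on (cube r) (?G n i)" for n i
    by (intro smooth_intros open_cube sa sX sb)
  have UG: "unif_cauchy_ck k (cube r) (\<lambda>n. ?G n i)" for i
    by (intro unif_cauchy_ck_add[OF open_cube] unif_cauchy_ck_sum[OF open_cube] unif_cauchy_ck_mult[OF open_cube] smooth_intros open_cube sa sX sb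
        UkX unif_cauchy_ck_mono[OF Suc.prems(1)] unif_cauchy_ck_mono[OF Suc.prems(5)])
  have dS: "pd l (X (Suc n) i) z = pd l (w i) z + (if l = ix then ?G n i z else coord_int ix (pd l (?G n i)) z)"
    if "z \<in> cube r" for l n i z
  proof -
    have "pd l (X (Suc n) i) z = pd l (\<lambda>z. w i z + coord_int ix (?G n i) z) z"
      by (rule pd_cong_open[OF open_cube that rec])
    then show ?thesis
      using pd_add[OF smooth_on_differentiable[OF sw that] coord_int_differentiable[OF sG that]] pd_coord_int[OF sG that] by simp
  qed
  \<comment> \<open>Along \<open>ix\<close> the derivative of the next iterate is an expression in
    the present one, already settled to order \<open>k\<close>. Transversally the derivatives
    satisfy a recursion with the same \<open>a\<close>; the terms in which \<open>a\<close> itself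
    is differentiated join the inhomogeneity.\<close>
  have Up: "unif_cauchy_ck k (cube r) (\<lambda>n. pd l (X n i))" for l i
  proof (cases "l = ix")
    case True
    have "unif_cauchy_ck k (cube r) (\<lambda>n z. pd ix (w i) z + ?G n i z)"
      by (intro unif_cauchy_ck_add[OF open_cube] UG smooth_on_pd sw sG) (use Suc.prems(6) in simp)
    then have "unif_cauchy_ck k (cube r) (\<lambda>n. pd l (X (Suc n) i))"
      by (subst unif_cauchy_ck_cong[OF open_cube]) (auto simp: dS True)
    moreover have "unif_cauchy_ck k (cube r) (\<lambda>n. pd l (X 0 i))" using Suc.prems(7) by simp
    ultimately show ?thesis by (rule unif_cauchy_ck_shift)
  next
    case False
    let ?b = "\<lambda>n i z. (\<Sum>j\<in>UNIV. pd l (a n i j) z * X n j z) + pd l (b n i) z"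
    have pG: "pd l (?G n i) z = (\<Sum>j\<in>UNIV. a n i j z * pd l (X n j) z) + ?b n i z" if "z \<in> cube r" for n i z
    proof -
      have d: "a n i j differentiable (at z)" "X n j differentiable (at z)" "b n i differentiable (at z)" for j
        using smooth_on_differentiable[OF _ that] sa sX sb by auto
      have "pd l (?G n i) z = (\<Sum>j\<in>UNIV. pd l (\<lambda>z. a n i j z * X n j z) z) + pd l (b n i) z"
        by (subst pd_add) (auto intro!: differentiable_sum_all differentiable_mult d pd_sum)
      then show ?thesis by (simp add: pd_mult[OF d(1,2)] sum.distrib)
    qed
    show ?thesis
    proof (rule Suc.IH[where X = "\<lambda>n i. pd l (X n i)" and w = "\<lambda>i. pd l (w i)" and b = ?b])
      show "unif_cauchy_ck k (cube r) (\<lambda>n. ?b n i)" for i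
        by (intro unif_cauchy_ck_add[OF open_cube] unif_cauchy_ck_sum[OF open_cube] unif_cauchy_ck_mult[OF open_cube] smooth_intros open_cube sa sX sb UkX)
          (use Suc.prems(1,5) in auto)
      show "pd l (X (Suc n) i) z = pd l (w i) z + coord_int ix (\<lambda>z. (\<Sum>j\<in>UNIV. a n i j z * pd l (X n j) z) + ?b n i z) z"
        if "z \<in> cube r" for n i z
        using dS[OF that, of l n i] coord_int_cong[where ix = ix, OF pG that] False by simp
    qed (use Suc.prems(6,7) unif_cauchy_ck_mono[OF Suc.prems(1)] in \<open>auto intro!: smooth_intros open_cube sa sX sb sw\<close>)
  qed
  show ?case using unif_cauchy_ck_uc0[OF UkX] Up by simp
qed


text \<open>The sum norm on the right matches the distance in which
  \<open>unif_cauchy_contraction\<close> measures iterates.\<close>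

lemma Lipschitz_l1:
  fixes W :: "real^'n::finite \<Rightarrow> real"
  assumes "convex K" "\<And>x. x \<in> K \<Longrightarrow> W differentiable (at x)" "\<And>x i. x \<in> K \<Longrightarrow> \<bar>pd i W x\<bar> \<le> A" "x \<in> K" "y \<in> K"
  shows "\<bar>W x - W y\<bar> \<le> A * (\<Sum>j\<in>UNIV. \<bar>x $ j - y $ j\<bar>)"
proof -
  define l where "l = (\<lambda>s. y + s *\<^sub>R (x - y))"
  have lK: "l s \<in> K" if "s \<in> {0..1}" for s
  proof -
    have "l s = (1 - s) *\<^sub>R y + s *\<^sub>R x" by (simp add: l_def algebra_simps)
    then show ?thesis using assms(1,4,5) that by (simp add: convex_def)
  qed
  have der: "((\<lambda>s. W (l s)) has_real_derivative (\<Sum>i\<in>UNIV. (x - y) $ i * pd i W (l s))) (at s)" if "s \<in> {0..1}" for s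
  proof -
    have "(l has_derivative (\<lambda>h. h *\<^sub>R (x - y))) (at s)"
      unfolding l_def by (auto intro!: derivative_eq_intros)
    from has_derivative_compose[OF this has_derivative_pd[OF assms(2)[OF lK[OF that]]]]
    have "((\<lambda>s. W (l s)) has_derivative (\<lambda>h. \<Sum>i\<in>UNIV. (h *\<^sub>R (x - y)) $ i * pd i W (l s))) (at s)" .
    moreover have "(\<lambda>h. \<Sum>i\<in>UNIV. (h *\<^sub>R (x - y)) $ i * pd i W (l s)) = (*) (\<Sum>i\<in>UNIV. (x - y) $ i * pd i W (l s))"
      by (rule ext) (simp add: sum_distrib_left sum_distrib_right mult_ac)
    ultimately show ?thesis unfolding has_field_derivative_def by simp
  qed
  have "\<exists>s>0. s < 1 \<and> W (l 1) - W (l 0) = (1 - 0) * (\<Sum>i\<in>UNIV. (x - y) $ i * pd i W (l s))"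
    by (rule MVT2) (use der in auto)
  then obtain s where s: "0 < s" "s < 1" "W (l 1) - W (l 0) = (1 - 0) * (\<Sum>i\<in>UNIV. (x - y) $ i * pd i W (l s))"
    by blast
  have "\<bar>W x - W y\<bar> = \<bar>\<Sum>i\<in>UNIV. (x - y) $ i * pd i W (l s)\<bar>" using s(3) by (simp add: l_def)
  also have "\<dots> \<le> (\<Sum>i\<in>UNIV. \<bar>(x - y) $ i * pd i W (l s)\<bar>)" by (rule sum_abs)
  also have "\<dots> \<le> (\<Sum>i\<in>UNIV. \<bar>x $ i - y $ i\<bar> * A)"
    unfolding abs_mult vector_minus_component using s by (intro sum_mono mult_left_mono assms(3) lK) auto
  finally show ?thesis by (simp add: sum_distrib_left mult.commute)
qed

lemma bounded_family_on_compact: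
  fixes F :: "'i::finite \<Rightarrow> real^'n::finite \<Rightarrow> real"
  assumes "compact K" "\<And>i. continuous_on K (F i)"
  obtains M where "M \<ge> 0" "\<And>i x. x \<in> K \<Longrightarrow> \<bar>F i x\<bar> \<le> M"
proof -
  have "unif_cauchy K (\<lambda>n. F i)" for i
  proof -
    have "bounded (F i ` K)" using compact_continuous_image[OF assms(2,1)] compact_imp_bounded by blast
    then obtain M where "\<And>x. x \<in> K \<Longrightarrow> \<bar>F i x\<bar> \<le> M" unfolding bounded_iff by auto
    then show ?thesis by (rule unif_cauchy_const)
  qed
  from unif_cauchy_bounded_family[of K "\<lambda>i n. F i", OF this] that show ?thesis by metis
qed

text \<open>Differentiating the nonlinear iteration across \<open>ix\<close> gives a linear one
  whose coefficients are the derivatives of \<open>V\<close> along the iterates. These are Cauchy to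
  order \<open>k\<close> because the iterates are, and \<open>unif_cauchy_ck_linear\<close> raises
  the order of the iterates by one. The bound \<open>A\<close> on the coefficients, and with it
  \<open>r\<close>, is the same at each order.\<close>

lemma unif_cauchy_ck_picard:
  fixes V :: "'n \<Rightarrow> real^'n::finite \<Rightarrow> real" and X :: "nat \<Rightarrow> 'n \<Rightarrow> real^'n \<Rightarrow> real"
  assumes "open D" and sV: "\<And>i. smooth_on D (V i)" and K: "compact K" "convex K" "K \<subseteq> D"
    and r: "0 < r" "r * A * real CARD('n) \<le> 1 / 2" and A: "A \<ge> 0"
    and bV: "\<And>i j x. x \<in> K \<Longrightarrow> \<bar>pd j (V i) x\<bar> \<le> A"
    and inK: "\<And>n z. z \<in> cube r \<Longrightarrow> (\<chi> j. X n j z) \<in> K"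
    and sX: "\<And>n i. smooth_on (cube r) (X n i)" and sw: "\<And>i. smooth_on (cube r) (w i)"
    and Uw: "\<And>k i. unif_cauchy_ck k (cube r) (\<lambda>n. w i)" and X0: "\<And>i. X 0 i = w i"
    and rec: "\<And>n i z. X (Suc n) i z = w i z + coord_int ix (\<lambda>z. V i (\<chi> j. X n j z)) z"
  shows "unif_cauchy_ck k (cube r) (\<lambda>n. X n i)"
proof (induction k arbitrary: i)
  case 0
  obtain M where M: "\<And>x. x \<in> K \<Longrightarrow> norm x \<le> M" using compact_imp_bounded[OF K(1)] unfolding bounded_iff by blast
  have "unif_cauchy (cube r) (\<lambda>n. X n i)"
  proof (rule unif_cauchy_contraction[where w = w and G = "\<lambda>n i z. V i (\<chi> j. X n j z)", OF rec _ _ _ r A])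
    show "continuous_on (cube r) (\<lambda>z. V i (\<chi> j. X n j z))" for n i
      by (rule smooth_on_continuous, rule smooth_on_compose[OF open_cube _ sV]) (use sX inK K(3) in auto)
    show "\<bar>X n i z\<bar> \<le> M" if "z \<in> cube r" for n i z
      using order_trans[OF component_le_norm_cart[of _ i] M[OF inK[OF that]], of n] by simp
    fix e :: real assume "e > 0"
    have "\<bar>V i (\<chi> j. X m j z) - V i (\<chi> j. X n j z)\<bar> \<le> A * (\<Sum>j\<in>UNIV. \<bar>X m j z - X n j z\<bar>)" if "z \<in> cube r" for m n i z
      using Lipschitz_l1[where W = "V i" and x = "\<chi> j. X m j z" and y = "\<chi> j. X n j z",
          OF K(2) smooth_on_differentiable[OF sV subsetD[OF K(3)]] bV inK[OF that] inK[OF that]] by simp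
    then show "\<exists>N. \<forall>m\<ge>N. \<forall>n\<ge>N. \<forall>i. \<forall>z\<in>cube r. \<bar>V i (\<chi> j. X m j z) - V i (\<chi> j. X n j z)\<bar>
        \<le> A * (\<Sum>j\<in>UNIV. \<bar>X m j z - X n j z\<bar>) + e"
      using \<open>e > 0\<close> by (intro exI[of _ 0]) (auto intro: add_increasing2)
  qed
  then show ?case by simp
next
  case (Suc k)
  have VX: "unif_cauchy_ck k (cube r) (\<lambda>n z. W (\<chi> j. X n j z))" if "smooth_on D W" for W
    by (rule unif_cauchy_ck_compose[OF open_cube assms(1) K(1,3) inK _ _ that]) (use sX Suc.IH in auto)
  have sVX: "smooth_on (cube r) (\<lambda>z. W (\<chi> j. X n j z))" if "smooth_on D W" for W n
    by (rule smooth_on_compose[OF open_cube _ that]) (use sX inK K(3) in auto)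
  have dS: "pd l (X (Suc n) i) z = pd l (w i) z + (if l = ix then V i (\<chi> j. X n j z) else coord_int ix (pd l (\<lambda>z. V i (\<chi> j. X n j z))) z)"
    if "z \<in> cube r" for l n i z
  proof -
    have "X (Suc n) i = (\<lambda>z. w i z + coord_int ix (\<lambda>z. V i (\<chi> j. X n j z)) z)" using rec by blast
    then show ?thesis
      using pd_add[OF smooth_on_differentiable[OF sw[of i] that] coord_int_differentiable[OF sVX[OF sV[of i], of n] that, where ix = ix], where i = l]
        pd_coord_int[OF sVX[OF sV[of i], of n] that, where i = l and ix = ix] by simp
  qed
  have Up: "unif_cauchy_ck k (cube r) (\<lambda>n. pd l (X n i))" for l
  proof (cases "l = ix")
    case True
    have "unif_cauchy_ck k (cube r) (\<lambda>n z. pd ix (w i) z + V i (\<chi> j. X n j z))"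
      by (intro unif_cauchy_ck_add[OF open_cube] VX sV smooth_on_pd sw sVX) (use Uw[of "Suc k"] in simp)
    then have "unif_cauchy_ck k (cube r) (\<lambda>n. pd l (X (Suc n) i))"
      by (subst unif_cauchy_ck_cong[OF open_cube]) (auto simp: dS True)
    moreover have "unif_cauchy_ck k (cube r) (\<lambda>n. pd l (X 0 i))" using Uw[of "Suc k"] by (simp add: X0)
    ultimately show ?thesis by (rule unif_cauchy_ck_shift)
  next
    case False
    have pV: "pd l (\<lambda>z. V i (\<chi> j. X n j z)) z = (\<Sum>j\<in>UNIV. pd j (V i) (\<chi> j. X n j z) * pd l (X n j) z) + 0"
      if "z \<in> cube r" for n i z
      using pd_chain[of "\<lambda>z. \<chi> j. X n j z" z "V i" l] smooth_on_differentiable[OF sX that]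
        smooth_on_differentiable[OF sV subsetD[OF K(3) inK[OF that]]] by simp
    show ?thesis
    proof (rule unif_cauchy_ck_linear[where a = "\<lambda>n i j z. pd j (V i) (\<chi> j. X n j z)" and w = "\<lambda>i. pd l (w i)" and b = "\<lambda>n i z. 0"
          and X = "\<lambda>n i. pd l (X n i)", OF r A])
      show "pd l (X (Suc n) i) z = pd l (w i) z + coord_int ix (\<lambda>z. (\<Sum>j\<in>UNIV. pd j (V i) (\<chi> j. X n j z) * pd l (X n j) z) + 0) z"
        if "z \<in> cube r" for n i z
        using dS[OF that, of l n i] coord_int_cong[where ix = ix, OF pV that] False by simp
      show "unif_cauchy_ck k (cube r) (\<lambda>n. pd l (X 0 i))" "unif_cauchy_ck k (cube r) (\<lambda>n. pd l (w i))" for i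
        using Uw[of "Suc k"] by (simp_all add: X0)
    qed (auto intro!: VX sVX smooth_on_pd sV sX sw bV inK unif_cauchy_ck_const smooth_on_const[OF open_cube])
  qed
  then show ?case using unif_cauchy_ck_uc0[OF Suc.IH] by simp
qed

text \<open>With the flow time as one coordinate \<open>ix\<close> among the others, smoothness in
  time and in the initial point is a single statement. The matrix \<open>P\<close> directs the
  initial slice; it is chosen later to make the Jacobian at 0 invertible.\<close>

theorem flow_exists:
  fixes V :: "'n::finite \<Rightarrow> real^'n \<Rightarrow> real" and P :: "real^'n^'n"
  assumes D: "open D" "x0 \<in> D" and sV: "\<And>i. smooth_on D (V i)"
  obtains r \<phi> where "r > 0" "\<And>i. smooth_on (cube r) (\<lambda>z. \<phi> z $ i)" "\<And>z. z \<in> cube r \<Longrightarrow> \<phi> z \<in> D"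
    "\<And>z i. z \<in> cube r \<Longrightarrow> pd ix (\<lambda>z. \<phi> z $ i) z = V i (\<phi> z)"
    "\<And>z. z \<in> cube r \<Longrightarrow> z $ ix = 0 \<Longrightarrow> \<phi> z = x0 + P *v z"
proof -
  obtain R where R: "R > 0" "cball x0 R \<subseteq> D" using D open_contains_cball by blast
  let ?K = "cball x0 R"
  define c where "c = real CARD('n)"
  have c: "c > 0" by (simp add: c_def)
  have cV: "continuous_on ?K (V i)" "continuous_on ?K (pd j (V i))" for i j
    using smooth_on_continuous[OF sV] smooth_on_continuous[OF smooth_on_pd[OF sV]] R(2) continuous_on_subset by blast+
  obtain Mv where Mv: "Mv \<ge> 0" "\<And>i x. x \<in> ?K \<Longrightarrow> \<bar>V i x\<bar> \<le> Mv"
    using bounded_family_on_compact[of ?K V] cV by auto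
  obtain A where A: "A \<ge> 0" "\<And>p x. x \<in> ?K \<Longrightarrow> \<bar>pd (fst p) (V (snd p)) x\<bar> \<le> A"
    using bounded_family_on_compact[of ?K "\<lambda>p. pd (fst p) (V (snd p))"] cV by auto
  define S where "S = (\<Sum>i\<in>UNIV. \<Sum>j\<in>UNIV. \<bar>P $ i $ j\<bar>)"
  have S: "S \<ge> 0" unfolding S_def by (intro sum_nonneg) auto
  \<comment> \<open>The three bounds keep the initial slice within \<open>R / 2\<close> of
    \<open>x0\<close>, the integral of \<open>V\<close> within another \<open>R / 2\<close>, and the
    contraction factor at most 1/2. The added 1 makes the denominators positive.\<close>
  define r where "r = min (R / (2 * (S + 1))) (min (R / (2 * (c * Mv + 1))) (1 / (2 * (A * c + 1))))"
  have pos: "S + 1 > 0" "c * Mv + 1 > 0" "A * c + 1 > 0" using S c Mv(1) A(1) by (simp_all add: add_nonneg_pos)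
  have r: "r > 0" unfolding r_def using R(1) pos by simp
  have rq: "r * q \<le> t / 2" if "r \<le> t / (2 * q)" "q > 0" for q t
    using that by (simp add: field_simps)
  have "r * (S + 1) \<le> R / 2" "r * (c * Mv + 1) \<le> R / 2" "r * (A * c + 1) \<le> 1 / 2"
    by (rule rq; use pos in \<open>simp add: r_def\<close>)+
  then have r1: "r * S \<le> R / 2" and r2: "c * (r * Mv) \<le> R / 2" and r3: "r * A * real CARD('n) \<le> 1 / 2"
    using r by (simp_all add: c_def algebra_simps)
  \<comment> \<open>The column \<open>ix\<close> of \<open>P\<close> is dropped, so that the initial
    value does not depend on the time coordinate.\<close>
  define w where "w = (\<lambda>i z. x0 $ i + (\<Sum>j\<in>UNIV. (if j = ix then 0 else P $ i $ j) * z $ j))"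
  define X where "X = rec_nat w (\<lambda>n Xn i z. w i z + coord_int ix (\<lambda>z. V i (\<chi> j. Xn j z)) z)"
  have X0: "X 0 i = w i" and XS: "X (Suc n) i = (\<lambda>z. w i z + coord_int ix (\<lambda>z. V i (\<chi> j. X n j z)) z)" for n i
    by (simp_all add: X_def)
  have sw: "smooth_on (cube r) (w i)" for i
    unfolding w_def by (intro smooth_intros open_cube)
  have Uw: "unif_cauchy_ck k (cube r) (\<lambda>n. w i)" for k i
    unfolding w_def
    by (intro unif_cauchy_ck_add[OF open_cube] unif_cauchy_ck_sum[OF open_cube] unif_cauchy_ck_mult[OF open_cube] smooth_intros open_cube unif_cauchy_ck_const unif_cauchy_ck_coord[where M = r])
      (auto simp: cube_def less_imp_le)
  have wx: "(\<Sum>i\<in>UNIV. \<bar>w i z - x0 $ i\<bar>) \<le> R / 2" if "z \<in> cube r" for z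
  proof -
    have "\<bar>w i z - x0 $ i\<bar> \<le> (\<Sum>j\<in>UNIV. \<bar>P $ i $ j\<bar>) * r" for i
    proof -
      have "\<bar>w i z - x0 $ i\<bar> \<le> (\<Sum>j\<in>UNIV. \<bar>(if j = ix then 0 else P $ i $ j) * z $ j\<bar>)"
        unfolding w_def using sum_abs by simp
      also have "\<dots> \<le> (\<Sum>j\<in>UNIV. \<bar>P $ i $ j\<bar> * r)"
        unfolding abs_mult using that by (intro sum_mono mult_mono) (auto simp: cube_def less_imp_le)
      finally show ?thesis by (simp add: sum_distrib_right)
    qed
    then have "(\<Sum>i\<in>UNIV. \<bar>w i z - x0 $ i\<bar>) \<le> (\<Sum>i\<in>UNIV. (\<Sum>j\<in>UNIV. \<bar>P $ i $ j\<bar>) * r)" by (intro sum_mono)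
    also have "\<dots> = r * S" by (simp add: S_def sum_distrib_left mult.commute)
    finally show ?thesis using r1 by simp
  qed
  have inv: "(\<forall>z\<in>cube r. (\<chi> j. X n j z) \<in> ?K) \<and> (\<forall>i. smooth_on (cube r) (X n i))" for n
  proof (induction n)
    case 0
    have "(\<chi> j. X 0 j z) \<in> ?K" if "z \<in> cube r" for z
    proof -
      have "norm ((\<chi> j. X 0 j z) - x0) \<le> (\<Sum>i\<in>UNIV. \<bar>w i z - x0 $ i\<bar>)"
        using norm_le_l1_cart[of "(\<chi> j. X 0 j z) - x0"] by (simp add: X0)
      then show ?thesis using wx[OF that] R(1) by (simp add: dist_norm norm_minus_commute)
    qed
    then show ?case using sw X0 by simp
  next
    case (Suc n)
    have sVX: "smooth_on (cube r) (\<lambda>z. V i (\<chi> j. X n j z))" for i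
      by (rule smooth_on_compose[OF open_cube _ sV]) (use Suc R(2) in auto)
    have "(\<chi> j. X (Suc n) j z) \<in> ?K" if z: "z \<in> cube r" for z
    proof -
      have Jb: "\<bar>coord_int ix (\<lambda>z. V i (\<chi> j. X n j z)) z\<bar> \<le> r * Mv" for i
        by (rule coord_int_bound[OF smooth_on_continuous[OF sVX] z]) (use Suc Mv(2) in blast)
      have "norm ((\<chi> j. X (Suc n) j z) - x0) \<le> (\<Sum>i\<in>UNIV. \<bar>X (Suc n) i z - x0 $ i\<bar>)"
        using norm_le_l1_cart[of "(\<chi> j. X (Suc n) j z) - x0"] by simp
      also have "\<dots> \<le> (\<Sum>i\<in>UNIV. \<bar>w i z - x0 $ i\<bar> + r * Mv)"
      proof (rule sum_mono)
        fix i show "\<bar>X (Suc n) i z - x0 $ i\<bar> \<le> \<bar>w i z - x0 $ i\<bar> + r * Mv"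
          using Jb[of i] unfolding XS by linarith
      qed
      also have "\<dots> = (\<Sum>i\<in>UNIV. \<bar>w i z - x0 $ i\<bar>) + c * (r * Mv)" by (simp add: sum.distrib c_def)
      also have "\<dots> \<le> R" using wx[OF z] r2 by linarith
      finally show ?thesis by (simp add: dist_norm norm_minus_commute)
    qed
    moreover have "smooth_on (cube r) (X (Suc n) i)" for i
      unfolding XS by (intro smooth_on_add[OF open_cube] sw smooth_coord_int sVX)
    ultimately show ?case by blast
  qed
  then have inK: "(\<chi> j. X n j z) \<in> ?K" if "z \<in> cube r" for n z using that by blast
  have sX: "smooth_on (cube r) (X n i)" for n i using inv by blast
  have sVX: "smooth_on (cube r) (\<lambda>z. V i (\<chi> j. X n j z))" for i n
    by (rule smooth_on_compose[OF open_cube _ sV]) (use sX inK R(2) in auto)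
  have U: "unif_cauchy_ck k (cube r) (\<lambda>n. X n i)" for k i
  proof (rule unif_cauchy_ck_picard[where V = V and K = ?K and D = D and w = w and ix = ix])
    show "\<And>i j x. x \<in> cball x0 R \<Longrightarrow> \<bar>pd j (V i) x\<bar> \<le> A" using A(2)[of _ "(_, _)"] by simp
  qed (use D sV R r r3 A(1) inK sX sw Uw X0 XS in auto)
  define \<phi> where "\<phi> = (\<lambda>z. \<chi> i. lim (\<lambda>n. X n i z))"
  have u: "unif_cauchy (cube r) (\<lambda>n. X n i)" "unif_cauchy (cube r) (\<lambda>n. pd l (X n i))" for i l
    using U[of "Suc 0" i] by auto
  have lim: "(\<lambda>n. \<chi> j. X n j z) \<longlonglongrightarrow> \<phi> z" if "z \<in> cube r" for z
    unfolding \<phi>_def by (intro vec_tendstoI) (use unif_cauchy_limit[OF u(1) that] in simp)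
  have \<phi>K: "\<phi> z \<in> ?K" if "z \<in> cube r" for z
    by (rule Lim_in_closed_set[OF closed_cball _ _ lim[OF that]]) (use inK[OF that] in auto)
  show ?thesis
  proof (rule that[OF r])
    show "smooth_on (cube r) (\<lambda>z. \<phi> z $ i)" for i
      unfolding \<phi>_def using unif_cauchy_ck_lim_smooth[OF open_cube convex_cube sX U] by simp
    show "\<phi> z \<in> D" if "z \<in> cube r" for z using \<phi>K[OF that] R(2) by blast
    show "\<phi> z = x0 + P *v z" if z: "z \<in> cube r" "z $ ix = 0" for z
    proof -
      have "X n i z = w i z" for n i by (cases n) (simp_all add: X0 XS coord_int_zero z(2))
      moreover have "w i z = (x0 + P *v z) $ i" for i
        unfolding w_def matrix_vector_mult_def using z(2) by (auto intro!: sum.cong)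
      ultimately show ?thesis by (simp add: \<phi>_def vec_eq_iff)
    qed
    show "pd ix (\<lambda>z. \<phi> z $ i) z = V i (\<phi> z)" if z: "z \<in> cube r" for z i
    proof -
      have "pd ix (\<lambda>z. \<phi> z $ i) z = lim (\<lambda>n. pd ix (X n i) z)"
        unfolding \<phi>_def using unif_cauchy_lim_pd[OF open_cube convex_cube sX u(1) u(2) z] by simp
      \<comment> \<open>The differential equation is the limit of the recursion: the derivative of
        \<open>coord_int\<close> along \<open>ix\<close> is its integrand, here \<open>V\<close> at
        the previous iterate.\<close>
      moreover have "(\<lambda>n. pd ix (X (Suc n) i) z) \<longlonglongrightarrow> V i (\<phi> z)"
      proof -
        have "pd ix (w i) z = 0"
        proof -
          have "pd ix (w i) z = (\<Sum>j\<in>UNIV. pd ix (\<lambda>z. (if j = ix then 0 else P $ i $ j) * z $ j) z)"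
            unfolding w_def
            by (subst pd_add, auto intro!: differentiable_sum_all differentiable_mult
                smooth_on_differentiable[OF smooth_on_coord[OF open_UNIV]])
              (subst pd_sum, auto intro!: differentiable_mult smooth_on_differentiable[OF smooth_on_coord[OF open_UNIV]])
          also have "\<dots> = 0"
            by (intro sum.neutral ballI, subst pd_cmult)
              (auto simp: pd_coord intro!: smooth_on_differentiable[OF smooth_on_coord[OF open_UNIV]])
          finally show ?thesis .
        qed
        then have "pd ix (X (Suc n) i) z = V i (\<chi> j. X n j z)" for n
          unfolding XS using pd_add[OF smooth_on_differentiable[OF sw[of i] z] coord_int_differentiable[OF sVX[where i = i and n = n] z, where ix = ix], where i = ix]
            pd_coord_int[OF sVX[where i = i and n = n] z, where i = ix and ix = ix] by simp
        moreover have "(\<lambda>n. V i (\<chi> j. X n j z)) \<longlonglongrightarrow> V i (\<phi> z)"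
          by (rule continuous_on_tendsto_compose[OF cV(1) lim[OF z] \<phi>K[OF z]]) (use inK[OF z] in auto)
        ultimately show ?thesis by simp
      qed
      ultimately show ?thesis
        using limI[OF LIMSEQ_imp_Suc] by simp
    qed
  qed
qed

section \<open>Inverse functions, closed forms and flow boxes\<close>

lemma matrix_inv_mult:
  fixes A :: "real^'n::finite^'n"
  assumes "invertible A"
  shows "A ** matrix_inv A = mat 1" "matrix_inv A ** A = mat 1"
proof -
  have "A ** matrix_inv A = mat 1 \<and> matrix_inv A ** A = mat 1"
    using assms unfolding matrix_inv_def invertible_def by (rule someI_ex)
  then show "A ** matrix_inv A = mat 1" "matrix_inv A ** A = mat 1" by blast+
qed

text \<open>The inverse function theorem yields one derivative of \<theta>, and that derivative is
  the inverse Jacobian matrix composed with \<theta>. Hence the functions \<open>h\<close> composed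
  with \<theta>, for \<open>h\<close> smooth on \<open>U'\<close>, have derivatives of the same
  form, and induction reaches every order.\<close>

theorem smooth_inverse_function:
  fixes \<psi> :: "real^'n::finite \<Rightarrow> real^'n"
  assumes "open U" "x0 \<in> U" and s: "\<And>i. smooth_on U (\<lambda>x. \<psi> x $ i)"
    and inv: "invertible (\<chi> a i. pd i (\<lambda>x. \<psi> x $ a) x0)"
  obtains U' V \<theta> where "open U'" "U' \<subseteq> U" "x0 \<in> U'" "open V" "homeomorphism U' V \<psi> \<theta>"
    "\<And>i. smooth_on V (\<lambda>y. \<theta> y $ i)"
proof -
  define M where "M = (\<lambda>x. \<chi> a i. pd i (\<lambda>x. \<psi> x $ a) x)"
  define f' where "f' = (\<lambda>x. Blinfun (\<lambda>h. M x *v h))"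
  have f' [simp]: "blinfun_apply (f' x) = (\<lambda>h. M x *v h)" for x
    unfolding f'_def by (rule bounded_linear_Blinfun_apply) (simp add: matrix_vector_mul_bounded_linear)
  \<comment> \<open>The matrix units as bounded linear maps. With them the derivative depends on
    \<open>x\<close> through its entries only, and its continuity in operator norm follows from that
    of the partial derivatives.\<close>
  define E :: "'n \<Rightarrow> 'n \<Rightarrow> (real^'n) \<Rightarrow>\<^sub>L (real^'n)" where "E = (\<lambda>a i. Blinfun (\<lambda>h. (h $ i) *\<^sub>R axis a 1))"
  have E: "blinfun_apply (E a i) h = (h $ i) *\<^sub>R axis a 1" for a i h
    unfolding E_def by (subst bounded_linear_Blinfun_apply)
      (auto intro: bounded_linear_scaleR_const bounded_linear_vec_nth)
  have f'E: "f' x = (\<Sum>a\<in>UNIV. \<Sum>i\<in>UNIV. pd i (\<lambda>x. \<psi> x $ a) x *\<^sub>R E a i)" for x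
  proof (rule blinfun_eqI)
    fix h
    have "(\<Sum>a\<in>UNIV. \<Sum>i\<in>UNIV. pd i (\<lambda>x. \<psi> x $ a) x * (h $ i * axis a 1 $ b)) = (M x *v h) $ b" for b
    proof -
      have "(\<Sum>a\<in>UNIV. \<Sum>i\<in>UNIV. pd i (\<lambda>x. \<psi> x $ a) x * (h $ i * axis a 1 $ b))
          = (\<Sum>a\<in>UNIV. axis b 1 $ a * (\<Sum>i\<in>UNIV. pd i (\<lambda>x. \<psi> x $ a) x * h $ i))"
        by (intro sum.cong) (auto simp: axis_def sum_distrib_left)
      then show ?thesis by (simp add: sum_axis M_def matrix_vector_mult_def)
    qed
    then show "blinfun_apply (f' x) h = blinfun_apply (\<Sum>a\<in>UNIV. \<Sum>i\<in>UNIV. pd i (\<lambda>x. \<psi> x $ a) x *\<^sub>R E a i) h"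
      by (simp add: blinfun.sum_left blinfun.scaleR_left E vec_eq_iff mult.assoc)
  qed
  have cont: "continuous_on U f'"
    unfolding f'E by (intro continuous_intros smooth_on_continuous smooth_on_pd s)
  have der: "(\<psi> has_derivative blinfun_apply (f' x)) (at x)" if "x \<in> U" for x
    using has_derivative_vec_pd[of \<psi> x] smooth_on_differentiable[OF s that]
    by (simp add: M_def matrix_vector_mult_def mult.commute)
  have "Blinfun (\<lambda>h. matrix_inv (M x0) *v h) o\<^sub>L f' x0 = id_blinfun"
  proof (rule blinfun_eqI)
    fix h
    have "blinfun_apply (Blinfun (\<lambda>h. matrix_inv (M x0) *v h)) = (\<lambda>h. matrix_inv (M x0) *v h)"
      by (rule bounded_linear_Blinfun_apply) (simp add: matrix_vector_mul_bounded_linear)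
    then show "blinfun_apply (Blinfun (\<lambda>h. matrix_inv (M x0) *v h) o\<^sub>L f' x0) h = blinfun_apply id_blinfun h"
      using matrix_inv_mult(2)[OF inv] by (simp add: matrix_vector_mul_assoc M_def)
  qed
  from inverse_function_theorem[OF assms(1) der cont assms(2) this]
  obtain U' V \<theta> \<theta>' where IFT: "open U'" "U' \<subseteq> U" "x0 \<in> U'" "open V" "homeomorphism U' V \<psi> \<theta>"
    and d\<theta>: "\<And>y. y \<in> V \<Longrightarrow> (\<theta> has_derivative \<theta>' y) (at y)"
    and \<theta>': "\<And>y. y \<in> V \<Longrightarrow> \<theta>' y = Hilbert_Choice.inv (blinfun_apply (f' (\<theta> y)))"
    and bij: "\<And>y. y \<in> V \<Longrightarrow> bij (blinfun_apply (f' (\<theta> y)))" by metis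
  have \<theta>U: "\<theta> y \<in> U'" if "y \<in> V" for y using IFT(5) that by (metis homeomorphism_def imageI)
  have invM: "invertible (M x)" if "x \<in> U'" for x
  proof -
    have "\<psi> x \<in> V" "\<theta> (\<psi> x) = x" using IFT(5) that by (auto simp: homeomorphism_def)
    then have "bij ((*v) (M x))" using bij[of "\<psi> x"] by simp
    then show ?thesis by (simp add: invertible_eq_bij)
  qed
  define N where "N = (\<lambda>x a j. matrix_inv (M x) $ a $ j)"
  have sN: "smooth_on U' (\<lambda>x. N x a j)" for a j
    unfolding N_def
    by (rule smooth_on_matrix_inv[OF IFT(1) _ invM])
      (simp_all add: M_def smooth_on_subset[OF smooth_on_pd[OF s] IFT(2)])
  have d\<theta>c: "((\<lambda>y. \<theta> y $ a) has_derivative (\<lambda>h. (matrix_inv (M (\<theta> y)) *v h) $ a)) (at y)" if "y \<in> V" for y a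
  proof -
    have "\<theta>' y h = matrix_inv (M (\<theta> y)) *v h" for h
    proof -
      have "inj ((*v) (M (\<theta> y)))" using bij[OF that] by (simp add: bij_def)
      moreover have "M (\<theta> y) *v (matrix_inv (M (\<theta> y)) *v h) = h"
        by (simp add: matrix_vector_mul_assoc matrix_inv_mult(1)[OF invM[OF \<theta>U[OF that]]])
      ultimately have "Hilbert_Choice.inv ((*v) (M (\<theta> y))) h = matrix_inv (M (\<theta> y)) *v h" by (rule inv_f_eq)
      then show ?thesis using \<theta>'[OF that] by simp
    qed
    then have "(\<theta> has_derivative (\<lambda>h. matrix_inv (M (\<theta> y)) *v h)) (at y)" using d\<theta>[OF that] by presburger
    then show ?thesis by (rule bounded_linear.has_derivative[OF bounded_linear_vec_nth])
  qed
  have d: "(\<lambda>y. \<theta> y $ a) differentiable (at y)" if "y \<in> V" for y a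
    using d\<theta>c[OF that] unfolding differentiable_def by blast
  have p: "pd j (\<lambda>y. \<theta> y $ a) y = N (\<theta> y) a j" if "y \<in> V" for y a j
    using pd_eq[OF d\<theta>c[OF that], of j] by (simp add: N_def matrix_vector_mult_basis column_def)
  have "ck k V (\<lambda>y. h (\<theta> y))" if "smooth_on U' h" for k h
    using that
  proof (induction k arbitrary: h)
    case 0
    then show ?case using differentiable_chain[OF d smooth_on_differentiable[OF _ \<theta>U]] by auto
  next
    case (Suc k)
    note dh = smooth_on_differentiable[OF Suc.prems \<theta>U]
    show ?case
    proof (rule ck_SucI[OF IFT(4) differentiable_chain[OF d dh], where f' = "\<lambda>j y. \<Sum>a\<in>UNIV. pd a h (\<theta> y) * N (\<theta> y) a j"])
      show "ck k V (\<lambda>y. \<Sum>a\<in>UNIV. pd a h (\<theta> y) * N (\<theta> y) a j)" for j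
        by (rule Suc.IH[of "\<lambda>x. \<Sum>a\<in>UNIV. pd a h x * N x a j"])
          (intro smooth_on_sum smooth_on_mult smooth_on_pd IFT(1) Suc.prems sN)
      show "pd j (\<lambda>y. h (\<theta> y)) y = (\<Sum>a\<in>UNIV. pd a h (\<theta> y) * N (\<theta> y) a j)" if "y \<in> V" for j y
        using pd_chain[OF d[OF that] dh[OF that], of j] by (simp add: p[OF that])
    qed
  qed
  from this[OF smooth_on_coord[OF IFT(1)]] have "smooth_on V (\<lambda>y. \<theta> y $ i)" for i
    by (simp add: smooth_on_iff_ck)
  then show ?thesis using that IFT by blast
qed

text \<open>The Poincare lemma: \<sigma> is the integral of the form along the segment from
  \<open>x0\<close>, and closedness turns the differentiated integrand into the derivative of
  \<open>s * w k (l s x)\<close> with respect to \<open>s\<close>.\<close>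

theorem closed_form_exact:
  fixes w :: "'n \<Rightarrow> real^'n::finite \<Rightarrow> real"
  assumes U: "open U" "convex U" "x0 \<in> U" and s: "\<And>i. smooth_on U (w i)"
    and closed: "\<And>x i j. x \<in> U \<Longrightarrow> pd i (w j) x = pd j (w i) x"
  obtains \<sigma> where "smooth_on U \<sigma>" "\<And>x i. x \<in> U \<Longrightarrow> pd i \<sigma> x = w i x" "\<sigma> x0 = 0"
proof -
  define l where "l = (\<lambda>s x. x0 + s *\<^sub>R (x - x0))"
  define F where "F = (\<lambda>s x. \<Sum>i\<in>UNIV. w i (l s x) * (x $ i - x0 $ i))"
  define \<sigma> where "\<sigma> = (\<lambda>x. integral {0..1} (\<lambda>s. F s x))"
  have lU: "l s x \<in> U" if "s \<in> {0..1}" "x \<in> U" for s x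
  proof -
    have "l s x = (1 - s) *\<^sub>R x0 + s *\<^sub>R x" by (simp add: l_def algebra_simps)
    then show ?thesis using U(2,3) that by (simp add: convex_def)
  qed
  have cd: "(\<lambda>x. x $ i) differentiable (at x)" for i and x :: "real^'n"
    by (rule smooth_on_differentiable[OF smooth_on_coord[OF open_UNIV]]) simp
  have ld: "(\<lambda>x. l s x $ a) differentiable (at x)" and lp: "pd k (\<lambda>x. l s x $ a) x = (if k = a then s else 0)" for s a k x
  proof -
    show "(\<lambda>x. l s x $ a) differentiable (at x)" unfolding l_def by (simp add: cd)
    have "(\<lambda>x. l s x $ a) = (\<lambda>x. (x0 $ a - s * x0 $ a) + s * x $ a)" by (auto simp: l_def algebra_simps)
    then show "pd k (\<lambda>x. l s x $ a) x = (if k = a then s else 0)"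
      using pd_add[of "\<lambda>x. x0 $ a - s * x0 $ a" x "\<lambda>x. s * x $ a" k] by (simp add: cd pd_cmult pd_coord)
  qed
  note wd = smooth_on_differentiable[OF s lU]
  have wld: "(\<lambda>x. w i (l s x)) differentiable (at x)"
    and wlp: "pd k (\<lambda>x. w i (l s x)) x = s * pd k (w i) (l s x)" if "s \<in> {0..1}" "x \<in> U" for s x i k
    using differentiable_chain[OF ld wd[OF that]] pd_chain[OF ld wd[OF that], of k]
    by (simp_all add: lp if_distrib[of "\<lambda>z. _ * z"] mult.commute[of s] cong: if_cong)
  have Fd: "F s differentiable (at x)" if "s \<in> {0..1}" "x \<in> U" for s x
    unfolding F_def by (intro differentiable_sum_all differentiable_mult differentiable_diff wld[OF that] cd) auto
  have Fp: "pd k (F s) x = w k (l s x) + s * (\<Sum>i\<in>UNIV. pd i (w k) (l s x) * (x $ i - x0 $ i))"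
    if "s \<in> {0..1}" "x \<in> U" for s x k
  proof -
    have "pd k (F s) x = (\<Sum>i\<in>UNIV. pd k (\<lambda>x. w i (l s x) * (x $ i - x0 $ i)) x)"
      unfolding F_def by (rule pd_sum) (auto intro!: differentiable_mult differentiable_diff wld[OF that] cd)
    also have "\<dots> = (\<Sum>i\<in>UNIV. s * (pd i (w k) (l s x) * (x $ i - x0 $ i)) + (if k = i then w i (l s x) else 0))"
    proof (rule sum.cong[OF refl])
      fix i
      have "pd k (\<lambda>x. x $ i - x0 $ i) x = (if k = i then 1 else 0)"
        using pd_diff[OF cd[of i x] differentiable_const[of "x0 $ i"], of k] by (simp add: pd_coord)
      then show "pd k (\<lambda>x. w i (l s x) * (x $ i - x0 $ i)) x
          = s * (pd i (w k) (l s x) * (x $ i - x0 $ i)) + (if k = i then w i (l s x) else 0)"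
        using closed[OF lU[OF that], of k i]
        unfolding pd_mult[OF wld[OF that] differentiable_diff[OF cd differentiable_const]] wlp[OF that]
        by simp
    qed
    finally show ?thesis by (simp add: sum.distrib sum_distrib_left)
  qed
  have cl: "continuous_on (U \<times> {0..1}) (\<lambda>p. l (snd p) (fst p))"
    unfolding l_def by (intro continuous_intros)
  have cw: "continuous_on (U \<times> {0..1}) (\<lambda>p. W (l (snd p) (fst p)))" if "continuous_on U W" for W :: "real^'n \<Rightarrow> real"
    by (rule continuous_on_compose2[OF that cl]) (auto intro: lU)
  have Fcd: "continuous_on (U \<times> {0..1}) (\<lambda>(x, s). pd k (F s) x)" for k
  proof -
    have "continuous_on (U \<times> {0..1}) (\<lambda>p. w k (l (snd p) (fst p)) + snd p * (\<Sum>i\<in>UNIV. pd i (w k) (l (snd p) (fst p)) * (fst p $ i - x0 $ i)))"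
      by (intro continuous_intros cw smooth_on_continuous smooth_on_pd s)
    then show ?thesis by (rule continuous_on_eq) (auto simp: Fp)
  qed
  have cs: "continuous_on {0..1} (\<lambda>s. W (l s x))" if "continuous_on U W" "x \<in> U" for W :: "real^'n \<Rightarrow> real" and x
  proof -
    have "continuous_on {0..1} (\<lambda>s. l s x)" unfolding l_def by (intro continuous_intros)
    then show ?thesis by (rule continuous_on_compose2[OF that(1)]) (use lU that(2) in auto)
  qed
  have Fc: "continuous_on {0..1} (\<lambda>s. F s x)" if "x \<in> U" for x
    unfolding F_def by (intro continuous_intros cs[OF _ that] smooth_on_continuous s)
  have \<sigma>d: "\<sigma> differentiable (at x)" if "x \<in> U" for x
    unfolding \<sigma>_def by (rule param_integral(1)[where F = F, OF U(1,2) that Fd Fc Fcd])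
  have \<sigma>p: "pd k \<sigma> x = w k x" if x: "x \<in> U" for x k
  proof -
    have der: "((\<lambda>s. s * w k (l s x)) has_real_derivative (w k (l s x) + s * (\<Sum>i\<in>UNIV. pd i (w k) (l s x) * (x $ i - x0 $ i)))) (at s)"
      if "s \<in> {0..1}" for s
    proof -
      have "((\<lambda>s. l s x) has_derivative (\<lambda>h. h *\<^sub>R (x - x0))) (at s)"
        unfolding l_def by (auto intro!: derivative_eq_intros)
      from has_derivative_compose[OF this has_derivative_pd[OF wd[OF that x]]]
      have "((\<lambda>s. w k (l s x)) has_derivative (\<lambda>h. \<Sum>i\<in>UNIV. (h *\<^sub>R (x - x0)) $ i * pd i (w k) (l s x))) (at s)" .
      moreover have "(\<lambda>h. \<Sum>i\<in>UNIV. (h *\<^sub>R (x - x0)) $ i * pd i (w k) (l s x)) = (*) (\<Sum>i\<in>UNIV. pd i (w k) (l s x) * (x $ i - x0 $ i))"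
        by (rule ext) (simp add: sum_distrib_left sum_distrib_right mult_ac)
      ultimately have "((\<lambda>s. w k (l s x)) has_real_derivative (\<Sum>i\<in>UNIV. pd i (w k) (l s x) * (x $ i - x0 $ i))) (at s)"
        unfolding has_field_derivative_def by simp
      from DERIV_mult[OF DERIV_ident this] show ?thesis by (simp add: algebra_simps)
    qed
    have "((\<lambda>s. w k (l s x) + s * (\<Sum>i\<in>UNIV. pd i (w k) (l s x) * (x $ i - x0 $ i))) has_integral (1 * w k (l 1 x) - 0 * w k (l 0 x))) {0..1}"
      by (rule fundamental_theorem_of_calculus)
        (use der in \<open>auto simp: has_real_derivative_iff_has_vector_derivative[symmetric] intro: has_field_derivative_at_within\<close>)
    then have "integral {0..1} (\<lambda>s. w k (l s x) + s * (\<Sum>i\<in>UNIV. pd i (w k) (l s x) * (x $ i - x0 $ i))) = w k x"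
      by (simp add: integral_unique l_def)
    moreover have "pd k \<sigma> x = integral {0..1} (\<lambda>s. pd k (F s) x)"
      unfolding \<sigma>_def by (rule param_integral(2)[where F = F, OF U(1,2) x Fd Fc Fcd])
    moreover have "integral {0..1} (\<lambda>s. pd k (F s) x) = integral {0..1} (\<lambda>s. w k (l s x) + s * (\<Sum>i\<in>UNIV. pd i (w k) (l s x) * (x $ i - x0 $ i)))"
      by (intro integral_cong Fp x)
    ultimately show ?thesis by simp
  qed
  show ?thesis
  proof (rule that)
    show "smooth_on U \<sigma>" by (rule smooth_onI[OF U(1) \<sigma>d s \<sigma>p])
    show "\<sigma> x0 = 0" by (simp add: \<sigma>_def F_def)
  qed (rule \<sigma>p)
qed

text \<open>
  Shifting the flow parameter by the values of \<open>\<tau>\<close> on the initial slice turns \<open>\<tau>\<close> itself into the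
  coordinate \<open>ix\<close>.
\<close>
theorem flow_box:
  fixes V :: "'n::finite \<Rightarrow> real^'n \<Rightarrow> real" and ix :: 'n
  assumes D: "open D" "x0 \<in> D" and sV: "\<And>i. smooth_on D (V i)"
    and s\<tau>: "smooth_on D \<tau>" "\<tau> x0 = 0" and V\<tau>: "\<And>x. x \<in> D \<Longrightarrow> (\<Sum>i\<in>UNIV. V i x * pd i \<tau> x) = 1"
  obtains r \<psi> \<theta> where "r > 0" "\<And>i. smooth_on (cube r) (\<lambda>z. \<psi> z $ i)" "\<psi> ` cube r \<subseteq> D" "\<psi> 0 = x0"
    "open (\<psi> ` cube r)" "homeomorphism (cube r) (\<psi> ` cube r) \<psi> \<theta>" "\<And>i. smooth_on (\<psi> ` cube r) (\<lambda>y. \<theta> y $ i)"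
    "\<And>z i. z \<in> cube r \<Longrightarrow> pd ix (\<lambda>z. \<psi> z $ i) z = V i (\<psi> z)" "\<And>z. z \<in> cube r \<Longrightarrow> \<tau> (\<psi> z) = z $ ix"
proof -
  define v where "v = (\<chi> i. V i x0)"
  have v0: "v \<noteq> 0"
  proof
    assume "v = 0"
    then have "V i x0 = 0" for i by (simp add: v_def vec_eq_iff)
    then show False using V\<tau>[OF D(2)] by simp
  qed
  \<comment> \<open>An orthogonal map taking the axis \<open>ix\<close> to the direction of
    \<open>v\<close>, scaled by the norm of \<open>v\<close>. Its other columns span a complement of
    the flow direction.\<close>
  obtain P :: "real^'n^'n" where P: "invertible P" "P *v axis ix 1 = v"
  proof -
    obtain f where f: "orthogonal_transformation f" "f (axis ix (1::real)) = v /\<^sub>R norm v"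
      by (rule orthogonal_transformation_exists[of "axis ix (1::real)" "v /\<^sub>R norm v"]) (use v0 in simp)
    have "linear (\<lambda>x. norm v *\<^sub>R f x)" and "inj (\<lambda>x. norm v *\<^sub>R f x)"
      using orthogonal_transformation_linear[OF f(1)] orthogonal_transformation_inj[OF f(1)] v0
      by (auto simp: inj_on_def intro: linear_compose_scale_right)
    then have "matrix (\<lambda>x. norm v *\<^sub>R f x) *v axis ix 1 = v" "invertible (matrix (\<lambda>x. norm v *\<^sub>R f x))"
      using f(2) v0 by (simp_all add: matrix_works invertible_eq_bij linear_injective_imp_surjective bij_def
          linear_matrix_vector_mul_eq ext)
    then show ?thesis using that by blast
  qed
  obtain r0 \<phi> where r0: "r0 > 0" and s\<phi>: "\<And>i. smooth_on (cube r0) (\<lambda>z. \<phi> z $ i)"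
    and \<phi>D: "\<And>z. z \<in> cube r0 \<Longrightarrow> \<phi> z \<in> D"
    and \<phi>V: "\<And>z i. z \<in> cube r0 \<Longrightarrow> pd ix (\<lambda>z. \<phi> z $ i) z = V i (\<phi> z)"
    and \<phi>0: "\<And>z. z \<in> cube r0 \<Longrightarrow> z $ ix = 0 \<Longrightarrow> \<phi> z = x0 + P *v z"
    using flow_exists[of D x0 V ix P] D sV by metis
  have zc: "0 \<in> (cube q :: (real^'n) set)" if "q > 0" for q using that by (simp add: cube_def)
  have \<phi>00: "\<phi> 0 = x0" using \<phi>0[OF zc[OF r0]] by simp
  have \<tau>\<phi>s: "smooth_on (cube r0) (\<lambda>z. \<tau> (\<phi> z))"
    by (rule smooth_on_compose[OF open_cube s\<phi> s\<tau>(1) \<phi>D])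
  have \<tau>\<phi>p: "pd ix (\<lambda>z. \<tau> (\<phi> z)) z = 1" if "z \<in> cube r0" for z
    using pd_chain[OF smooth_on_differentiable[OF s\<phi> that] smooth_on_differentiable[OF s\<tau>(1) \<phi>D[OF that]], of ix]
      V\<tau>[OF \<phi>D[OF that]] by (simp add: \<phi>V[OF that] mult.commute)
  have set0: "set_coord ix 0 z \<in> cube r0" if "z \<in> cube r0" for z
    using that r0 by (simp add: cube_def set_coord_nth)
  have cd: "(\<lambda>x. x $ i) differentiable (at x)" for i and x :: "real^'n"
    by (rule smooth_on_differentiable[OF smooth_on_coord[OF open_UNIV]]) simp
  \<comment> \<open>Along the flow \<tau> grows at unit rate, so it differs from the flow time by
    its value on the initial slice.\<close>
  have \<tau>\<phi>: "\<tau> (\<phi> z) = z $ ix + \<tau> (\<phi> (set_coord ix 0 z))" if z: "z \<in> cube r0" for z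
  proof -
    have "\<tau> (\<phi> z) - z $ ix = \<tau> (\<phi> (set_coord ix 0 z)) - set_coord ix 0 z $ ix"
    proof (rule pd_zero_imp_eq[OF convex_cube open_cube z set0[OF z]])
      show "(\<lambda>z. \<tau> (\<phi> z) - z $ ix) differentiable (at y)" if "y \<in> cube r0" for y
        by (intro differentiable_diff smooth_on_differentiable[OF \<tau>\<phi>s that] cd)
      show "pd i (\<lambda>z. \<tau> (\<phi> z) - z $ ix) y = 0" if "y \<in> cube r0" "z $ i \<noteq> set_coord ix 0 z $ i" for i y
      proof -
        have "i = ix" using that(2) by (simp add: set_coord_nth split: if_splits)
        then show ?thesis
          using pd_diff[OF smooth_on_differentiable[OF \<tau>\<phi>s that(1)] cd, of ix] by (simp add: \<tau>\<phi>p[OF that(1)] pd_coord)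
      qed
    qed
    then show ?thesis by (simp add: set_coord_nth)
  qed
  define k where "k = (\<lambda>z. \<tau> (\<phi> (set_coord ix 0 z)))"
  have s0: "smooth_on (cube r0) (\<lambda>z. set_coord ix 0 z $ i)" for i
    by (cases "i = ix") (simp_all add: set_coord_nth smooth_on_const smooth_on_coord open_cube)
  have sk: "smooth_on (cube r0) k"
    unfolding k_def by (rule smooth_on_compose[OF open_cube s0 \<tau>\<phi>s set0])
  define \<mu> where "\<mu> = (\<lambda>z. set_coord ix (z $ ix - k z) z)"
  have s\<mu>: "smooth_on (cube r0) (\<lambda>z. \<mu> z $ i)" for i
    by (cases "i = ix") (simp_all add: \<mu>_def set_coord_nth smooth_on_diff smooth_on_coord open_cube sk)
  have k0: "k 0 = 0" and \<mu>0: "\<mu> 0 = 0"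
  proof -
    have "set_coord ix 0 0 = (0 :: real^'n)" by (simp add: vec_eq_iff set_coord_nth)
    then show "k 0 = 0" by (simp add: k_def \<phi>00 s\<tau>(2))
    then show "\<mu> 0 = 0" by (simp add: \<mu>_def vec_eq_iff set_coord_nth)
  qed
  \<comment> \<open>The shift by \<open>k\<close> may leave the cube on which the flow exists; only
    points whose image stays inside are kept.\<close>
  define W where "W = {z \<in> cube r0. \<mu> z \<in> cube r0}"
  have "continuous_on (cube r0) \<mu>"
    by (subst continuous_on_componentwise) (auto simp: Basis_vec_def inner_axis intro!: smooth_on_continuous s\<mu>)
  then have W: "open W"
    unfolding W_def using continuous_open_preimage[OF _ open_cube open_cube, of r0 \<mu> r0]
    by (simp add: vimage_def Int_def)
  have W0: "0 \<in> W" by (simp add: W_def \<mu>0 zc r0)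
  have Wc: "z \<in> cube r0" "\<mu> z \<in> cube r0" if "z \<in> W" for z using that by (auto simp: W_def)
  define \<psi> where "\<psi> = (\<lambda>z. \<phi> (\<mu> z))"
  have s\<mu>W: "smooth_on W (\<lambda>z. \<mu> z $ i)" for i by (rule smooth_on_subset[OF s\<mu>]) (auto simp: W_def)
  have s\<psi>: "smooth_on W (\<lambda>z. \<psi> z $ i)" for i
    unfolding \<psi>_def by (rule smooth_on_compose[OF W s\<mu>W s\<phi> Wc(2)])
  have pk: "pd ix k z = 0" if "z \<in> cube r0" for z
  proof -
    have "pd ix (\<lambda>z. set_coord ix 0 z $ a) z = 0" for a by (cases "a = ix") (simp_all add: set_coord_nth pd_coord)
    then show ?thesis unfolding k_def
      using pd_chain[OF smooth_on_differentiable[OF s0 that] smooth_on_differentiable[OF \<tau>\<phi>s set0[OF that]], of ix] by simp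
  qed
  have p\<mu>: "pd i (\<lambda>z. \<mu> z $ a) z = (if a = ix then (if i = ix then 1 else 0) - pd i k z else if i = a then 1 else 0)"
    if "z \<in> cube r0" for i a z
    using pd_diff[OF cd smooth_on_differentiable[OF sk that], of i ix] by (auto simp: \<mu>_def set_coord_nth pd_coord)
  have p\<psi>: "pd i (\<lambda>z. \<psi> z $ b) z = (\<Sum>a\<in>UNIV. pd a (\<lambda>z. \<phi> z $ b) (\<mu> z) * pd i (\<lambda>z. \<mu> z $ a) z)" if "z \<in> W" for i b z
    unfolding \<psi>_def
    by (rule pd_chain[OF smooth_on_differentiable[OF s\<mu> Wc(1)[OF that]] smooth_on_differentiable[OF s\<phi> Wc(2)[OF that]]])
  have \<psi>V: "pd ix (\<lambda>z. \<psi> z $ b) z = V b (\<psi> z)" if "z \<in> W" for b z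
  proof -
    have "pd ix (\<lambda>z. \<mu> z $ a) z = (if a = ix then 1 else 0)" for a
      using p\<mu>[OF Wc(1)[OF that], of ix a] pk[OF Wc(1)[OF that]] by simp
    then show ?thesis
      using p\<psi>[OF that, of ix b] \<phi>V[OF Wc(2)[OF that], of b] by (simp add: \<psi>_def if_distrib[of "\<lambda>z. _ * z"] cong: if_cong)
  qed
  have \<psi>\<tau>: "\<tau> (\<psi> z) = z $ ix" if "z \<in> W" for z
  proof -
    have "set_coord ix 0 (\<mu> z) = set_coord ix 0 z" by (simp add: vec_eq_iff set_coord_nth \<mu>_def)
    then show ?thesis using \<tau>\<phi>[OF Wc(2)[OF that]] by (simp add: \<psi>_def k_def \<mu>_def set_coord_nth)
  qed
  have \<phi>P: "pd a (\<lambda>z. \<phi> z $ b) 0 = P $ b $ a" for a b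
  proof (cases "a = ix")
    case True
    have "P $ b $ ix = v $ b" using P(2) by (metis matrix_vector_mult_basis column_def vec_lambda_beta)
    then show ?thesis using \<phi>V[OF zc[OF r0], of b] True by (simp add: \<phi>00 v_def)
  next
    case False
    have dl: "((\<lambda>s. \<phi> (0 + s *\<^sub>R axis a 1) $ b) has_real_derivative pd a (\<lambda>z. \<phi> z $ b) (0 + 0 *\<^sub>R axis a 1)) (at 0)"
      by (rule pd_line) (use smooth_on_differentiable[OF s\<phi> zc[OF r0]] in simp)
    have "((\<lambda>s. x0 $ b + s * P $ b $ a) has_real_derivative P $ b $ a) (at 0)"
      by (auto intro!: derivative_eq_intros)
    moreover have "\<phi> (0 + s *\<^sub>R axis a 1) $ b = x0 $ b + s * P $ b $ a" if "s \<in> {-r0<..<r0}" for s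
    proof -
      have "s *\<^sub>R axis a 1 \<in> cube r0" "(s *\<^sub>R axis a (1::real)) $ ix = 0"
        using that r0 False by (auto simp: cube_def axis_def abs_less_iff)
      then have "\<phi> (s *\<^sub>R axis a 1) = x0 + P *v (s *\<^sub>R axis a 1)" by (rule \<phi>0)
      then show ?thesis by (simp add: matrix_vector_mult_scaleR matrix_vector_mult_basis column_def)
    qed
    ultimately have "((\<lambda>s. \<phi> (0 + s *\<^sub>R axis a 1) $ b) has_real_derivative P $ b $ a) (at 0)"
      using r0 by (subst has_field_derivative_cong_eventually[where g = "\<lambda>s. x0 $ b + s * P $ b $ a"])
        (auto simp: eventually_at_topological \<phi>00 intro!: exI[of _ "{-r0<..<r0}"])
    then show ?thesis using DERIV_unique[OF dl] by simp
  qed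
  \<comment> \<open>At 0 the Jacobian is \<open>P\<close> times the shear \<open>Sh\<close>, which
    differs from the identity only in the row \<open>ix\<close>; the diagonal entry there is 1
    because \<open>k\<close> does not depend on the coordinate \<open>ix\<close>.\<close>
  have "invertible (\<chi> a i. pd i (\<lambda>x. \<psi> x $ a) 0)"
  proof -
    define Sh :: "real^'n^'n" where "Sh = (\<chi> a i. if a = ix then (if i = ix then 1 else 0) - pd i k 0 else if i = a then 1 else 0)"
    have "(\<chi> a i. pd i (\<lambda>x. \<psi> x $ a) 0) = P ** Sh"
      by (simp add: vec_eq_iff matrix_matrix_mult_def p\<psi>[OF W0] \<mu>0 \<phi>P p\<mu>[OF zc[OF r0]] Sh_def)
    moreover have "invertible Sh"
    proof -
      have "x = 0" if "Sh *v x = 0" for x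
      proof -
        have e: "(\<Sum>i\<in>UNIV. Sh $ a $ i * x $ i) = 0" for a
          using that by (simp add: vec_eq_iff matrix_vector_mult_def)
        have a0: "x $ a = 0" if "a \<noteq> ix" for a
          using e[of a] that by (simp add: Sh_def if_distrib[of "\<lambda>z. z * _"] cong: if_cong)
        have "(\<Sum>i\<in>UNIV. Sh $ ix $ i * x $ i) = (\<Sum>i\<in>UNIV. if i = ix then x $ ix else 0)"
          by (rule sum.cong) (use a0 pk[OF zc[OF r0]] in \<open>auto simp: Sh_def\<close>)
        then have "x $ ix = 0" using e[of ix] by simp
        then show "x = 0" using a0 by (metis vec_eq_iff zero_index)
      qed
      then show ?thesis using invertible_left_inverse matrix_left_invertible_ker by blast
    qed
    ultimately show ?thesis using P(1) invertible_mult by metis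
  qed
  from smooth_inverse_function[OF W W0 s\<psi> this]
  obtain U' V' \<theta> where I: "open U'" "U' \<subseteq> W" "0 \<in> U'" "open V'" "homeomorphism U' V' \<psi> \<theta>"
    "\<And>i. smooth_on V' (\<lambda>y. \<theta> y $ i)" by metis
  obtain e where e: "e > 0" "ball 0 e \<subseteq> U'" using I(1,3) openE by blast
  define r where "r = e / (2 * real CARD('n))"
  have r: "r > 0" using e by (simp add: r_def)
  have rU: "cube r \<subseteq> U'"
  proof
    fix z :: "real^'n" assume "z \<in> cube r"
    have "norm z \<le> (\<Sum>i\<in>UNIV. \<bar>z $ i\<bar>)" by (rule norm_le_l1_cart)
    also have "\<dots> \<le> (\<Sum>i\<in>(UNIV::'n set). r)" using \<open>z \<in> cube r\<close> by (intro sum_mono) (auto simp: cube_def less_imp_le)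
    also have "\<dots> < e" using e(1) by (simp add: r_def)
    finally show "z \<in> U'" using e(2) by auto
  qed
  have hom: "homeomorphism (cube r) (\<psi> ` cube r) \<psi> \<theta>"
    by (rule homeomorphism_of_subsets[OF I(5) rU]) (use I(5) rU in \<open>auto simp: homeomorphism_def\<close>)
  have opn: "open (\<psi> ` cube r)"
  proof -
    have "openin (top_of_set V') (\<psi> ` cube r)"
      using homeomorphism_imp_open_map[OF I(5)] rU open_cube by (metis I(1) openin_open_eq)
    then show ?thesis using I(4) openin_open_eq by blast
  qed
  have sub: "\<psi> ` cube r \<subseteq> V'" using I(5) rU by (auto simp: homeomorphism_def)
  show ?thesis
  proof (rule that[OF r])
    show "smooth_on (cube r) (\<lambda>z. \<psi> z $ i)" for i
      using smooth_on_subset[OF s\<psi>] rU I(2) by blast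
    show "\<psi> ` cube r \<subseteq> D" using rU I(2) Wc(2) \<phi>D by (auto simp: \<psi>_def)
    show "\<psi> 0 = x0" by (simp add: \<psi>_def \<mu>0 \<phi>00)
    show "smooth_on (\<psi> ` cube r) (\<lambda>y. \<theta> y $ i)" for i by (rule smooth_on_subset[OF I(6) sub])
  qed (use opn hom \<psi>V \<psi>\<tau> rU I(2) in auto)
qed

section \<open>Algebra of a Lorentzian frame\<close>

text \<open>The linear algebra of a single point, with \<open>g\<close> and \<open>gi\<close> the
  metric and its inverse there. Derivatives enter only as unspecified arrays of numbers, so that
  contractions are finite sums of reals.\<close>

locale frame =
  fixes g gi :: "'n::finite \<Rightarrow> 'n \<Rightarrow> real" and u :: "'n \<Rightarrow> real"
  assumes g_sym: "g i j = g j i" and gi_sym: "gi i j = gi j i"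
    and gi_g: "(\<Sum>k\<in>UNIV. gi i k * g k j) = (if i = j then 1 else 0)"
    and u_norm: "(\<Sum>i\<in>UNIV. \<Sum>j\<in>UNIV. gi i j * u i * u j) = -1"
begin

definition v :: "'n \<Rightarrow> real" where "v i = (\<Sum>j\<in>UNIV. gi i j * u j)"
text \<open>Contraction with the raised \<open>u\<close>; on the gradient of a function it is the
  derivative in the time direction, hence the name.\<close>

definition dt :: "('n \<Rightarrow> real) \<Rightarrow> real" where "dt X = (\<Sum>i\<in>UNIV. v i * X i)"
definition tr :: "('n \<Rightarrow> 'n \<Rightarrow> real) \<Rightarrow> real" where "tr T = (\<Sum>k\<in>UNIV. \<Sum>l\<in>UNIV. gi k l * T k l)"

lemma g_gi: "(\<Sum>k\<in>UNIV. g i k * gi k j) = (if i = j then 1 else 0)"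
  using gi_g[of j i] by (simp add: g_sym[of i] gi_sym[of _ j] mult.commute eq_commute)

lemma tr_add: "tr (\<lambda>k l. S k l + T k l) = tr S + tr T"
  by (simp add: tr_def algebra_simps sum.distrib)
lemma tr_diff: "tr (\<lambda>k l. S k l - T k l) = tr S - tr T"
  by (simp add: tr_def algebra_simps sum_subtractf)
lemma tr_cmult: "tr (\<lambda>k l. c * T k l) = c * tr T"
  by (simp add: tr_def sum_distrib_left mult_ac)
lemma tr_swap: "tr (\<lambda>k l. T l k) = tr T"
  unfolding tr_def by (subst sum.swap) (simp add: gi_sym)
lemma dt_add: "dt (\<lambda>k. X k + Y k) = dt X + dt Y"
  by (simp add: dt_def algebra_simps sum.distrib)
lemma dt_diff: "dt (\<lambda>k. X k - Y k) = dt X - dt Y"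
  by (simp add: dt_def algebra_simps sum_subtractf)
lemma dt_cmult: "dt (\<lambda>k. c * X k) = c * dt X"
  by (simp add: dt_def sum_distrib_left mult_ac)
lemma dt_multc: "dt (\<lambda>k. X k * c) = dt X * c"
  using dt_cmult[of c X] by (simp add: mult.commute)

lemma tr_X_g: "tr (\<lambda>k l. X k * g j l) = X j"
proof -
  have "tr (\<lambda>k l. X k * g j l) = (\<Sum>k\<in>UNIV. X k * (\<Sum>l\<in>UNIV. gi k l * g l j))"
    by (simp add: tr_def sum_distrib_left mult_ac g_sym[of j])
  then show ?thesis by (simp add: gi_g if_distrib[of "\<lambda>z. _ * z"] cong: if_cong)
qed

lemma tr_g: "tr g = real CARD('n)"
proof -
  have "(\<Sum>l\<in>UNIV. gi k l * g k l) = 1" for k using gi_g[of k k] by (simp add: g_sym[of k])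
  then show ?thesis by (simp add: tr_def)
qed

lemma tr_X_u: "tr (\<lambda>k l. X k * u l) = dt X"
  by (simp add: tr_def dt_def v_def sum_distrib_left mult_ac)

lemma dt_u: "dt u = -1"
  using u_norm by (simp add: dt_def v_def sum_distrib_left sum_distrib_right mult_ac)

lemma dt_g: "dt (\<lambda>i. g k i) = u k" "dt (\<lambda>i. g i k) = u k"
proof -
  have "dt (\<lambda>i. g k i) = (\<Sum>i\<in>UNIV. \<Sum>j\<in>UNIV. g k i * gi i j * u j)"
    by (simp add: dt_def v_def sum_distrib_left mult_ac)
  also have "\<dots> = (\<Sum>j\<in>UNIV. (\<Sum>i\<in>UNIV. g k i * gi i j) * u j)"
    by (subst sum.swap) (simp add: sum_distrib_right)
  finally show "dt (\<lambda>i. g k i) = u k" by (simp add: g_gi if_distrib[of "\<lambda>z. z * _"] cong: if_cong)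
  then show "dt (\<lambda>i. g i k) = u k" by (simp add: g_sym)
qed

lemmas tr_dt = tr_add tr_diff tr_cmult dt_add dt_diff dt_cmult dt_multc tr_X_g tr_g tr_X_u dt_u dt_g

text \<open>
  With \<open>K\<close> standing for \<open>\<nabla>u\<close>, \<open>R'\<close> is the covariant derivative of \<open>A g + B u \<otimes> u\<close>, \<open>P'\<close> that of the
  Schouten tensor, and the hypothesis \<open>H\<close> is the vanishing of the divergence of the Weyl tensor after the
  contracted second Bianchi identity. Its trace gives \<open>Z = 0\<close>, so \<open>\<nabla>\<^sup>j R\<^sub>j\<^sub>k = \<nabla>\<^sub>k R / 2\<close> is not
  needed separately; then the Cotton tensor \<open>C\<close> vanishes.
\<close>
lemma fluid_algebra:
  fixes dA dB :: "'n \<Rightarrow> real" and K :: "'n \<Rightarrow> 'n \<Rightarrow> real" and B :: real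
  defines "n \<equiv> real CARD('n)"
  defines "S \<equiv> \<lambda>j. ((n - 2) * dA j + dB j) / (2 * (n - 1))"
  defines "R' \<equiv> \<lambda>j k l. dA j * g k l + dB j * u k * u l + B * (K j k * u l + u k * K j l)"
  defines "P' \<equiv> \<lambda>j k l. S j / (n - 2) * g k l + dB j / (n - 2) * u k * u l + B / (n - 2) * (K j k * u l + u k * K j l)"
  defines "q \<equiv> \<lambda>j. \<Sum>m\<in>UNIV. \<Sum>s\<in>UNIV. gi m s * P' s j m"
  assumes K_sym: "\<And>j l. K j l = K l j" and Kv: "\<And>j. dt (K j) = 0" and n: "n > 3"
    and H: "\<And>j k l. - (R' j k l - R' k j l) + (P' j k l - P' k j l) + g k l * q j - g j l * q k = 0"
  defines "f \<equiv> tr K / (n - 1)"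
  shows "B * K j l = B * (f * (g j l + u j * u l))" and "S j = B * f * u j" and "\<exists>c. \<forall>j. dA j = c * u j"
proof -
  define \<theta> where "\<theta> = tr K"
  define w where "w = dt dB + B * \<theta>"
  have Kv': "dt (\<lambda>s. K s j) = 0" for j using Kv[of j] by (simp add: K_sym[of _ j])
  have q: "(n - 2) * q j = S j + w * u j" for j
  proof -
    have "q j = tr (\<lambda>m s. P' s j m)" by (simp add: q_def tr_def)
    also have "\<dots> = tr (\<lambda>s m. P' s j m)" by (rule tr_swap)
    also have "\<dots> = tr (\<lambda>s m. 1 / (n - 2) * (S s * g j m) + (u j / (n - 2)) * (dB s * u m)
        + ((B / (n - 2)) * (K s j * u m) + (B * u j / (n - 2)) * K s m))"
      by (simp add: P'_def algebra_simps)
    also have "\<dots> = 1 / (n - 2) * S j + (u j / (n - 2)) * dt dB + (B / (n - 2)) * 0 + (B * u j / (n - 2)) * \<theta>"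
      by (simp only: tr_dt Kv' \<theta>_def)
    finally have "q j = (S j + u j * dt dB + B * u j * \<theta>) / (n - 2)" by (simp add: add_divide_distrib)
    then have "(n - 2) * q j = S j + u j * dt dB + B * u j * \<theta>" using n by simp
    then show ?thesis by (simp add: w_def algebra_simps)
  qed
  define C where "C = (\<lambda>j k l. S j * g k l - S k * g j l + (dB j * u k - dB k * u j) * u l + B * (u k * K j l - u j * K k l))"
  \<comment> \<open>This turns out to be the trace of \<open>C\<close>, so that the trace of
    \<open>H'\<close> is an equation for \<open>Z\<close> alone, with coefficient
    \<open>2 * n - 4\<close>.\<close>
  define Z where "Z = (\<lambda>j. (n - 1) * S j - dB j - w * u j)"
  have P'C: "(n - 2) * (P' j k l - P' k j l) = C j k l" for j k l
  proof -
    have "P' j k l = (S j * g k l + dB j * u k * u l + B * (K j k * u l + u k * K j l)) / (n - 2)" for j k l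
      by (simp add: P'_def add_divide_distrib)
    then have "(n - 2) * (P' j k l - P' k j l) = (S j * g k l + dB j * u k * u l + B * (K j k * u l + u k * K j l))
       - (S k * g j l + dB k * u j * u l + B * (K k j * u l + u j * K k l))"
      using n by (simp add: right_diff_distrib)
    then show ?thesis by (simp add: C_def K_sym[of k j] algebra_simps)
  qed
  have S2: "2 * (n - 1) * S j = (n - 2) * dA j + dB j" for j using n by (simp add: S_def)
  have SA: "(n - 2) * (dA j - S j) = n * S j - dB j" for j
    using S2[of j] by (simp add: algebra_simps)
  have R'C: "R' j k l - R' k j l = C j k l + (dA j - S j) * g k l - (dA k - S k) * g j l" for j k l
    by (simp add: R'_def C_def K_sym[of k j] algebra_simps)
  have H': "(n - 3) * C j k l + g k l * Z j - g j l * Z k = 0" for j k l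
  proof -
    have "(n - 2) * (- (R' j k l - R' k j l) + (P' j k l - P' k j l) + g k l * q j - g j l * q k)
       = - ((n - 2) * C j k l + ((n - 2) * (dA j - S j)) * g k l - ((n - 2) * (dA k - S k)) * g j l)
         + (n - 2) * (P' j k l - P' k j l) + g k l * ((n - 2) * q j) - g j l * ((n - 2) * q k)"
      unfolding R'C by (simp add: algebra_simps)
    then have "0 = - ((n - 2) * C j k l + (n * S j - dB j) * g k l - (n * S k - dB k) * g j l)
         + C j k l + g k l * (S j + w * u j) - g j l * (S k + w * u k)"
      unfolding H SA P'C q by simp
    then show ?thesis by (simp add: Z_def algebra_simps)
  qed
  have trC: "tr (C j) = Z j" for j
  proof -
    have "tr (C j) = tr (\<lambda>k l. S j * g k l - S k * g j l + (dB j * (u k * u l) - u j * (dB k * u l)) + (B * (u k * K j l) - (B * u j) * K k l))"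
      by (simp add: C_def algebra_simps)
    also have "\<dots> = S j * n - S j + (dB j * (-1) - u j * dt dB) + (B * 0 - (B * u j) * \<theta>)"
    proof -
      have "tr (\<lambda>k l. u k * K j l) = tr (\<lambda>k l. K j k * u l)"
        using tr_swap[of "\<lambda>k l. u l * K j k"] by (simp add: mult.commute)
      then show ?thesis by (simp add: tr_dt Kv \<theta>_def n_def)
    qed
    finally show ?thesis by (simp add: Z_def w_def algebra_simps)
  qed
  have Z0: "Z j = 0" for j
  proof -
    have "tr (\<lambda>k l. (n - 3) * C j k l + Z j * g k l - Z k * g j l) = (n - 3) * Z j + Z j * n - Z j"
      by (simp add: tr_dt trC n_def)
    moreover have "tr (\<lambda>k l. (n - 3) * C j k l + Z j * g k l - Z k * g j l) = tr (\<lambda>k l. 0)"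
      using H' by (simp add: mult.commute)
    ultimately have "(n - 3) * Z j + Z j * n - Z j = 0" by (simp add: tr_def)
    then have "(2 * n - 4) * Z j = 0" by (simp add: algebra_simps)
    then show ?thesis using n by simp
  qed
  have C0: "C j k l = 0" for j k l using H'[of j k l] Z0 n by simp
  define s b where "s = dt S" and "b = dt dB"
  \<comment> \<open>The contraction of \<open>C\<close> with the raised \<open>u\<close> in its last
    two indices; the terms with \<open>K\<close> drop out by \<open>Kv\<close>.\<close>
  have SB: "S j - dB j = (b - s) * u j" for j
  proof -
    have "dt (C j k) = S j * u k - S k * u j - (dB j * u k - dB k * u j)" for k
    proof -
      have "dt (C j k) = dt (\<lambda>l. S j * g k l - S k * g j l + (dB j * u k - dB k * u j) * u l + ((B * u k) * K j l - (B * u j) * K k l))"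
        by (simp add: C_def algebra_simps)
      then show ?thesis by (simp add: tr_dt Kv)
    qed
    then have "dt (\<lambda>k. S j * u k - S k * u j - (dB j * u k - dB k * u j)) = dt (\<lambda>k. dt (C j k))" by simp
    also have "\<dots> = 0" unfolding C0 by (simp add: dt_def)
    finally show ?thesis by (simp add: tr_dt s_def b_def algebra_simps)
  qed
  \<comment> \<open>Contracting only the index \<open>k\<close> isolates \<open>B * K j l\<close>,
    and \<open>SB\<close> turns the remainder into a multiple of the projector orthogonal to
    \<open>u\<close>.\<close>
  have BK: "B * K j l = - s * (g j l + u j * u l)" for j l
  proof -
    have "dt (\<lambda>k. C j k l) = dt (\<lambda>k. S j * g k l - S k * g j l + ((dB j * u l) * u k - dB k * (u j * u l)) + ((B * K j l) * u k - (B * u j) * K k l))"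
      by (simp add: C_def algebra_simps)
    also have "\<dots> = S j * u l - s * g j l + (- dB j * u l - b * (u j * u l)) - B * K j l"
      by (simp add: tr_dt Kv' s_def b_def)
    finally have "B * K j l = S j * u l - s * g j l + (- dB j * u l - b * (u j * u l))"
      unfolding C0 by (simp add: dt_def)
    also have "\<dots> = (S j - dB j) * u l - s * g j l - b * (u j * u l)" by (simp add: algebra_simps)
    finally show ?thesis unfolding SB by (simp add: algebra_simps)
  qed
  have B\<theta>: "B * \<theta> = - s * (n - 1)"
  proof -
    have "B * \<theta> = tr (\<lambda>j l. B * K j l)" by (simp add: tr_dt \<theta>_def)
    also have "\<dots> = tr (\<lambda>j l. (- s) * (g j l + u j * u l))" unfolding BK by simp
    also have "\<dots> = - s * (n - 1)" unfolding tr_cmult tr_add tr_X_u dt_u tr_g by (simp add: n_def)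
    finally show ?thesis .
  qed
  have Bf: "B * f = - s" using B\<theta> n by (simp add: f_def \<theta>_def field_simps)
  show "B * K j l = B * (f * (g j l + u j * u l))" using BK Bf by (simp add: mult.assoc[symmetric])
  \<comment> \<open>Since \<open>Z\<close> vanishes, \<open>SB\<close> makes \<open>S\<close> a
    multiple of \<open>u\<close>; contraction with the raised \<open>u\<close> determines the
    factor.\<close>
  have S': "S j = - s * u j" for j
  proof -
    have c: "S i = (w - (b - s)) / (n - 2) * u i" for i
    proof -
      have "(n - 2) * S i = Z i - (S i - dB i) + w * u i" by (simp add: Z_def algebra_simps)
      then show ?thesis using n unfolding Z0 SB by (simp add: field_simps)
    qed
    have "S = (\<lambda>i. (w - (b - s)) / (n - 2) * u i)" using c by (rule ext)
    from arg_cong[OF this, of dt] have "s = (w - (b - s)) / (n - 2) * dt u" by (simp only: dt_cmult s_def[symmetric])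
    then have "(w - (b - s)) / (n - 2) = - s" unfolding dt_u by linarith
    then show ?thesis using c[of j] by metis
  qed
  then show "S j = B * f * u j" using Bf by simp
  have "dA j = (2 * (n - 1) * (- s) - (- s - (b - s))) / (n - 2) * u j" for j
  proof -
    have "(n - 2) * dA j = 2 * (n - 1) * S j - S j + (b - s) * u j" using S2[of j] SB[of j] by linarith
    then have "(n - 2) * dA j = (2 * (n - 1) * (- s) - (- s - (b - s))) * u j"
      unfolding S' by (simp add: algebra_simps)
    then show ?thesis using n by (simp add: field_simps)
  qed
  then show "\<exists>c. \<forall>j. dA j = c * u j" by blast
qed

text \<open>\<open>R\<close> is the Ricci identity for a field with
  \<open>\<nabla>u = f (g + u \<otimes> u)\<close>. Its trace has \<open>F\<close> and
  \<open>dt F\<close> as unknowns; contracting once more gives \<open>dt F\<close>, after which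
  \<open>F\<close> is a known multiple of \<open>u\<close>.\<close>

lemma ricci_identity_algebra:
  fixes df :: "'n \<Rightarrow> real" and f A B :: real and Ru :: "'n \<Rightarrow> 'n \<Rightarrow> 'n \<Rightarrow> real"
  defines "n \<equiv> real CARD('n)"
  defines "F \<equiv> \<lambda>j. df j - f\<^sup>2 * u j"
  assumes n: "n > 3"
    and R: "\<And>j k l. F j * (g k l + u k * u l) - F k * (g j l + u j * u l) = Ru j k l"
    and ric: "\<And>j. tr (Ru j) = - (A - B) * u j"
  shows "df j = (f\<^sup>2 + (A - B) / (1 - n)) * u j"
    and "Ru j k l = (A - B) / (1 - n) * (u j * g k l - u k * g j l)"
proof -
  have 1: "(n - 2) * F j - dt F * u j = - (A - B) * u j" for j
  proof -
    have "tr (Ru j) = tr (\<lambda>k l. F j * (g k l + u k * u l) - (F k * g j l + u j * (F k * u l)))"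
      unfolding R[symmetric] by (simp add: algebra_simps)
    also have "\<dots> = F j * (n - 1) - (F j + u j * dt F)"
      by (simp add: tr_dt n_def)
    finally show ?thesis using ric[of j] by (simp add: algebra_simps)
  qed
  have "dt (\<lambda>j. (n - 2) * F j - dt F * u j) = dt (\<lambda>j. - (A - B) * u j)" unfolding 1 ..
  then have "(n - 2) * dt F + dt F = A - B" unfolding dt_diff dt_cmult dt_u by simp
  then have "(n - 1) * dt F = A - B" by (simp add: algebra_simps)
  then have dF: "dt F = (A - B) / (n - 1)" using n by (simp add: field_simps)
  have F: "F j = (A - B) / (1 - n) * u j" for j
  proof -
    have "(n - 2) * F j = (dt F - (A - B)) * u j" using 1[of j] by (simp add: algebra_simps)
    also have "\<dots> = (n - 2) * ((A - B) / (1 - n) * u j)" using n unfolding dF by (simp add: divide_simps) (simp add: algebra_simps)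
    finally show ?thesis using n by (subst (asm) mult_left_cancel) auto
  qed
  show "df j = (f\<^sup>2 + (A - B) / (1 - n)) * u j" using F[of j] by (simp add: F_def algebra_simps)
  show "Ru j k l = (A - B) / (1 - n) * (u j * g k l - u k * g j l)"
  proof -
    define c where "c = (A - B) / (1 - n)"
    show ?thesis unfolding R[symmetric] F c_def[symmetric] by (simp add: algebra_simps)
  qed
qed

end


section \<open>Curvature in a chart\<close>

definition cov2 :: "(real^'n::finite \<Rightarrow> real^'n^'n) \<Rightarrow> 'n \<Rightarrow> ('n \<Rightarrow> 'n \<Rightarrow> real^'n \<Rightarrow> real) \<Rightarrow> 'n \<Rightarrow> 'n \<Rightarrow> real^'n \<Rightarrow> real"
  where "cov2 g s T k l x = pd s (T k l) x -
    (\<Sum>p\<in>UNIV. christoffel g p s k x * T p l x + christoffel g p s l x * T k p x)"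

text \<open>The last index is upper, whence the opposite sign of its correction term. In this form
  the second Bianchi identity involves the metric only through the Christoffel symbols.\<close>

definition cov_riemann_up :: "(real^'n::finite \<Rightarrow> real^'n^'n) \<Rightarrow> 'n \<Rightarrow> 'n \<Rightarrow> 'n \<Rightarrow> 'n \<Rightarrow> 'n \<Rightarrow> real^'n \<Rightarrow> real"
  where "cov_riemann_up g i j k l m x = pd i (riemann_up g j k l m) x -
    (\<Sum>p\<in>UNIV. christoffel g p i j x * riemann_up g p k l m x + christoffel g p i k x * riemann_up g j p l m x
       + christoffel g p i l x * riemann_up g j k p m x - christoffel g m i p x * riemann_up g j k l p x)"

locale chart_metric =
  fixes D :: "(real^'n::finite) set" and g :: "real^'n \<Rightarrow> real^'n^'n"
  assumes D_open: "open D" and g_smooth: "smooth_on D (\<lambda>x. g x $ i $ j)"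
    and g_sym: "x \<in> D \<Longrightarrow> g x $ i $ j = g x $ j $ i" and g_inv: "x \<in> D \<Longrightarrow> invertible (g x)"
begin

abbreviation "gi \<equiv> ginv g"
abbreviation "\<Gamma> \<equiv> christoffel g"

lemma gi_g: assumes "x \<in> D" shows "(\<Sum>k\<in>UNIV. gi i k x * g x $ k $ j) = (if i = j then 1 else 0)"
  using arg_cong[OF matrix_inv_mult(2)[OF g_inv[OF assms]], of "\<lambda>M. M $ i $ j"]
  by (simp add: ginv_def matrix_matrix_mult_def mat_def)

lemma g_gi: assumes "x \<in> D" shows "(\<Sum>k\<in>UNIV. g x $ i $ k * gi k j x) = (if i = j then 1 else 0)"
  using arg_cong[OF matrix_inv_mult(1)[OF g_inv[OF assms]], of "\<lambda>M. M $ i $ j"]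
  by (simp add: ginv_def matrix_matrix_mult_def mat_def)

lemma gi_sym: assumes "x \<in> D" shows "gi i j x = gi j i x"
proof -
  let ?G = "g x" and ?H = "matrix_inv (g x)"
  note GH = matrix_inv_mult[OF g_inv[OF assms]]
  have t: "transpose ?G = ?G" using g_sym[OF assms] by (simp add: vec_eq_iff transpose_def)
  have "transpose ?H ** ?G = mat 1"
    using arg_cong[OF GH(1), of transpose] by (simp add: matrix_transpose_mul t transpose_mat)
  then have "transpose ?H = ?H"
    by (metis GH(1) matrix_mul_assoc matrix_mul_lid matrix_mul_rid)
  then have "transpose ?H $ i $ j = ?H $ i $ j" by simp
  then show ?thesis by (simp add: ginv_def transpose_def)
qed

lemma smooth_gi: "smooth_on D (gi i j)"
  unfolding ginv_def by (rule smooth_on_matrix_inv[OF D_open g_smooth g_inv])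

lemma smooth_\<Gamma>: "smooth_on D (\<Gamma> m i j)"
  unfolding christoffel_def divide_inverse by (intro smooth_intros D_open smooth_gi g_smooth)

lemma smooth_riemann_up: "smooth_on D (riemann_up g j k l m)"
  unfolding riemann_up_def by (intro smooth_intros D_open smooth_\<Gamma>)

lemmas smooth_chart = smooth_gi smooth_\<Gamma> g_smooth smooth_riemann_up

lemma diff:
  assumes "x \<in> D"
  shows "gi i j differentiable (at x)" "\<Gamma> m i j differentiable (at x)" "(\<lambda>x. g x $ i $ j) differentiable (at x)"
    "riemann_up g i j k l differentiable (at x)" "pd k (\<Gamma> m i j) differentiable (at x)"
  by (rule smooth_on_differentiable[OF _ assms], intro smooth_chart smooth_on_pd)+

lemma pd_g_sym: "x \<in> D \<Longrightarrow> pd k (\<lambda>x. g x $ i $ j) x = pd k (\<lambda>x. g x $ j $ i) x"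
  by (rule pd_cong_open[OF D_open]) (auto simp: g_sym)

lemma \<Gamma>_sym: "x \<in> D \<Longrightarrow> \<Gamma> m i j x = \<Gamma> m j i x"
  unfolding christoffel_def by (simp add: pd_g_sym[of x _ i j] algebra_simps)

text \<open>Lowering the index gives the Christoffel symbols of the first kind, free of the inverse
  metric. Metric compatibility and, later, the symbols of the warped chart are read off from
  them.\<close>

lemma \<Gamma>_lower:
  assumes "x \<in> D"
  shows "(\<Sum>p\<in>UNIV. \<Gamma> p i j x * g x $ p $ m)
    = (pd i (\<lambda>y. g y $ j $ m) x + pd j (\<lambda>y. g y $ i $ m) x - pd m (\<lambda>y. g y $ i $ j) x) / 2"
proof -
  let ?E = "\<lambda>l. pd i (\<lambda>y. g y $ j $ l) x + pd j (\<lambda>y. g y $ i $ l) x - pd l (\<lambda>y. g y $ i $ j) x"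
  have "(\<Sum>p\<in>UNIV. \<Gamma> p i j x * g x $ p $ m) = (\<Sum>p\<in>UNIV. \<Sum>l\<in>UNIV. g x $ m $ p * gi p l x * (?E l / 2))"
    unfolding christoffel_def by (simp add: sum_distrib_left sum_divide_distrib g_sym[OF assms, of m] mult_ac)
  also have "\<dots> = (\<Sum>l\<in>UNIV. (\<Sum>p\<in>UNIV. g x $ m $ p * gi p l x) * (?E l / 2))"
    by (subst sum.swap) (simp add: sum_distrib_right sum_divide_distrib)
  also have "\<dots> = ?E m / 2" unfolding g_gi[OF assms]
    by (simp add: if_distrib[of "\<lambda>z. z * _"] if_distrib[of "\<lambda>z. z / _"] cong: if_cong)
  finally show ?thesis .
qed

lemma compat:
  assumes "x \<in> D"
  shows "pd k (\<lambda>x. g x $ i $ j) x = (\<Sum>p\<in>UNIV. \<Gamma> p k i x * g x $ p $ j) + (\<Sum>p\<in>UNIV. \<Gamma> p k j x * g x $ i $ p)"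
  using \<Gamma>_lower[OF assms, of k i j] \<Gamma>_lower[OF assms, of k j i] pd_g_sym[OF assms, of i j k] pd_g_sym[OF assms, of j i k]
    pd_g_sym[OF assms, of k i j]
  by (simp add: g_sym[OF assms, of i] field_simps)

lemma cov2_g: "x \<in> D \<Longrightarrow> cov2 g s (\<lambda>i j x. g x $ i $ j) i j x = 0"
  unfolding cov2_def compat by (simp add: sum.distrib)

text \<open>Second derivatives of \<open>w\<close> cancel by their symmetry and the terms with
  \<open>\<Gamma> p j k\<close> by that of the Christoffel symbols. Products of symbols with first
  derivatives of \<open>w\<close> cancel in pairs, and the rest is the definition of the
  curvature.\<close>

lemma ricci_identity:
  assumes x: "x \<in> D" and w: "\<And>i. smooth_on D (\<lambda>x. w x $ i)"
  shows "cov2 g j (\<lambda>k l. cov1 g k w l) k l x - cov2 g k (\<lambda>k l. cov1 g k w l) j l x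
    = (\<Sum>m\<in>UNIV. riemann_up g j k l m x * w x $ m)"
proof -
  let ?w = "\<lambda>m. (\<lambda>x. w x $ m)"
  have dw: "?w m differentiable (at x)" "pd k (?w m) differentiable (at x)" for m k
    using smooth_on_differentiable[OF _ x] w smooth_on_pd by blast+
  have p: "pd j (cov1 g k w l) x = pd j (pd k (?w l)) x - (\<Sum>m\<in>UNIV. pd j (\<Gamma> m k l) x * w x $ m + \<Gamma> m k l x * pd j (?w m) x)" for j k
  proof -
    have "cov1 g k w l = (\<lambda>x. pd k (?w l) x - (\<Sum>m\<in>UNIV. \<Gamma> m k l x * w x $ m))" by (simp add: cov1_def fun_eq_iff)
    then show ?thesis
      by (simp add: pd_diff dw diff[OF x] differentiable_sum_all differentiable_mult pd_sum pd_mult)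
  qed
  have c: "cov2 g j (\<lambda>k l. cov1 g k w l) k l x = pd j (pd k (?w l)) x
      - (\<Sum>m\<in>UNIV. pd j (\<Gamma> m k l) x * w x $ m) - (\<Sum>m\<in>UNIV. \<Gamma> m k l x * pd j (?w m) x)
      - (\<Sum>p\<in>UNIV. \<Gamma> p j k x * cov1 g p w l x) - (\<Sum>p\<in>UNIV. \<Gamma> p j l x * pd k (?w p) x)
      + (\<Sum>m\<in>UNIV. (\<Sum>p\<in>UNIV. \<Gamma> p j l x * \<Gamma> m k p x) * w x $ m)" for j k
  proof -
    have "(\<Sum>p\<in>UNIV. \<Gamma> p j l x * cov1 g k w p x) = (\<Sum>p\<in>UNIV. \<Gamma> p j l x * pd k (?w p) x)
        - (\<Sum>p\<in>UNIV. \<Sum>m\<in>UNIV. \<Gamma> p j l x * \<Gamma> m k p x * w x $ m)"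
      by (simp add: cov1_def right_diff_distrib sum_subtractf sum_distrib_left mult.assoc)
    also have "(\<Sum>p\<in>UNIV. \<Sum>m\<in>UNIV. \<Gamma> p j l x * \<Gamma> m k p x * w x $ m) = (\<Sum>m\<in>UNIV. (\<Sum>p\<in>UNIV. \<Gamma> p j l x * \<Gamma> m k p x) * w x $ m)"
      by (subst sum.swap) (simp add: sum_distrib_right)
    finally show ?thesis unfolding cov2_def p by (simp add: sum.distrib)
  qed
  have "pd j (pd k (?w l)) x = pd k (pd j (?w l)) x" by (rule pd_commute[OF D_open x w])
  moreover have "(\<Sum>p\<in>UNIV. \<Gamma> p j k x * cov1 g p w l x) = (\<Sum>p\<in>UNIV. \<Gamma> p k j x * cov1 g p w l x)"
    by (simp add: \<Gamma>_sym[OF x, of _ j k])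
  ultimately show ?thesis unfolding c riemann_up_def
    by (simp add: sum.distrib sum_subtractf left_diff_distrib distrib_right)
qed

text \<open>Second derivatives of \<open>g\<close> commute, and each first derivative is a sum of
  two lowered Christoffel symbols \<open>?A\<close>. The antisymmetrised derivative of
  \<open>?A\<close> is the lowered curvature up to quadratic terms \<open>?Z\<close>, which cancel
  in the sum over both orders of \<open>l\<close> and \<open>m\<close>.\<close>

lemma riemann_antisym:
  assumes x: "x \<in> D"
  shows "riemann g j k l m x = - riemann g j k m l x"
proof -
  let ?A = "\<lambda>j l m x. \<Sum>p\<in>UNIV. \<Gamma> p j l x * g x $ p $ m"
  let ?Z = "\<lambda>j l k m. \<Sum>p\<in>UNIV. \<Sum>q\<in>UNIV. \<Gamma> p j l x * (\<Gamma> q k m x * g x $ p $ q)"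
  have dA: "?A j l m differentiable (at x)" for j l m
    by (intro differentiable_sum_all differentiable_mult diff[OF x] finite)
  have pA: "pd k (?A j l m) x = (\<Sum>p\<in>UNIV. (pd k (\<Gamma> p j l) x + (\<Sum>q\<in>UNIV. \<Gamma> q j l x * \<Gamma> p k q x)) * g x $ p $ m) + ?Z j l k m"
    for j k l m
  proof -
    have "pd k (?A j l m) x = (\<Sum>p\<in>UNIV. pd k (\<Gamma> p j l) x * g x $ p $ m + \<Gamma> p j l x * pd k (\<lambda>x. g x $ p $ m) x)"
      by (simp add: pd_sum pd_mult differentiable_mult diff[OF x])
    also have "\<dots> = (\<Sum>p\<in>UNIV. pd k (\<Gamma> p j l) x * g x $ p $ m)
        + (\<Sum>p\<in>UNIV. \<Sum>q\<in>UNIV. \<Gamma> p j l x * \<Gamma> q k p x * g x $ q $ m) + ?Z j l k m"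
      unfolding compat[OF x] by (simp add: sum.distrib distrib_left sum_distrib_left mult.assoc)
    also have "(\<Sum>p\<in>UNIV. \<Sum>q\<in>UNIV. \<Gamma> p j l x * \<Gamma> q k p x * g x $ q $ m)
        = (\<Sum>q\<in>UNIV. (\<Sum>p\<in>UNIV. \<Gamma> p j l x * \<Gamma> q k p x) * g x $ q $ m)"
      by (subst sum.swap) (simp add: sum_distrib_right)
    finally show ?thesis by (simp add: distrib_right sum.distrib)
  qed
  have R: "pd k (?A j l m) x - pd j (?A k l m) x = riemann g j k l m x + ?Z j l k m - ?Z k l j m" for l m
    unfolding pA riemann_def riemann_up_def
    by (simp add: sum.distrib sum_subtractf left_diff_distrib distrib_right)
  have ZZ: "?Z j l k m = ?Z k m j l" for l m
    by (subst sum.swap) (simp add: g_sym[OF x] mult_ac)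
  have gA: "pd k (\<lambda>x. g x $ l $ m) y = ?A k l m y + ?A k m l y" if "y \<in> D" for k y
    using compat[OF that, of k l m] by (simp add: g_sym[OF that, of l])
  have "pd k (pd j (\<lambda>x. g x $ l $ m)) x = pd k (?A j l m) x + pd k (?A j m l) x" for j k
  proof -
    have "pd k (pd j (\<lambda>x. g x $ l $ m)) x = pd k (\<lambda>y. ?A j l m y + ?A j m l y) x"
      by (rule pd_cong_open[OF D_open x gA])
    then show ?thesis using pd_add[OF dA dA] by simp
  qed
  then have "pd k (?A j l m) x + pd k (?A j m l) x = pd j (?A k l m) x + pd j (?A k m l) x"
    using pd_commute[OF D_open x g_smooth, of k j l m] by simp
  then show ?thesis using R[of l m] R[of m l] ZZ[of l m] ZZ[of m l] by linarith
qed

lemma riemann_up_swap: "riemann_up g j k l m x = - riemann_up g k j l m x"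
  unfolding riemann_up_def by (simp add: sum_negf[symmetric])

text \<open>The cyclic sum cancels type by type: second derivatives \<open>H\<close>, products of a
  symbol and a derivative \<open>E\<close> and \<open>F\<close>, cubic terms \<open>T\<close>, and
  the corrections \<open>L\<close> in the first two indices, where the symmetry of
  \<open>\<Gamma>\<close> enters.\<close>

lemma bianchi:
  assumes x: "x \<in> D"
  shows "cov_riemann_up g i j k l m x + cov_riemann_up g j k i l m x + cov_riemann_up g k i j l m x = 0"
proof -
  define T where "T = (\<lambda>a b c. \<Sum>p\<in>UNIV. \<Sum>q\<in>UNIV. \<Gamma> m c q x * (\<Gamma> q b p x * \<Gamma> p a l x))"
  define E where "E = (\<lambda>i j k. \<Sum>p\<in>UNIV. pd i (\<Gamma> p j l) x * \<Gamma> m k p x)"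
  define F where "F = (\<lambda>i j k. \<Sum>p\<in>UNIV. \<Gamma> p j l x * pd i (\<Gamma> m k p) x)"
  define H where "H = (\<lambda>i k j. pd i (pd k (\<Gamma> m j l)) x)"
  define L where "L = (\<lambda>i j k. \<Sum>p\<in>UNIV. \<Gamma> p i j x * riemann_up g p k l m x)"
  have H: "H i k j = H k i j" for i j k unfolding H_def by (rule pd_commute[OF D_open x smooth_\<Gamma>])
  have L: "L i j k = L j i k" for i j k unfolding L_def by (simp add: \<Gamma>_sym[OF x, of _ i j])
  have pR: "pd i (riemann_up g j k l m) x = H i k j - H i j k + (E i j k + F i j k - E i k j - F i k j)" for i j k
  proof -
    have "riemann_up g j k l m = (\<lambda>x. pd k (\<Gamma> m j l) x - pd j (\<Gamma> m k l) x
        + (\<Sum>p\<in>UNIV. \<Gamma> p j l x * \<Gamma> m k p x - \<Gamma> p k l x * \<Gamma> m j p x))" by (simp add: riemann_up_def fun_eq_iff)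
    then have "pd i (riemann_up g j k l m) x = H i k j - H i j k + (\<Sum>p\<in>UNIV. (pd i (\<Gamma> p j l) x * \<Gamma> m k p x + \<Gamma> p j l x * pd i (\<Gamma> m k p) x)
        - (pd i (\<Gamma> p k l) x * \<Gamma> m j p x + \<Gamma> p k l x * pd i (\<Gamma> m j p) x))"
      by (simp add: H_def pd_add pd_diff pd_sum pd_mult differentiable_sum_all differentiable_mult differentiable_diff diff[OF x])
    then show ?thesis by (simp add: E_def F_def sum.distrib sum_subtractf)
  qed
  have t1: "(\<Sum>p\<in>UNIV. \<Gamma> p i l x * riemann_up g j k p m x) = F k i j - F j i k + T i j k - T i k j" for i j k
  proof -
    have "(\<Sum>p\<in>UNIV. \<Gamma> p i l x * riemann_up g j k p m x) = F k i j - F j i k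
       + ((\<Sum>p\<in>UNIV. \<Sum>q\<in>UNIV. \<Gamma> m k q x * (\<Gamma> q j p x * \<Gamma> p i l x)) - (\<Sum>p\<in>UNIV. \<Sum>q\<in>UNIV. \<Gamma> m j q x * (\<Gamma> q k p x * \<Gamma> p i l x)))"
      by (simp add: riemann_up_def F_def distrib_left right_diff_distrib sum.distrib sum_subtractf sum_distrib_left mult_ac)
    then show ?thesis by (simp add: T_def)
  qed
  have t2: "(\<Sum>p\<in>UNIV. \<Gamma> m i p x * riemann_up g j k l p x) = E k j i - E j k i + T j k i - T k j i" for i j k
  proof -
    have "(\<Sum>p\<in>UNIV. \<Gamma> m i p x * riemann_up g j k l p x) = E k j i - E j k i
       + ((\<Sum>p\<in>UNIV. \<Sum>q\<in>UNIV. \<Gamma> m i p x * (\<Gamma> p k q x * \<Gamma> q j l x)) - (\<Sum>p\<in>UNIV. \<Sum>q\<in>UNIV. \<Gamma> m i p x * (\<Gamma> p j q x * \<Gamma> q k l x)))"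
      by (simp add: riemann_up_def E_def distrib_left right_diff_distrib sum.distrib sum_subtractf sum_distrib_left mult_ac)
    also have "(\<Sum>p\<in>UNIV. \<Sum>q\<in>UNIV. \<Gamma> m i p x * (\<Gamma> p k q x * \<Gamma> q j l x)) = T j k i"
      unfolding T_def by (rule sum.swap)
    also have "(\<Sum>p\<in>UNIV. \<Sum>q\<in>UNIV. \<Gamma> m i p x * (\<Gamma> p j q x * \<Gamma> q k l x)) = T k j i"
      unfolding T_def by (rule sum.swap)
    finally show ?thesis by simp
  qed
  have cov: "cov_riemann_up g i j k l m x = H i k j - H i j k + (E i j k + F i j k - E i k j - F i k j)
     - L i j k + L i k j - (F k i j - F j i k + T i j k - T i k j) + (E k j i - E j k i + T j k i - T k j i)" for i j k
  proof -
    have "(\<Sum>p\<in>UNIV. \<Gamma> p i k x * riemann_up g j p l m x) = - L i k j"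
      unfolding L_def riemann_up_swap[of j] by (simp add: sum_negf)
    then show ?thesis
      unfolding cov_riemann_up_def pR sum.distrib sum_subtractf t1 t2 by (simp add: L_def)
  qed
  show ?thesis unfolding cov
    using H[of i k j] H[of i j k] H[of j k i] L[of i j k] L[of i k j] L[of j k i] by linarith
qed

text \<open>Lowering an index commutes with the covariant derivative because \<open>compat\<close>
  makes the metric parallel.\<close>

lemma cov4_riemann:
  assumes x: "x \<in> D"
  shows "cov4 g s (riemann g) j k l m x = (\<Sum>p\<in>UNIV. cov_riemann_up g s j k l p x * g x $ p $ m)"
proof -
  let ?R = "riemann_up g"
  have pR: "pd s (riemann g j k l m) x = (\<Sum>p\<in>UNIV. pd s (?R j k l p) x * g x $ p $ m)
      + (\<Sum>p\<in>UNIV. \<Sum>q\<in>UNIV. \<Gamma> p s q x * ?R j k l q x * g x $ p $ m) + (\<Sum>q\<in>UNIV. \<Gamma> q s m x * riemann g j k l q x)"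
  proof -
    have "riemann g j k l m = (\<lambda>x. \<Sum>p\<in>UNIV. ?R j k l p x * g x $ p $ m)" by (simp add: riemann_def fun_eq_iff)
    then have "pd s (riemann g j k l m) x = (\<Sum>p\<in>UNIV. pd s (?R j k l p) x * g x $ p $ m + ?R j k l p x * pd s (\<lambda>x. g x $ p $ m) x)"
      by (simp add: pd_sum pd_mult differentiable_mult diff[OF x])
    also have "\<dots> = (\<Sum>p\<in>UNIV. pd s (?R j k l p) x * g x $ p $ m)
       + (\<Sum>p\<in>UNIV. \<Sum>q\<in>UNIV. \<Gamma> q s p x * ?R j k l p x * g x $ q $ m) + (\<Sum>p\<in>UNIV. \<Sum>q\<in>UNIV. \<Gamma> q s m x * (?R j k l p x * g x $ p $ q))"
      unfolding compat[OF x] by (simp add: sum.distrib distrib_left sum_distrib_left mult_ac)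
    also have "(\<Sum>p\<in>UNIV. \<Sum>q\<in>UNIV. \<Gamma> q s p x * ?R j k l p x * g x $ q $ m) = (\<Sum>p\<in>UNIV. \<Sum>q\<in>UNIV. \<Gamma> p s q x * ?R j k l q x * g x $ p $ m)"
      by (rule sum.swap)
    also have "(\<Sum>p\<in>UNIV. \<Sum>q\<in>UNIV. \<Gamma> q s m x * (?R j k l p x * g x $ p $ q)) = (\<Sum>q\<in>UNIV. \<Gamma> q s m x * riemann g j k l q x)"
      by (subst sum.swap) (simp add: riemann_def sum_distrib_left)
    finally show ?thesis .
  qed
  have sw: "(\<Sum>p\<in>UNIV. a p * riemann g (J p) (K p) (L p) m x) = (\<Sum>p\<in>UNIV. (\<Sum>q\<in>UNIV. a q * ?R (J q) (K q) (L q) p x) * g x $ p $ m)" for a J K L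
  proof -
    have "(\<Sum>p\<in>UNIV. a p * riemann g (J p) (K p) (L p) m x) = (\<Sum>p\<in>UNIV. \<Sum>q\<in>UNIV. a p * ?R (J p) (K p) (L p) q x * g x $ q $ m)"
      by (simp add: riemann_def sum_distrib_left mult.assoc)
    then show ?thesis by (subst (asm) sum.swap) (simp add: sum_distrib_right)
  qed
  show ?thesis
    unfolding cov4_def pR sum.distrib cov_riemann_up_def
      sw[of "\<lambda>p. \<Gamma> p s j x" "\<lambda>p. p" "\<lambda>p. k" "\<lambda>p. l"] sw[of "\<lambda>p. \<Gamma> p s k x" "\<lambda>p. j" "\<lambda>p. p" "\<lambda>p. l"]
      sw[of "\<lambda>p. \<Gamma> p s l x" "\<lambda>p. j" "\<lambda>p. k" "\<lambda>p. p"]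
    by (simp add: sum_subtractf sum.distrib left_diff_distrib distrib_right sum_distrib_right)
qed

text \<open>Antisymmetry in the last two indices moves the contraction to the second and fourth
  place and absorbs the minus sign of \<open>ricci\<close>.\<close>

lemma riemann_up_trace:
  assumes x: "x \<in> D"
  shows "(\<Sum>s\<in>UNIV. riemann_up g k s l s x) = ricci g k l x"
proof -
  have "ricci g k l x = (\<Sum>a\<in>UNIV. \<Sum>b\<in>UNIV. gi a b x * riemann g k a l b x)"
    unfolding ricci_def by (simp add: riemann_antisym[OF x, of k _ l] sum_negf)
  also have "\<dots> = (\<Sum>a\<in>UNIV. \<Sum>p\<in>UNIV. riemann_up g k a l p x * (\<Sum>b\<in>UNIV. gi a b x * g x $ b $ p))"
  proof (rule sum.cong[OF refl])
    fix a
    have "(\<Sum>b\<in>UNIV. gi a b x * riemann g k a l b x) = (\<Sum>b\<in>UNIV. \<Sum>p\<in>UNIV. riemann_up g k a l p x * (gi a b x * g x $ b $ p))"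
      by (simp add: riemann_def sum_distrib_left mult_ac g_sym[OF x])
    then show "(\<Sum>b\<in>UNIV. gi a b x * riemann g k a l b x) = (\<Sum>p\<in>UNIV. riemann_up g k a l p x * (\<Sum>b\<in>UNIV. gi a b x * g x $ b $ p))"
      by (subst (asm) sum.swap) (simp add: sum_distrib_left)
  qed
  finally show ?thesis unfolding gi_g[OF x] by (simp add: if_distrib[of "\<lambda>z. _ * z"] cong: if_cong)
qed

lemma cov_ricci:
  assumes x: "x \<in> D"
  shows "(\<Sum>s\<in>UNIV. cov_riemann_up g j k s l s x) = cov2 g j (ricci g) k l x"
proof -
  let ?R = "riemann_up g"
  have "pd j (ricci g k l) x = pd j (\<lambda>x. \<Sum>s\<in>UNIV. ?R k s l s x) x"
    by (rule pd_cong_open[OF D_open x]) (simp add: riemann_up_trace)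
  then have p: "pd j (ricci g k l) x = (\<Sum>s\<in>UNIV. pd j (?R k s l s) x)" by (simp add: pd_sum diff[OF x])
  have sw: "(\<Sum>s\<in>UNIV. \<Sum>p\<in>UNIV. \<Gamma> p j s x * ?R k p l s x) = (\<Sum>s\<in>UNIV. \<Sum>p\<in>UNIV. \<Gamma> s j p x * ?R k s l p x)"
    by (rule sum.swap)
  have t: "(\<Sum>s\<in>UNIV. \<Sum>p\<in>UNIV. a p * ?R (J p) s (L p) s x) = (\<Sum>p\<in>UNIV. a p * ricci g (J p) (L p) x)" for a J L
    by (subst sum.swap) (simp add: riemann_up_trace[OF x, symmetric] sum_distrib_left)
  show ?thesis
    unfolding cov_riemann_up_def cov2_def p
    using sw t[of "\<lambda>p. \<Gamma> p j k x" "\<lambda>p. p" "\<lambda>p. l"] t[of "\<lambda>p. \<Gamma> p j l x" "\<lambda>p. k" "\<lambda>p. p"]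
    by (simp add: sum_subtractf sum.distrib)
qed

text \<open>The contracted second Bianchi identity: in \<open>bianchi\<close> the upper index is set
  equal to the index of differentiation and summed, and \<open>cov_ricci\<close> recognises the
  other two terms as derivatives of the Ricci tensor.\<close>

lemma div_riemann:
  assumes x: "x \<in> D"
  shows "(\<Sum>m\<in>UNIV. \<Sum>s\<in>UNIV. gi m s x * cov4 g s (riemann g) j k l m x) = - cov2 g j (ricci g) k l x + cov2 g k (ricci g) j l x"
proof -
  have "(\<Sum>m\<in>UNIV. \<Sum>s\<in>UNIV. gi m s x * cov4 g s (riemann g) j k l m x) = (\<Sum>s\<in>UNIV. \<Sum>m\<in>UNIV. gi s m x * cov4 g s (riemann g) j k l m x)"
    by (subst sum.swap) (simp add: gi_sym[OF x])
  also have "\<dots> = (\<Sum>s\<in>UNIV. \<Sum>p\<in>UNIV. cov_riemann_up g s j k l p x * (\<Sum>m\<in>UNIV. gi s m x * g x $ m $ p))"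
  proof (rule sum.cong[OF refl])
    fix s
    have "(\<Sum>m\<in>UNIV. gi s m x * cov4 g s (riemann g) j k l m x) = (\<Sum>m\<in>UNIV. \<Sum>p\<in>UNIV. cov_riemann_up g s j k l p x * (gi s m x * g x $ m $ p))"
      by (simp add: cov4_riemann[OF x] sum_distrib_left mult_ac g_sym[OF x])
    then show "(\<Sum>m\<in>UNIV. gi s m x * cov4 g s (riemann g) j k l m x) = (\<Sum>p\<in>UNIV. cov_riemann_up g s j k l p x * (\<Sum>m\<in>UNIV. gi s m x * g x $ m $ p))"
      by (subst (asm) sum.swap) (simp add: sum_distrib_left)
  qed
  also have "\<dots> = (\<Sum>s\<in>UNIV. cov_riemann_up g s j k l s x)"
    unfolding gi_g[OF x] by (simp add: if_distrib[of "\<lambda>z. _ * z"] cong: if_cong)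
  also have "\<dots> = (\<Sum>s\<in>UNIV. - cov_riemann_up g j k s l s x + cov_riemann_up g k j s l s x)"
  proof (rule sum.cong[OF refl])
    fix s
    have "riemann_up g s j l s = (\<lambda>x. - riemann_up g j s l s x)" using riemann_up_swap[of s j l s] by blast
    then have "pd k (riemann_up g s j l s) x = - pd k (riemann_up g j s l s) x" by (simp add: pd_minus diff[OF x])
    then have "cov_riemann_up g k s j l s x = - cov_riemann_up g k j s l s x"
      unfolding cov_riemann_up_def
      by (simp add: riemann_up_swap[of s] riemann_up_swap[of _ j] sum_subtractf sum.distrib sum_negf)
    then show "cov_riemann_up g s j k l s x = - cov_riemann_up g j k s l s x + cov_riemann_up g k j s l s x"
      using bianchi[OF x, of s j k l s] by simp
  qed
  also have "\<dots> = - cov2 g j (ricci g) k l x + cov2 g k (ricci g) j l x"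
    by (simp add: sum.distrib sum_negf sum_subtractf cov_ricci[OF x])
  finally show ?thesis .
qed

end


section \<open>Product rules for covariant derivatives\<close>

context chart_metric
begin

text \<open>The products in the Weyl tensor pair the indices as \<open>jm\<close>, \<open>kl\<close>
  or as \<open>km\<close>, \<open>jl\<close>, whence two versions of the rule.\<close>

lemma cov4_prod1:
  assumes "x \<in> D" "a j m differentiable (at x)" "b k l differentiable (at x)"
  shows "cov4 g s (\<lambda>j k l m x. a j m x * b k l x) j k l m x = cov2 g s a j m x * b k l x + a j m x * cov2 g s b k l x"
  unfolding cov4_def cov2_def
  by (simp add: pd_mult assms sum.distrib left_diff_distrib right_diff_distrib distrib_left distrib_right
      sum_distrib_left sum_distrib_right mult_ac)

lemma cov4_prod2:
  assumes "x \<in> D" "a k m differentiable (at x)" "b j l differentiable (at x)"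
  shows "cov4 g s (\<lambda>j k l m x. a k m x * b j l x) j k l m x = cov2 g s a k m x * b j l x + a k m x * cov2 g s b j l x"
  unfolding cov4_def cov2_def
  by (simp add: pd_mult assms sum.distrib left_diff_distrib right_diff_distrib distrib_left distrib_right
      sum_distrib_left sum_distrib_right mult_ac)

lemma cov4_add:
  assumes "S j k l m differentiable (at x)" "T j k l m differentiable (at x)"
  shows "cov4 g s (\<lambda>j k l m x. S j k l m x + T j k l m x) j k l m x = cov4 g s S j k l m x + cov4 g s T j k l m x"
  unfolding cov4_def by (simp add: pd_add assms sum.distrib distrib_left)

lemma cov4_diff:
  assumes "S j k l m differentiable (at x)" "T j k l m differentiable (at x)"
  shows "cov4 g s (\<lambda>j k l m x. S j k l m x - T j k l m x) j k l m x = cov4 g s S j k l m x - cov4 g s T j k l m x"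
  unfolding cov4_def by (simp add: pd_diff assms sum_subtractf sum.distrib right_diff_distrib)

lemma cov4_cong:
  assumes "x \<in> D" "\<And>j k l m y. y \<in> D \<Longrightarrow> S j k l m y = T j k l m y"
  shows "cov4 g s S j k l m x = cov4 g s T j k l m x"
proof -
  have "pd s (S j k l m) x = pd s (T j k l m) x" by (rule pd_cong_open[OF D_open assms])
  then show ?thesis unfolding cov4_def using assms by simp
qed

lemma cov2_cong:
  assumes "x \<in> D" "\<And>k l y. y \<in> D \<Longrightarrow> S k l y = T k l y"
  shows "cov2 g s S k l x = cov2 g s T k l x"
proof -
  have "pd s (S k l) x = pd s (T k l) x" by (rule pd_cong_open[OF D_open assms])
  then show ?thesis unfolding cov2_def using assms by simp
qed

text \<open>The shape \<open>a g + b u \<otimes> u\<close> is common to the Ricci tensor, the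
  Schouten tensor and, in the end, \<open>\<nabla>u\<close>; one computation serves all
  three.\<close>

lemma cov2_metric_form:
  assumes x: "x \<in> D" and "a differentiable (at x)" "b differentiable (at x)" "\<And>i. (\<lambda>x. u x $ i) differentiable (at x)"
  shows "cov2 g s (\<lambda>k l x. a x * g x $ k $ l + b x * (u x $ k * u x $ l)) k l x
    = pd s a x * g x $ k $ l + pd s b x * (u x $ k * u x $ l)
      + b x * (cov1 g s u k x * u x $ l + u x $ k * cov1 g s u l x)"
proof -
  have "cov2 g s (\<lambda>k l x. a x * g x $ k $ l + b x * (u x $ k * u x $ l)) k l x
    = pd s a x * g x $ k $ l + a x * cov2 g s (\<lambda>i j x. g x $ i $ j) k l x + pd s b x * (u x $ k * u x $ l)
      + b x * (cov1 g s u k x * u x $ l + u x $ k * cov1 g s u l x)"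
    unfolding cov2_def cov1_def
    by (simp add: pd_add pd_mult differentiable_mult assms diff[OF x] sum.distrib left_diff_distrib right_diff_distrib
        distrib_left distrib_right sum_distrib_left sum_distrib_right mult_ac)
  then show ?thesis by (simp add: cov2_g[OF x])
qed

end

section \<open>Perfect fluids in a single chart\<close>

locale chart_fluid = chart_metric D g for D :: "(real^'n::finite) set" and g +
  fixes u :: "real^'n \<Rightarrow> real^'n" and A B :: "real^'n \<Rightarrow> real" and n :: real
  assumes u_smooth: "smooth_on D (\<lambda>x. u x $ i)" and A_smooth: "smooth_on D A" and B_smooth: "smooth_on D B"
    and norm_u: "x \<in> D \<Longrightarrow> sq_norm g u x = -1"
    and ricci_fluid: "x \<in> D \<Longrightarrow> ricci g k l x = A x * g x $ k $ l + B x * u x $ k * u x $ l"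
    and closed_u: "x \<in> D \<Longrightarrow> cov1 g k u j x - cov1 g j u k x = 0"
    and div_weyl_0: "x \<in> D \<Longrightarrow> div_weyl g j k l x = 0"
    and n_def: "n = real CARD('n)" and dim: "n > 3"
begin

text \<open>If \<open>\<nabla>u = f (g + u \<otimes> u)\<close>, the trace of the right-hand side is
  \<open>(n - 1) f\<close>. This is therefore the only candidate, and it is smooth also where
  \<open>B\<close> vanishes.\<close>

definition f :: "real^'n \<Rightarrow> real" where
  "f x = (\<Sum>k\<in>UNIV. \<Sum>l\<in>UNIV. ginv g k l x * cov1 g k u l x) / (n - 1)"

definition uu :: "'n \<Rightarrow> real^'n \<Rightarrow> real" where "uu i x = (\<Sum>j\<in>UNIV. ginv g i j x * u x $ j)"

lemma frame_at: "x \<in> D \<Longrightarrow> frame (\<lambda>i j. g x $ i $ j) (\<lambda>i j. ginv g i j x) (\<lambda>i. u x $ i)"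
  by unfold_locales (use g_sym gi_sym gi_g norm_u in \<open>auto simp: sq_norm_def\<close>)

lemma smooth_cov1: "smooth_on D (cov1 g k u j)"
  unfolding cov1_def by (intro smooth_intros D_open smooth_\<Gamma> u_smooth)

lemma smooth_f: "smooth_on D f"
  unfolding f_def divide_inverse by (intro smooth_intros D_open smooth_gi smooth_cov1)

lemma smooth_uu: "smooth_on D (uu i)"
  unfolding uu_def by (intro smooth_intros D_open smooth_gi u_smooth)

lemma udiff: "x \<in> D \<Longrightarrow> (\<lambda>x. u x $ i) differentiable (at x)"
  by (rule smooth_on_differentiable[OF u_smooth])

lemma lower_uu: "x \<in> D \<Longrightarrow> (\<Sum>j\<in>UNIV. g x $ i $ j * uu j x) = u x $ i"
  using frame.dt_g(1)[OF frame_at, of x i] by (simp add: frame.dt_def[OF frame_at] frame.v_def[OF frame_at] uu_def mult.commute)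

lemma uu_u: "x \<in> D \<Longrightarrow> (\<Sum>i\<in>UNIV. uu i x * u x $ i) = -1"
  using frame.dt_u[OF frame_at, of x] by (simp add: frame.dt_def[OF frame_at] frame.v_def[OF frame_at] uu_def)

text \<open>The norm of \<open>u\<close> is constant and the metric is parallel. The argument runs
  in ordinary derivatives: \<open>Q\<close> collects those of \<open>g\<close>, which compatibility
  turns into Christoffel terms.\<close>

lemma cov_u_uu:
  assumes x: "x \<in> D"
  shows "(\<Sum>l\<in>UNIV. uu l x * cov1 g j u l x) = 0"
proof -
  let ?G = "\<lambda>a b. (\<lambda>x. g x $ a $ b)"
  have d: "uu i differentiable (at x)" "?G a b differentiable (at x)" "(\<lambda>x. u x $ i) differentiable (at x)" for i a b
    using smooth_on_differentiable[OF smooth_uu x] diff[OF x] udiff[OF x] by auto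
  define Q where "Q = (\<Sum>a\<in>UNIV. \<Sum>b\<in>UNIV. uu a x * (pd j (?G a b) x * uu b x))"
  have u1: "pd j (\<lambda>x. u x $ a) x = (\<Sum>b\<in>UNIV. pd j (?G a b) x * uu b x) + (\<Sum>b\<in>UNIV. g x $ a $ b * pd j (uu b) x)" for a
  proof -
    have "pd j (\<lambda>x. u x $ a) x = pd j (\<lambda>x. \<Sum>b\<in>UNIV. g x $ a $ b * uu b x) x"
      by (rule pd_cong_open[OF D_open x]) (simp add: lower_uu)
    then show ?thesis by (simp add: pd_sum pd_mult differentiable_mult d sum.distrib)
  qed
  have 1: "(\<Sum>a\<in>UNIV. uu a x * pd j (\<lambda>x. u x $ a) x) = Q + (\<Sum>b\<in>UNIV. pd j (uu b) x * u x $ b)"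
  proof -
    have "(\<Sum>a\<in>UNIV. uu a x * pd j (\<lambda>x. u x $ a) x) = Q + (\<Sum>a\<in>UNIV. \<Sum>b\<in>UNIV. pd j (uu b) x * (g x $ b $ a * uu a x))"
      unfolding u1 Q_def by (simp add: distrib_left sum.distrib sum_distrib_left g_sym[OF x] mult_ac)
    also have "(\<Sum>a\<in>UNIV. \<Sum>b\<in>UNIV. pd j (uu b) x * (g x $ b $ a * uu a x)) = (\<Sum>b\<in>UNIV. pd j (uu b) x * (\<Sum>a\<in>UNIV. g x $ b $ a * uu a x))"
      by (subst sum.swap) (simp add: sum_distrib_left)
    finally show ?thesis by (simp add: lower_uu[OF x])
  qed
  have "pd j (\<lambda>x. \<Sum>i\<in>UNIV. uu i x * u x $ i) x = pd j (\<lambda>x. -1) x"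
    by (rule pd_cong_open[OF D_open x]) (simp add: uu_u)
  then have 2: "(\<Sum>b\<in>UNIV. pd j (uu b) x * u x $ b) + (\<Sum>a\<in>UNIV. uu a x * pd j (\<lambda>x. u x $ a) x) = 0"
    by (simp add: pd_sum pd_mult differentiable_mult d sum.distrib)
  have 3: "Q = 2 * (\<Sum>a\<in>UNIV. uu a x * (\<Sum>p\<in>UNIV. \<Gamma> p j a x * u x $ p))"
  proof -
    have s: "(\<Sum>b\<in>UNIV. (\<Sum>p\<in>UNIV. \<Gamma> p j a x * g x $ p $ b) * uu b x) = (\<Sum>p\<in>UNIV. \<Gamma> p j a x * u x $ p)" for a
    proof -
      have "(\<Sum>b\<in>UNIV. (\<Sum>p\<in>UNIV. \<Gamma> p j a x * g x $ p $ b) * uu b x) = (\<Sum>b\<in>UNIV. \<Sum>p\<in>UNIV. \<Gamma> p j a x * (g x $ p $ b * uu b x))"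
        by (simp add: sum_distrib_right mult.assoc)
      then show ?thesis by (subst (asm) sum.swap) (simp add: sum_distrib_left[symmetric] lower_uu[OF x])
    qed
    have "Q = (\<Sum>a\<in>UNIV. uu a x * (\<Sum>b\<in>UNIV. (\<Sum>p\<in>UNIV. \<Gamma> p j a x * g x $ p $ b) * uu b x))
       + (\<Sum>a\<in>UNIV. \<Sum>b\<in>UNIV. uu a x * ((\<Sum>p\<in>UNIV. \<Gamma> p j b x * g x $ p $ a) * uu b x))"
      unfolding Q_def compat[OF x] by (simp add: distrib_left distrib_right sum.distrib sum_distrib_left[of _ _ UNIV] g_sym[OF x])
    also have "(\<Sum>a\<in>UNIV. \<Sum>b\<in>UNIV. uu a x * ((\<Sum>p\<in>UNIV. \<Gamma> p j b x * g x $ p $ a) * uu b x))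
       = (\<Sum>b\<in>UNIV. uu b x * (\<Sum>a\<in>UNIV. (\<Sum>p\<in>UNIV. \<Gamma> p j b x * g x $ p $ a) * uu a x))"
      by (subst sum.swap) (simp add: sum_distrib_left mult_ac)
    finally show ?thesis by (simp add: s)
  qed
  have "(\<Sum>l\<in>UNIV. uu l x * cov1 g j u l x) = (\<Sum>a\<in>UNIV. uu a x * pd j (\<lambda>x. u x $ a) x)
      - (\<Sum>a\<in>UNIV. uu a x * (\<Sum>p\<in>UNIV. \<Gamma> p j a x * u x $ p))"
    by (simp add: cov1_def right_diff_distrib sum_subtractf)
  then show ?thesis using 1 2 3 by linarith
qed

lemma scal_fluid: "x \<in> D \<Longrightarrow> scal g x = n * A x - B x"
proof -
  assume x: "x \<in> D"
  interpret fr: frame "\<lambda>i j. g x $ i $ j" "\<lambda>i j. ginv g i j x" "\<lambda>i. u x $ i" by (rule frame_at[OF x])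
  have "scal g x = fr.tr (\<lambda>k l. A x * g x $ k $ l + B x * (u x $ k * u x $ l))"
    by (simp add: scal_def fr.tr_def ricci_fluid[OF x] mult.assoc)
  also have "\<dots> = n * A x - B x" by (simp add: fr.tr_dt n_def)
  finally show "scal g x = n * A x - B x" .
qed

text \<open>\<open>P\<close> is the Schouten tensor,
  \<open>(Ric - R g / (2 (n - 1))) / (n - 2)\<close>. It absorbs the scalar curvature, so that the
  derivative of the Weyl tensor follows from product rules.\<close>

lemma weyl_fluid:
  assumes x: "x \<in> D"
  defines "P \<equiv> \<lambda>k l x. ((n - 2) * A x + B x) / (2 * (n - 1)) / (n - 2) * g x $ k $ l + B x / (n - 2) * (u x $ k * u x $ l)"
  shows "weyl g j k l m x = riemann g j k l m x + g x $ j $ m * P k l x - g x $ k $ m * P j l x + P j m x * g x $ k $ l - P k m x * g x $ j $ l"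
proof -
  have P: "P k l x = (ricci g k l x - scal g x / (2 * (n - 1)) * g x $ k $ l) / (n - 2)" for k l
  proof -
    define t where "t = (n * A x - B x) / (2 * (n - 1))"
    have "((n - 2) * A x + B x) / (2 * (n - 1)) = A x - t"
      using dim by (simp add: t_def field_simps)
    then show ?thesis unfolding P_def ricci_fluid[OF x] scal_fluid[OF x] t_def[symmetric]
      by (simp add: diff_divide_distrib add_divide_distrib left_diff_distrib mult.assoc)
  qed
  define r where "r = scal g x / (2 * (n - 1))"
  have e: "scal g x / ((n - 1) * (n - 2)) = 2 * r / (n - 2)"
  proof -
    have "scal g x = 2 * r * (n - 1)" using dim by (simp add: r_def field_simps)
    then show ?thesis using dim by simp
  qed
  have "weyl g j k l m x = riemann g j k l m x
    + (g x $ j $ m * ricci g k l x - g x $ k $ m * ricci g j l x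
       + ricci g j m x * g x $ k $ l - ricci g k m x * g x $ j $ l) / (n - 2)
    - (g x $ j $ m * g x $ k $ l - g x $ m $ k * g x $ j $ l) * (scal g x / ((n - 1) * (n - 2)))"
    by (simp add: weyl_def Let_def n_def)
  then show ?thesis unfolding P e r_def[symmetric] g_sym[OF x, of m k]
    using dim by (simp add: divide_simps) (simp add: algebra_simps)
qed

lemma cov_u_sym: "x \<in> D \<Longrightarrow> cov1 g j u l x = cov1 g l u j x"
  using closed_u by (metis eq_iff_diff_eq_0)

text \<open>In the divergence of the Weyl tensor two of the metric terms contract the index of
  differentiation away and leave derivatives of \<open>P\<close>; the other two leave its divergence
  \<open>q\<close>. With the contracted Bianchi identity this is the hypothesis of
  \<open>fluid_algebra\<close>.\<close>

lemma
  assumes x: "x \<in> D"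
  shows B_cov_u: "B x * cov1 g j u l x = B x * (f x * (g x $ j $ l + u x $ j * u x $ l))"
    and grad_S: "((n - 2) * pd j A x + pd j B x) / (2 * (n - 1)) = B x * f x * u x $ j"
    and grad_A: "\<exists>c. \<forall>j. pd j A x = c * u x $ j"
proof -
  interpret fr: frame "\<lambda>i j. g x $ i $ j" "\<lambda>i j. ginv g i j x" "\<lambda>i. u x $ i" by (rule frame_at[OF x])
  define a b where "a = (\<lambda>x. ((n - 2) * A x + B x) / (2 * (n - 1)) / (n - 2))" and "b = (\<lambda>x. B x / (n - 2))"
  define P where "P = (\<lambda>k l x. a x * g x $ k $ l + b x * (u x $ k * u x $ l))"
  let ?G = "\<lambda>i j x. g x $ i $ j"
  let ?K = "\<lambda>j l. cov1 g j u l x"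
  have AB: "A differentiable (at x)" "B differentiable (at x)"
    using smooth_on_differentiable[OF _ x] A_smooth B_smooth by blast+
  have ab: "smooth_on D a" "smooth_on D b"
    unfolding a_def b_def divide_inverse by (intro smooth_intros D_open A_smooth B_smooth)+
  have da: "pd j a x = ((n - 2) * pd j A x + pd j B x) / (2 * (n - 1)) / (n - 2)" for j
  proof -
    define c where "c = 1 / (2 * (n - 1)) / (n - 2)"
    have "a = (\<lambda>x. c * ((n - 2) * A x + B x))" by (simp add: a_def c_def fun_eq_iff)
    then have "pd j a x = c * ((n - 2) * pd j A x + pd j B x)" by (simp add: pd_cmult pd_add AB)
    then show ?thesis by (simp add: c_def)
  qed
  have db: "pd j b x = pd j B x / (n - 2)" for j
  proof -
    define c where "c = 1 / (n - 2)"
    have "b = (\<lambda>x. c * B x)" by (simp add: b_def c_def fun_eq_iff)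
    then have "pd j b x = c * pd j B x" by (simp add: pd_cmult AB)
    then show ?thesis by (simp add: c_def)
  qed
  have sP: "smooth_on D (P k l)" for k l
    unfolding P_def by (intro smooth_intros D_open ab u_smooth g_smooth)
  have dP: "P k l differentiable (at x)" for k l by (rule smooth_on_differentiable[OF sP x])
  have dR: "riemann g j k l m differentiable (at x)" for j k l m
    unfolding riemann_def by (intro differentiable_sum_all differentiable_mult diff[OF x] finite)
  have cP: "cov2 g s P k l x = pd s a x * g x $ k $ l + pd s b x * (u x $ k * u x $ l)
      + b x * (?K s k * u x $ l + u x $ k * ?K s l)" for s k l
    unfolding P_def
    by (rule cov2_metric_form[OF x smooth_on_differentiable[OF ab(1) x] smooth_on_differentiable[OF ab(2) x] udiff[OF x]])
  have cR: "cov2 g s (ricci g) k l x = pd s A x * g x $ k $ l + pd s B x * (u x $ k * u x $ l)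
      + B x * (?K s k * u x $ l + u x $ k * ?K s l)" for s k l
  proof -
    have "cov2 g s (ricci g) k l x = cov2 g s (\<lambda>k l x. A x * g x $ k $ l + B x * (u x $ k * u x $ l)) k l x"
      by (rule cov2_cong[OF x]) (simp add: ricci_fluid mult.assoc)
    then show ?thesis using cov2_metric_form[OF x AB udiff[OF x]] by simp
  qed
  have W: "cov4 g s (weyl g) j k l m x = cov4 g s (riemann g) j k l m x
     + g x $ j $ m * cov2 g s P k l x - g x $ k $ m * cov2 g s P j l x + cov2 g s P j m x * g x $ k $ l - cov2 g s P k m x * g x $ j $ l" for s j k l m
  proof -
    have "cov4 g s (weyl g) j k l m x = cov4 g s (\<lambda>j k l m x. riemann g j k l m x + ?G j m x * P k l x - ?G k m x * P j l x
        + P j m x * ?G k l x - P k m x * ?G j l x) j k l m x"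
      by (rule cov4_cong[OF x]) (simp add: weyl_fluid P_def a_def b_def)
    also have "\<dots> = cov4 g s (riemann g) j k l m x + cov4 g s (\<lambda>j k l m x. ?G j m x * P k l x) j k l m x
       - cov4 g s (\<lambda>j k l m x. ?G k m x * P j l x) j k l m x + cov4 g s (\<lambda>j k l m x. P j m x * ?G k l x) j k l m x
       - cov4 g s (\<lambda>j k l m x. P k m x * ?G j l x) j k l m x"
      by (simp add: cov4_add cov4_diff differentiable_mult dP dR diff[OF x])
    also have "\<dots> = cov4 g s (riemann g) j k l m x
     + g x $ j $ m * cov2 g s P k l x - g x $ k $ m * cov2 g s P j l x + cov2 g s P j m x * g x $ k $ l - cov2 g s P k m x * g x $ j $ l"
      by (simp add: cov4_prod1[OF x, where a = ?G] cov4_prod2[OF x, where a = ?G] cov4_prod1[OF x, where b = ?G]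
        cov4_prod2[OF x, where b = ?G] dP diff[OF x] cov2_g[OF x])
    finally show ?thesis .
  qed
  define q where "q = (\<lambda>j. \<Sum>m\<in>UNIV. \<Sum>s\<in>UNIV. ginv g m s x * cov2 g s P j m x)"
  have lowidx: "(\<Sum>m\<in>UNIV. \<Sum>s\<in>UNIV. ginv g m s x * (g x $ j $ m * X s)) = X j" for j and X :: "'n \<Rightarrow> real"
    using fr.tr_X_g[of X j] fr.tr_swap[of "\<lambda>k l. X k * g x $ j $ l"] by (simp add: fr.tr_def mult.commute)
  have H: "- (cov2 g j (ricci g) k l x - cov2 g k (ricci g) j l x) + (cov2 g j P k l x - cov2 g k P j l x)
      + g x $ k $ l * q j - g x $ j $ l * q k = 0" for j k l
  proof -
    have "0 = (\<Sum>m\<in>UNIV. \<Sum>s\<in>UNIV. ginv g m s x * cov4 g s (weyl g) j k l m x)"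
      using div_weyl_0[OF x, of j k l] by (simp add: div_weyl_def)
    also have "\<dots> = (\<Sum>m\<in>UNIV. \<Sum>s\<in>UNIV. ginv g m s x * cov4 g s (riemann g) j k l m x)
       + (\<Sum>m\<in>UNIV. \<Sum>s\<in>UNIV. ginv g m s x * (g x $ j $ m * cov2 g s P k l x))
       - (\<Sum>m\<in>UNIV. \<Sum>s\<in>UNIV. ginv g m s x * (g x $ k $ m * cov2 g s P j l x))
       + (\<Sum>m\<in>UNIV. \<Sum>s\<in>UNIV. g x $ k $ l * (ginv g m s x * cov2 g s P j m x))
       - (\<Sum>m\<in>UNIV. \<Sum>s\<in>UNIV. g x $ j $ l * (ginv g m s x * cov2 g s P k m x))"
      unfolding W by (simp add: distrib_left right_diff_distrib sum.distrib sum_subtractf mult_ac)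
    also have "\<dots> = - cov2 g j (ricci g) k l x + cov2 g k (ricci g) j l x + cov2 g j P k l x - cov2 g k P j l x
        + g x $ k $ l * q j - g x $ j $ l * q k"
      unfolding div_riemann[OF x] lowidx by (simp add: q_def sum_distrib_left)
    finally show ?thesis by simp
  qed
  have Kv: "fr.dt (?K j) = 0" for j
    using cov_u_uu[OF x, of j] by (simp add: fr.dt_def fr.v_def uu_def)
  note alg = fr.fluid_algebra[where K = ?K and dA = "\<lambda>j. pd j A x" and dB = "\<lambda>j. pd j B x" and B = "B x",
      OF cov_u_sym[OF x] Kv dim[unfolded n_def], folded n_def]
  have fx: "f x = fr.tr ?K / (n - 1)" by (simp add: f_def fr.tr_def)
  have H': "- (pd j A x * g x $ k $ l + pd j B x * u x $ k * u x $ l + B x * (?K j k * u x $ l + u x $ k * ?K j l)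
        - (pd k A x * g x $ j $ l + pd k B x * u x $ j * u x $ l + B x * (?K k j * u x $ l + u x $ j * ?K k l)))
      + (((n - 2) * pd j A x + pd j B x) / (2 * (n - 1)) / (n - 2) * g x $ k $ l + pd j B x / (n - 2) * u x $ k * u x $ l
           + B x / (n - 2) * (?K j k * u x $ l + u x $ k * ?K j l)
        - (((n - 2) * pd k A x + pd k B x) / (2 * (n - 1)) / (n - 2) * g x $ j $ l + pd k B x / (n - 2) * u x $ j * u x $ l
           + B x / (n - 2) * (?K k j * u x $ l + u x $ j * ?K k l)))
      + g x $ k $ l * (\<Sum>m\<in>UNIV. \<Sum>s\<in>UNIV. ginv g m s x * (((n - 2) * pd s A x + pd s B x) / (2 * (n - 1)) / (n - 2) * g x $ j $ m
           + pd s B x / (n - 2) * u x $ j * u x $ m + B x / (n - 2) * (?K s j * u x $ m + u x $ j * ?K s m)))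
      - g x $ j $ l * (\<Sum>m\<in>UNIV. \<Sum>s\<in>UNIV. ginv g m s x * (((n - 2) * pd s A x + pd s B x) / (2 * (n - 1)) / (n - 2) * g x $ k $ m
           + pd s B x / (n - 2) * u x $ k * u x $ m + B x / (n - 2) * (?K s k * u x $ m + u x $ k * ?K s m))) = 0" for j k l
    using H[of j k l] unfolding q_def cP cR da db unfolding b_def by (simp only: mult.assoc)
  show "B x * cov1 g j u l x = B x * (f x * (g x $ j $ l + u x $ j * u x $ l))" unfolding fx by (rule alg(1)[OF H'])
  show "((n - 2) * pd j A x + pd j B x) / (2 * (n - 1)) = B x * f x * u x $ j" unfolding fx by (rule alg(2)[OF H'])
  show "\<exists>c. \<forall>j. pd j A x = c * u x $ j" by (rule alg(3)[OF H'])
qed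

end

text \<open>The torse-forming equation, which \<open>B_cov_u\<close> yields only where \<open>B \<noteq> 0\<close>.\<close>
locale chart_torse = chart_fluid D g u A B n for D :: "(real^'n::finite) set" and g u A B n +
  assumes cov_u: "x \<in> D \<Longrightarrow> cov1 g j u l x = f x * (g x $ j $ l + u x $ j * u x $ l)"
begin

text \<open>By \<open>cov_u\<close> the commutator of derivatives of \<open>u\<close> contains only
  \<open>f\<close>, its gradient, \<open>g\<close> and \<open>u\<close>. The trace of the curvature
  side is minus the Ricci tensor applied to \<open>u\<close>, and the fluid form makes the latter
  \<open>(A - B) u\<close>, as \<open>u\<close> has norm -1.\<close>

lemma
  assumes x: "x \<in> D"
  shows grad_f: "pd j f x = ((f x)\<^sup>2 + (A x - B x) / (1 - n)) * u x $ j"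
    and riemann_u: "(\<Sum>m\<in>UNIV. riemann_up g j k l m x * u x $ m)
      = (A x - B x) / (1 - n) * (u x $ j * g x $ k $ l - u x $ k * g x $ j $ l)"
proof -
  interpret fr: frame "\<lambda>i j. g x $ i $ j" "\<lambda>i j. ginv g i j x" "\<lambda>i. u x $ i" by (rule frame_at[OF x])
  define Ru where "Ru = (\<lambda>j k l. \<Sum>m\<in>UNIV. riemann_up g j k l m x * u x $ m)"
  have fd: "f differentiable (at x)" by (rule smooth_on_differentiable[OF smooth_f x])
  have c: "cov2 g j (\<lambda>k l. cov1 g k u l) k l x = pd j f x * g x $ k $ l + pd j f x * (u x $ k * u x $ l)
     + f x * (cov1 g j u k x * u x $ l + u x $ k * cov1 g j u l x)" for j k l
  proof -
    have "cov2 g j (\<lambda>k l. cov1 g k u l) k l x = cov2 g j (\<lambda>k l x. f x * g x $ k $ l + f x * (u x $ k * u x $ l)) k l x"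
      by (rule cov2_cong[OF x]) (simp add: cov_u algebra_simps)
    then show ?thesis using cov2_metric_form[OF x fd fd udiff[OF x]] by simp
  qed
  have R: "(pd j f x - (f x)\<^sup>2 * u x $ j) * (g x $ k $ l + u x $ k * u x $ l)
      - (pd k f x - (f x)\<^sup>2 * u x $ k) * (g x $ j $ l + u x $ j * u x $ l) = Ru j k l" for j k l
  proof -
    have "Ru j k l = cov2 g j (\<lambda>k l. cov1 g k u l) k l x - cov2 g k (\<lambda>k l. cov1 g k u l) j l x"
      unfolding Ru_def by (rule ricci_identity[OF x u_smooth, symmetric])
    then show ?thesis unfolding c cov_u[OF x] by (simp add: g_sym[OF x, of k j] power2_eq_square algebra_simps)
  qed
  have low: "Ru j k l = (\<Sum>p\<in>UNIV. uu p x * riemann g j k l p x)" for j k l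
  proof -
    have "Ru j k l = (\<Sum>m\<in>UNIV. \<Sum>p\<in>UNIV. uu p x * (riemann_up g j k l m x * g x $ m $ p))"
      unfolding Ru_def by (simp add: lower_uu[OF x, symmetric] sum_distrib_left mult_ac)
    then show ?thesis by (subst (asm) sum.swap) (simp add: riemann_def sum_distrib_left)
  qed
  have ric: "fr.tr (Ru j) = - (A x - B x) * u x $ j" for j
  proof -
    have "fr.tr (Ru j) = (\<Sum>k\<in>UNIV. \<Sum>l\<in>UNIV. \<Sum>p\<in>UNIV. uu p x * (ginv g k l x * riemann g j k l p x))"
      by (simp add: fr.tr_def low sum_distrib_left mult_ac)
    also have "\<dots> = (\<Sum>k\<in>UNIV. \<Sum>p\<in>UNIV. \<Sum>l\<in>UNIV. uu p x * (ginv g k l x * riemann g j k l p x))"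
      by (rule sum.cong[OF refl]) (rule sum.swap)
    also have "\<dots> = (\<Sum>p\<in>UNIV. uu p x * (- ricci g j p x))"
      by (subst sum.swap) (simp add: ricci_def sum_distrib_left)
    also have "\<dots> = - fr.dt (\<lambda>p. A x * g x $ j $ p + (B x * u x $ j) * u x $ p)"
      by (simp add: ricci_fluid[OF x] fr.dt_def fr.v_def uu_def sum_negf[symmetric] algebra_simps)
    also have "\<dots> = - (A x - B x) * u x $ j" by (simp add: fr.tr_dt algebra_simps)
    finally show ?thesis .
  qed
  note alg = fr.ricci_identity_algebra[where df = "\<lambda>j. pd j f x" and f = "f x" and A = "A x" and B = "B x", OF dim[unfolded n_def] R ric, folded n_def]
  show "pd j f x = ((f x)\<^sup>2 + (A x - B x) / (1 - n)) * u x $ j" by (rule alg(1))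
  show "(\<Sum>m\<in>UNIV. riemann_up g j k l m x * u x $ m) = (A x - B x) / (1 - n) * (u x $ j * g x $ k $ l - u x $ k * g x $ j $ l)"
    using alg(2) by (simp add: Ru_def)
qed

text \<open>Contracted with the raised \<open>u\<close>, each part of the Weyl tensor leaves a
  multiple of \<open>u j * g k l - u k * g j l\<close>, the curvature by \<open>riemann_u\<close>,
  apart from terms \<open>u j * u k * u l\<close> that cancel. The coefficients sum to zero.\<close>

lemma weyl_u:
  assumes x: "x \<in> D"
  shows "(\<Sum>m\<in>UNIV. \<Sum>s\<in>UNIV. weyl g j k l m x * ginv g m s x * u x $ s) = 0"
proof -
  interpret fr: frame "\<lambda>i j. g x $ i $ j" "\<lambda>i j. ginv g i j x" "\<lambda>i. u x $ i" by (rule frame_at[OF x])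
  define a b where "a = ((n - 2) * A x + B x) / (2 * (n - 1)) / (n - 2)" and "b = B x / (n - 2)"
  have R: "fr.dt (\<lambda>m. riemann g j k l m x) = (A x - B x) / (1 - n) * (u x $ j * g x $ k $ l - u x $ k * g x $ j $ l)"
  proof -
    have "(\<Sum>m\<in>UNIV. riemann_up g j k l m x * u x $ m) = (\<Sum>m\<in>UNIV. \<Sum>p\<in>UNIV. uu p x * (riemann_up g j k l m x * g x $ m $ p))"
      by (simp add: lower_uu[OF x, symmetric] sum_distrib_left mult_ac)
    then have "(\<Sum>m\<in>UNIV. riemann_up g j k l m x * u x $ m) = fr.dt (\<lambda>m. riemann g j k l m x)"
      by (subst (asm) sum.swap) (simp add: riemann_def sum_distrib_left fr.dt_def fr.v_def uu_def)
    then show ?thesis using riemann_u[OF x] by simp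
  qed
  have "(\<Sum>m\<in>UNIV. \<Sum>s\<in>UNIV. weyl g j k l m x * ginv g m s x * u x $ s) = fr.dt (\<lambda>m. weyl g j k l m x)"
    by (simp add: fr.dt_def fr.v_def sum_distrib_left sum_distrib_right mult_ac)
  also have "\<dots> = fr.dt (\<lambda>m. riemann g j k l m x + (a * g x $ k $ l + b * (u x $ k * u x $ l)) * g x $ j $ m
      - (a * g x $ j $ l + b * (u x $ j * u x $ l)) * g x $ k $ m
      + (g x $ k $ l * a * g x $ j $ m + g x $ k $ l * b * u x $ j * u x $ m)
      - (g x $ j $ l * a * g x $ k $ m + g x $ j $ l * b * u x $ k * u x $ m))"
    unfolding weyl_fluid[OF x] a_def[symmetric] b_def[symmetric] by (simp add: algebra_simps)
  also have "\<dots> = ((A x - B x) / (1 - n) + 2 * a - b) * (u x $ j * g x $ k $ l - u x $ k * g x $ j $ l)"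
    unfolding fr.dt_add fr.dt_diff fr.dt_cmult fr.dt_g fr.dt_u R by (simp add: algebra_simps)
  also have "(A x - B x) / (1 - n) + 2 * a - b = 0"
  proof -
    have "2 * a - b = (A x - B x) / (n - 1)" using dim by (simp add: a_def b_def divide_simps) (simp add: algebra_simps)
    moreover have "(A x - B x) / (1 - n) = - ((A x - B x) / (n - 1))"
      by (metis minus_diff_eq minus_divide_right)
    ultimately show ?thesis by simp
  qed
  finally show ?thesis by simp
qed

end

section \<open>The warped product form\<close>

lemma sum_option: "(\<Sum>i\<in>(UNIV::'m::finite option set). F i) = F None + (\<Sum>\<alpha>\<in>UNIV. F (Some \<alpha>))"
  by (simp add: UNIV_option_conv sum.reindex)

lemma sum_delta: "(\<Sum>i\<in>(UNIV::'m::finite set). F i * (if i = a then c else 0)) = F a * (c::real)"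
  by (simp add: if_distrib[of "\<lambda>z. _ * z"] cong: if_cong)

lemma matrix_inv_unique:
  fixes X Y :: "real^'n::finite^'n"
  assumes "X ** Y = mat 1"
  shows "invertible Y" "matrix_inv Y = X"
proof -
  have "Y ** X = mat 1" using assms matrix_left_right_inverse by blast
  then show "invertible Y" using assms unfolding invertible_def by blast
  from matrix_inv_mult[OF this] show "matrix_inv Y = X"
    using assms by (metis matrix_mul_assoc matrix_mul_lid matrix_mul_rid)
qed

text \<open>After diagonalisation the component \<open>t\<close> dominates the time-like
  \<open>a\<close>. Were \<open>b\<close>, orthogonal to it, not space-like, the Cauchy-Schwarz
  inequality for the other components would fail. This is the source of positivity of the fibre
  metric.\<close>

lemma lorentzian_spacelike:
  fixes G :: "real^'n::finite^'n"
  assumes "lorentzian_form G" "e \<bullet> (G *v e) < 0" "e \<bullet> (G *v w) = 0" "w \<noteq> 0"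
  shows "0 < w \<bullet> (G *v w)"
proof -
  obtain P :: "real^'n^'n" and t where P: "invertible P"
    and D: "transpose P ** G ** P = (\<chi> i j. if i = j then (if i = t then -1 else 1) else 0)"
    using assms(1) unfolding lorentzian_form_def by blast
  define a b where "a = matrix_inv P *v e" and "b = matrix_inv P *v w"
  have ab: "P *v a = e" "P *v b = w"
    by (simp_all add: a_def b_def matrix_vector_mul_assoc matrix_inv_mult(1)[OF P])
  have form: "(P *v y) \<bullet> (G *v (P *v z)) = (\<Sum>i\<in>UNIV-{t}. y $ i * z $ i) - y $ t * z $ t" for y z
  proof -
    have "(P *v y) \<bullet> (G *v (P *v z)) = y \<bullet> ((transpose P ** G ** P) *v z)"
    proof -
      have "(P *v y) \<bullet> w = y \<bullet> (transpose P *v w)" for w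
        by (metis dot_lmul_matrix vector_transpose_matrix)
      from this[of "G *v (P *v z)"] show ?thesis by (simp only: matrix_vector_mul_assoc matrix_mul_assoc)
    qed
    also have "\<dots> = (\<Sum>i\<in>UNIV. y $ i * ((if i = t then -1 else 1) * z $ i))"
      unfolding D by (simp add: inner_vec_def matrix_vector_mult_def if_distrib[of "\<lambda>c. c * _"] cong: if_cong)
    also have "\<dots> = (\<Sum>i\<in>UNIV-{t}. y $ i * z $ i) - y $ t * z $ t"
      by (subst sum.remove[of _ t]) (auto intro!: sum.cong)
    finally show ?thesis .
  qed
  let ?S = "\<lambda>y z. \<Sum>i\<in>UNIV-{t}. y $ i * z $ i"
  have 1: "?S a a < a $ t * a $ t" using assms(2) unfolding ab(1)[symmetric] form by simp
  have 2: "?S a b = a $ t * b $ t" using assms(3) unfolding ab[symmetric] form by simp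
  have "\<not> ?S b b \<le> b $ t * b $ t"
  proof
    assume le: "?S b b \<le> b $ t * b $ t"
    have pos: "0 \<le> ?S a a" "0 \<le> ?S b b" by (auto intro!: sum_nonneg)
    show False
    proof (cases "b $ t = 0")
      case True
      then have "?S b b = 0" using le pos by simp
      then have "b $ i = 0" if "i \<noteq> t" for i
        using that by (subst (asm) sum_nonneg_eq_0_iff) auto
      then have "b = 0" using True by (metis vec_eq_iff zero_index)
      then show False using ab(2) assms(4) by simp
    next
      case False
      have "(a $ t * b $ t)\<^sup>2 \<le> ?S a a * ?S b b"
        using Cauchy_Schwarz_ineq_sum[of "\<lambda>i. a $ i" "\<lambda>i. b $ i" "UNIV - {t}"] 2 by (simp add: power2_eq_square)
      also have "\<dots> \<le> ?S a a * (b $ t * b $ t)" using le pos by (intro mult_left_mono)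
      also have "\<dots> < (a $ t * a $ t) * (b $ t * b $ t)" using 1 False by (intro mult_strict_right_mono) (auto simp: zero_less_mult_iff)
      finally show False by (simp add: power2_eq_square mult_ac)
    qed
  qed
  then show ?thesis unfolding ab(2)[symmetric] form by simp
qed

definition line :: "real \<Rightarrow> real^('m::finite option)" where "line t = t *\<^sub>R axis None 1"
definition emb :: "real^'m::finite \<Rightarrow> real^('m option)" where
  "emb y = (\<chi> i. case i of None \<Rightarrow> 0 | Some \<alpha> \<Rightarrow> y $ \<alpha>)"

lemma emb_nth [simp]: "emb y $ None = 0" "emb y $ Some \<alpha> = y $ \<alpha>" by (simp_all add: emb_def)
lemma line_nth [simp]: "line t $ None = t" "line t $ Some \<alpha> = 0" by (simp_all add: line_def axis_def)

lemma cube_option: "z \<in> cube r \<longleftrightarrow> z $ None \<in> {-r<..<r} \<and> space_part z \<in> cube r"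
  unfolding cube_def space_part_def
  by (auto simp: abs_less_iff) (metis option.exhaust minus_less_iff)+

lemma emb_cube: "r > 0 \<Longrightarrow> y \<in> cube r \<Longrightarrow> emb y \<in> cube r"
  by (simp add: cube_option space_part_def)

lemma line_cube: "t \<in> {-r<..<r} \<Longrightarrow> line t \<in> (cube r :: (real^'m::finite option) set)"
  unfolding cube_def
proof (intro CollectI allI)
  fix i assume "t \<in> {-r<..<r}"
  then show "\<bar>line t $ i\<bar> < r" by (cases i) (auto simp: abs_less_iff)
qed

lemma set_coord_emb: "set_coord None 0 z = emb (space_part z)"
proof -
  have "set_coord None 0 z $ i = emb (space_part z) $ i" for i by (cases i) (simp_all add: set_coord_nth space_part_def)
  then show ?thesis by (simp add: vec_eq_iff)
qed

text \<open>Two notions of smoothness meet here: the iterated \<open>deriv\<close> of the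
  restriction to the time axis is the restriction of the iterated \<open>pd None\<close>.\<close>

lemma smooth_real_on_line:
  fixes F :: "real^'m::finite option \<Rightarrow> real"
  assumes "smooth_on (cube r) F"
  shows "smooth_real_on {-r<..<r} (\<lambda>t. F (line t))"
proof -
  let ?F = "\<lambda>k. foldr pd (replicate k None) F"
  have s: "smooth_on (cube r) (?F k)" for k by (induction k) (auto simp: assms smooth_on_pd)
  have d: "((\<lambda>t. ?F k (line t)) has_real_derivative ?F (Suc k) (line t)) (at t)" if "t \<in> {-r<..<r}" for k t
    using pd_line[of "?F k" 0 t None] smooth_on_differentiable[OF s line_cube[OF that]] by (simp add: line_def)
  have e: "(deriv ^^ k) (\<lambda>t. F (line t)) t = ?F k (line t)" if "t \<in> {-r<..<r}" for k t
    using that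
  proof (induction k arbitrary: t)
    case (Suc k)
    have "((deriv ^^ k) (\<lambda>t. F (line t)) has_real_derivative ?F (Suc k) (line t)) (at t)"
      by (rule has_field_derivative_transform_within_open[OF d[OF Suc.prems] _ Suc.prems]) (use Suc.IH in auto)
    then show ?case by (simp add: DERIV_imp_deriv)
  qed simp
  show ?thesis unfolding smooth_real_on_def
  proof (intro allI ballI)
    fix k t assume t: "t \<in> {-r<..<r}"
    have "((deriv ^^ k) (\<lambda>t. F (line t)) has_real_derivative ?F (Suc k) (line t)) (at t)"
      by (rule has_field_derivative_transform_within_open[OF d[OF t] _ t]) (use e in auto)
    then show "(deriv ^^ k) (\<lambda>t. F (line t)) differentiable (at t)"
      unfolding real_differentiable_def by blast
  qed
qed

lemma emb_smooth: "open S \<Longrightarrow> smooth_on S (\<lambda>y. emb y $ i)"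
  by (cases i) (simp_all add: smooth_on_const smooth_on_coord)

lemma pd_emb:
  fixes F :: "real^'m::finite option \<Rightarrow> real"
  assumes "F differentiable (at (emb y))"
  shows "pd \<alpha> (\<lambda>y. F (emb y)) y = pd (Some \<alpha>) F (emb y)"
proof -
  have "pd \<alpha> (\<lambda>y. F (emb y)) y = (\<Sum>a\<in>UNIV. pd a F (emb y) * pd \<alpha> (\<lambda>y. emb y $ a) y)"
    by (rule pd_chain[OF smooth_on_differentiable[OF emb_smooth[OF open_UNIV]] assms]) simp
  then show ?thesis
    by (simp add: sum_option pd_coord if_distrib[of "\<lambda>z. _ * z"] cong: if_cong)
qed

text \<open>What the flow box provides: \<open>u\<close> is minus the differential of the time
  coordinate, and the raised \<open>u\<close> is the time direction, so the row \<open>None\<close>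
  of the metric consists of the components of \<open>u\<close>.\<close>

locale chart_warped = chart_torse "cube r" g u A B n
  for r :: real and g :: "real^'m::finite option \<Rightarrow> real^'m option^'m option" and u A B n +
  assumes r_pos: "r > 0"
    and u_None: "x \<in> cube r \<Longrightarrow> u x $ None = -1" and u_Some: "x \<in> cube r \<Longrightarrow> u x $ Some \<alpha> = 0"
    and g_NN: "x \<in> cube r \<Longrightarrow> g x $ None $ None = -1" and g_NS: "x \<in> cube r \<Longrightarrow> g x $ None $ Some \<alpha> = 0"
    and g_lor: "x \<in> cube r \<Longrightarrow> lorentzian_form (g x)"
begin

abbreviation "C \<equiv> (cube r :: (real^'m option) set)"

lemma g_SN: "x \<in> C \<Longrightarrow> g x $ Some \<alpha> $ None = 0"
  using g_NS g_sym by metis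

lemma pd_const_on: "x \<in> C \<Longrightarrow> (\<And>y. y \<in> C \<Longrightarrow> F y = c) \<Longrightarrow> pd i F x = 0"
  using pd_cong_open[OF open_cube, of x r F "\<lambda>y. c" i] by simp

lemma pd_g_None: "x \<in> C \<Longrightarrow> pd i (\<lambda>x. g x $ None $ j) x = 0" "x \<in> C \<Longrightarrow> pd i (\<lambda>x. g x $ j $ None) x = 0"
proof -
  assume x: "x \<in> C"
  show "pd i (\<lambda>x. g x $ None $ j) x = 0"
    by (cases j) (auto intro!: pd_const_on[OF x] simp: g_NN g_NS)
  then show "pd i (\<lambda>x. g x $ j $ None) x = 0" using pd_g_sym[OF x, of i j None] by simp
qed

text \<open>The components of \<open>u\<close> are constant, so \<open>\<nabla>u\<close> reduces to
  its Christoffel term, in which only the index \<open>None\<close> survives.\<close>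

lemma \<Gamma>_None: "x \<in> C \<Longrightarrow> \<Gamma> None k j x = f x * (g x $ k $ j + u x $ k * u x $ j)"
proof -
  assume x: "x \<in> C"
  have "pd k (\<lambda>x. u x $ j) x = 0"
    by (cases j) (auto intro!: pd_const_on[OF x] simp: u_None u_Some)
  then show ?thesis using cov_u[OF x, of k j] by (simp add: cov1_def sum_option u_None[OF x] u_Some[OF x])
qed

text \<open>Lowering the index \<open>None\<close> costs a sign, and of the first-kind symbol only
  the time derivative of the spatial metric is left.\<close>

lemma pd_None_g: "x \<in> C \<Longrightarrow> pd None (\<lambda>x. g x $ Some \<alpha> $ Some \<beta>) x = 2 * f x * g x $ Some \<alpha> $ Some \<beta>"
proof -
  assume x: "x \<in> C"
  have "(\<Sum>p\<in>UNIV. \<Gamma> p (Some \<alpha>) (Some \<beta>) x * g x $ p $ None) = - \<Gamma> None (Some \<alpha>) (Some \<beta>) x"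
    by (simp add: sum_option g_NN[OF x] g_SN[OF x])
  then show ?thesis
    using \<Gamma>_lower[OF x, of "Some \<alpha>" "Some \<beta>" None] by (simp add: \<Gamma>_None[OF x] u_Some[OF x] pd_g_None[OF x])
qed

text \<open>Lowered Christoffel symbols are explicit in these coordinates; nondegeneracy lets the
  symbols themselves be identified from them.\<close>

lemma g_nondeg:
  assumes x: "x \<in> C" and "\<And>l. (\<Sum>p\<in>UNIV. X p * g x $ p $ l) = 0"
  shows "X q = 0"
proof -
  have "0 = (\<Sum>l\<in>UNIV. (\<Sum>p\<in>UNIV. X p * g x $ p $ l) * gi l q x)" by (simp add: assms(2))
  also have "\<dots> = (\<Sum>l\<in>UNIV. \<Sum>p\<in>UNIV. X p * (g x $ p $ l * gi l q x))" by (simp add: sum_distrib_right mult.assoc)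
  also have "\<dots> = (\<Sum>p\<in>UNIV. X p * (\<Sum>l\<in>UNIV. g x $ p $ l * gi l q x))" by (subst sum.swap) (simp add: sum_distrib_left)
  also have "\<dots> = X q" unfolding g_gi[OF x] by (rule trans[OF sum_delta]) simp
  finally show ?thesis by simp
qed

lemma \<Gamma>_N_S: assumes x: "x \<in> C" shows "\<Gamma> p None (Some \<beta>) x = (if p = Some \<beta> then f x else 0)"
proof -
  have "(\<Sum>p\<in>UNIV. (\<Gamma> p None (Some \<beta>) x - (if p = Some \<beta> then f x else 0)) * g x $ p $ l) = 0" for l
  proof -
    have "(\<Sum>p\<in>UNIV. (\<Gamma> p None (Some \<beta>) x - (if p = Some \<beta> then f x else 0)) * g x $ p $ l)
        = (\<Sum>p\<in>UNIV. \<Gamma> p None (Some \<beta>) x * g x $ p $ l) - f x * g x $ Some \<beta> $ l"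
      by (simp add: left_diff_distrib sum_subtractf if_distrib[of "\<lambda>z. z * _"] cong: if_cong)
    also have "\<dots> = 0"
      unfolding \<Gamma>_lower[OF x] by (cases l) (simp_all add: pd_g_None[OF x] g_SN[OF x] pd_None_g[OF x])
    finally show ?thesis .
  qed
  from g_nondeg[OF x this, of p] show ?thesis by simp
qed

lemma \<Gamma>_N_N: assumes x: "x \<in> C" shows "\<Gamma> p None None x = 0"
  by (rule g_nondeg[OF x]) (simp add: \<Gamma>_lower[OF x] pd_g_None[OF x])

lemma pd_Some_f: "x \<in> C \<Longrightarrow> pd (Some \<alpha>) f x = 0"
  by (simp add: grad_f u_Some)

lemma pd_Some_A: "x \<in> C \<Longrightarrow> pd (Some \<alpha>) A x = 0"
  using grad_A[of x] u_Some[of x] by (metis mult_zero_right)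

lemma const_on_slices:
  assumes "\<And>x. x \<in> C \<Longrightarrow> F differentiable (at x)" "\<And>x \<alpha>. x \<in> C \<Longrightarrow> pd (Some \<alpha>) F x = 0"
    "z \<in> C" "z' \<in> C" "z $ None = z' $ None"
  shows "F z = F z'"
proof (rule pd_zero_imp_eq[OF convex_cube open_cube assms(3,4,1)])
  fix i x assume "x \<in> C" "z $ i \<noteq> z' $ i"
  then show "pd i F x = 0" using assms(2,5) by (cases i) auto
qed

text \<open>The exponent is the time integral of \<open>f\<close>, so that the square of
  \<open>q\<close> satisfies the equation \<open>pd_None_g\<close> of the spatial metric;
  \<open>q 0 = 1\<close> makes \<open>h\<close> the metric of the slice at time 0.\<close>

definition q :: "real \<Rightarrow> real" where "q t = exp (coord_int None f (line t))"

definition h :: "real^'m \<Rightarrow> real^'m^'m" where "h y = (\<chi> \<alpha> \<beta>. g (emb y) $ Some \<alpha> $ Some \<beta>)"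

lemma smooth_log_warp: "smooth_on C (coord_int None f)" by (rule smooth_coord_int[OF smooth_f])

lemma pd_Some_log_warp: "x \<in> C \<Longrightarrow> pd (Some \<alpha>) (coord_int None f) x = 0"
  unfolding pd_coord_int[OF smooth_f]
  using coord_int_cong[of r "pd (Some \<alpha>) f" "\<lambda>_. 0" x None] by (simp add: pd_Some_f) (simp add: coord_int_def)

lemma log_warp_line: assumes "z \<in> C" shows "coord_int None f z = coord_int None f (line (z $ None))"
proof -
  have "line (z $ None) \<in> C" by (rule line_cube) (use assms in \<open>simp add: cube_option\<close>)
  then show ?thesis
    by (intro const_on_slices[OF smooth_on_differentiable[OF smooth_log_warp] pd_Some_log_warp]) (use assms in auto)
qed

text \<open>After multiplication by \<open>exp (- 2 * coord_int None f z)\<close> the spatial metric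
  has vanishing time derivative and equals its value on the slice at time 0, where the exponent
  vanishes.\<close>

lemma g_warped:
  assumes z: "z \<in> C"
  shows "g z $ Some \<alpha> $ Some \<beta> = (q (z $ None))\<^sup>2 * h (space_part z) $ \<alpha> $ \<beta>"
proof -
  let ?G = "\<lambda>z. g z $ Some \<alpha> $ Some \<beta>"
  let ?F = "\<lambda>z. ?G z * exp (- 2 * coord_int None f z)"
  have z0: "set_coord None 0 z \<in> C" using set_coord_cube[OF z, of 0 None] by simp
  have d: "coord_int None f differentiable (at x)" "?G differentiable (at x)" if "x \<in> C" for x
    using smooth_on_differentiable[OF smooth_log_warp that] diff[OF that] by auto
  have d2: "(\<lambda>x. - 2 * coord_int None f x) differentiable (at x)" if "x \<in> C" for x
    by (intro differentiable_mult differentiable_const d that)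
  have "?F z = ?F (set_coord None 0 z)"
  proof (rule pd_zero_imp_eq[OF convex_cube open_cube z z0])
    show "?F differentiable (at x)" if "x \<in> C" for x
      by (intro differentiable_mult differentiable_exp d d2 that)
    fix i x assume x: "x \<in> C" and "z $ i \<noteq> set_coord None 0 z $ i"
    then have i: "i = None" by (auto simp: set_coord_nth split: if_splits)
    have "pd None (\<lambda>x. - 2 * coord_int None f x) x = - 2 * f x"
      using pd_cmult[OF d(1)[OF x], of None "-2"] pd_coord_int[OF smooth_f x, of None None] by simp
    then have "pd None (\<lambda>x. exp (- 2 * coord_int None f x)) x = exp (- 2 * coord_int None f x) * (- 2 * f x)"
      using pd_exp[OF d2[OF x], of None] by simp
    then show "pd i ?F x = 0" unfolding i
      by (subst pd_mult[OF d(2)[OF x] differentiable_exp[OF d2[OF x]]]) (simp add: pd_None_g[OF x])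
  qed
  moreover have "coord_int None f (set_coord None 0 z) = 0" by (rule coord_int_zero) (simp add: set_coord_nth)
  ultimately have "?G z * exp (- 2 * coord_int None f z) = h (space_part z) $ \<alpha> $ \<beta>"
    by (simp add: h_def set_coord_emb)
  moreover have "(q (z $ None))\<^sup>2 * exp (- 2 * coord_int None f z) = 1"
    unfolding q_def log_warp_line[OF z] by (simp add: exp_double[symmetric] exp_minus power2_eq_square mult_exp_exp)
  moreover have "a = b * c" if "a * e = c" "b * e = 1" for a b c e :: real
    using that by (metis mult.assoc mult.commute mult_1)
  ultimately show ?thesis by blast
qed

lemma emb_C: "y \<in> cube r \<Longrightarrow> emb y \<in> C"
  by (rule emb_cube[OF r_pos])

lemma riemannian_h: "riemannian_metric_on (cube r) h"
  unfolding riemannian_metric_on_def smooth_matrix_on_def riemannian_form_def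
proof (intro conjI allI ballI impI)
  show "smooth_on (cube r) (\<lambda>x. h x $ i $ j)" for i j
    unfolding h_def by (simp, rule smooth_on_compose[OF open_cube emb_smooth[OF open_cube] g_smooth emb_C])
  fix y :: "real^'m" assume y: "y \<in> cube r"
  show "transpose (h y) = h y" using g_sym[OF emb_C[OF y]] by (simp add: h_def transpose_def vec_eq_iff)
  fix v :: "real^'m" assume "v \<noteq> 0"
  let ?e = "axis None 1 :: real^'m option"
  have "emb v \<noteq> 0" using \<open>v \<noteq> 0\<close> by (metis emb_nth(2) vec_eq_iff zero_index)
  moreover have "?e \<bullet> (g (emb y) *v ?e) < 0"
    by (simp add: inner_axis' matrix_vector_mult_basis column_def g_NN[OF emb_C[OF y]])
  moreover have "?e \<bullet> (g (emb y) *v emb v) = 0"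
    by (simp add: inner_axis' matrix_vector_mult_def sum_option g_NS[OF emb_C[OF y]])
  ultimately have "0 < emb v \<bullet> (g (emb y) *v emb v)"
    using lorentzian_spacelike[OF g_lor[OF emb_C[OF y]]] by blast
  also have "emb v \<bullet> (g (emb y) *v emb v) = v \<bullet> (h y *v v)"
    by (simp add: inner_vec_def matrix_vector_mult_def sum_option h_def)
  finally show "0 < v \<bullet> (h y *v v)" .
qed

lemma gi_SN: "x \<in> C \<Longrightarrow> gi (Some \<alpha>) None x = 0" and gi_NN: "x \<in> C \<Longrightarrow> gi None None x = -1"
  using gi_g[of x "Some \<alpha>" None] gi_g[of x None None] by (simp_all add: sum_option g_NN g_SN)

lemma ginv_h: assumes y: "y \<in> cube r" shows "ginv h \<alpha> \<beta> y = gi (Some \<alpha>) (Some \<beta>) (emb y)"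
proof -
  have "(\<chi> \<alpha> \<beta>. gi (Some \<alpha>) (Some \<beta>) (emb y)) ** h y = mat 1"
    using gi_g[OF emb_C[OF y], of "Some _" "Some _"]
    by (simp add: matrix_matrix_mult_def mat_def vec_eq_iff sum_option g_NS[OF emb_C[OF y]] h_def)
  from matrix_inv_unique(2)[OF this] show ?thesis by (simp add: ginv_def)
qed

text \<open>The metric and its inverse are block diagonal on the slice, so nothing of the time
  direction enters.\<close>

lemma christoffel_h: assumes y: "y \<in> cube r"
  shows "christoffel h \<gamma> \<alpha> \<beta> y = \<Gamma> (Some \<gamma>) (Some \<alpha>) (Some \<beta>) (emb y)"
proof -
  have "pd i (\<lambda>y. h y $ a $ b) y = pd (Some i) (\<lambda>x. g x $ Some a $ Some b) (emb y)" for i a b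
    unfolding h_def using pd_emb[OF diff(3)[OF emb_C[OF y]]] by simp
  then show ?thesis
    unfolding christoffel_def by (simp add: ginv_h[OF y] sum_option gi_SN[OF emb_C[OF y]])
qed

lemma pd_christoffel_h: assumes y: "y \<in> cube r"
  shows "pd \<delta> (christoffel h \<gamma> \<alpha> \<beta>) y = pd (Some \<delta>) (\<Gamma> (Some \<gamma>) (Some \<alpha>) (Some \<beta>)) (emb y)"
proof -
  have "pd \<delta> (christoffel h \<gamma> \<alpha> \<beta>) y = pd \<delta> (\<lambda>y. \<Gamma> (Some \<gamma>) (Some \<alpha>) (Some \<beta>) (emb y)) y"
    by (rule pd_cong_open[OF open_cube y christoffel_h])
  then show ?thesis using pd_emb[OF diff(2)[OF emb_C[OF y]]] by simp
qed

text \<open>The Gauss equation: the slice is totally umbilic, its second fundamental form being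
  \<open>f\<close> times the metric up to sign. The quadratic term comes from the summation index
  \<open>None\<close>, present in the sums for \<open>g\<close> and absent from those for
  \<open>h\<close>.\<close>

lemma riemann_h: assumes y: "y \<in> cube r"
  defines "x \<equiv> emb y"
  shows "riemann h \<alpha> \<gamma> \<delta> \<beta> y = riemann g (Some \<alpha>) (Some \<gamma>) (Some \<delta>) (Some \<beta>) x
    - (f x)\<^sup>2 * (g x $ Some \<alpha> $ Some \<delta> * g x $ Some \<gamma> $ Some \<beta> - g x $ Some \<gamma> $ Some \<delta> * g x $ Some \<alpha> $ Some \<beta>)"
proof -
  have x: "x \<in> C" using emb_C[OF y] by (simp add: x_def)
  have S: "\<Gamma> p (Some \<beta>) None x = (if p = Some \<beta> then f x else 0)" for p \<beta>
    using \<Gamma>_N_S[OF x] \<Gamma>_sym[OF x] by metis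
  have up: "riemann_up h \<alpha> \<gamma> \<delta> \<pi> y = riemann_up g (Some \<alpha>) (Some \<gamma>) (Some \<delta>) (Some \<pi>) x
    - (f x)\<^sup>2 * (g x $ Some \<alpha> $ Some \<delta> * (if \<pi> = \<gamma> then 1 else 0) - g x $ Some \<gamma> $ Some \<delta> * (if \<pi> = \<alpha> then 1 else 0))" for \<pi>
    unfolding riemann_up_def pd_christoffel_h[OF y] christoffel_h[OF y] x_def[symmetric]
    by (simp add: sum_option \<Gamma>_None[OF x] u_Some[OF x] S power2_eq_square algebra_simps)
  have "riemann h \<alpha> \<gamma> \<delta> \<beta> y = (\<Sum>\<pi>\<in>UNIV. riemann_up g (Some \<alpha>) (Some \<gamma>) (Some \<delta>) (Some \<pi>) x * g x $ Some \<pi> $ Some \<beta>)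
     - (f x)\<^sup>2 * (\<Sum>\<pi>\<in>UNIV. (g x $ Some \<alpha> $ Some \<delta> * (if \<pi> = \<gamma> then 1 else 0) - g x $ Some \<gamma> $ Some \<delta> * (if \<pi> = \<alpha> then 1 else 0)) * g x $ Some \<pi> $ Some \<beta>)"
    unfolding riemann_def up by (simp add: h_def x_def left_diff_distrib right_diff_distrib sum_subtractf sum_distrib_left mult.assoc)
  then show ?thesis
    by (simp add: riemann_def sum_option g_NS[OF x] left_diff_distrib sum_subtractf
        if_distrib[of "\<lambda>z. z * _"] if_distrib[of "\<lambda>z. _ * z"] cong: if_cong)
qed

text \<open>The trace of the Gauss equation over the \<open>n - 1\<close> space directions. The
  curvature of planes containing the time direction, evaluated in \<open>N\<close>, has to be taken
  out of the Ricci tensor of \<open>g\<close>.\<close>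

lemma ricci_h: assumes y: "y \<in> cube r"
  defines "x \<equiv> emb y"
  shows "ricci h \<alpha> \<beta> y = (A x - pd None f x - (n - 1) * (f x)\<^sup>2) * h y $ \<alpha> $ \<beta>"
proof -
  have x: "x \<in> C" using emb_C[OF y] by (simp add: x_def)
  have S: "\<Gamma> p (Some \<beta>) None z = (if p = Some \<beta> then f z else 0)" if "z \<in> C" for p \<beta> z
    using \<Gamma>_N_S[OF that] \<Gamma>_sym[OF that] by metis
  have m: "n - 1 = real CARD('m)" by (simp add: n_def)
  let ?G = "\<lambda>\<alpha> \<beta>. g x $ Some \<alpha> $ Some \<beta>" and ?i = "\<lambda>\<alpha> \<beta>. gi (Some \<alpha>) (Some \<beta>) x"
  have inv: "(\<Sum>\<delta>\<in>UNIV. ?i \<gamma> \<delta> * ?G \<delta> \<beta>) = (if \<gamma> = \<beta> then 1 else 0)" for \<gamma> \<beta>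
    using gi_g[OF x, of "Some \<gamma>" "Some \<beta>"] by (simp add: sum_option g_NS[OF x])
  have up: "riemann_up g (Some \<alpha>) None None (Some \<pi>) x = (if \<pi> = \<alpha> then pd None f x + (f x)\<^sup>2 else 0)" for \<pi>
  proof -
    have "pd None (\<Gamma> (Some \<pi>) (Some \<alpha>) None) x = pd None (\<lambda>x. if \<pi> = \<alpha> then f x else 0) x"
      by (rule pd_cong_open[OF open_cube x]) (simp add: S)
    moreover have "pd (Some \<alpha>) (\<Gamma> (Some \<pi>) None None) x = 0"
      by (rule pd_const_on[OF x \<Gamma>_N_N])
    ultimately show ?thesis
      unfolding riemann_up_def
      by (simp add: \<Gamma>_N_N[OF x] S[OF x] sum_option \<Gamma>_N_S[OF x] power2_eq_square if_distrib[of "\<lambda>z. z * _"] cong: if_cong)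
  qed
  have N: "riemann g (Some \<alpha>) None None (Some \<beta>) x = (pd None f x + (f x)\<^sup>2) * ?G \<alpha> \<beta>"
    unfolding riemann_def by (simp add: sum_option g_NS[OF x] up if_distrib[of "\<lambda>z. z * _"] cong: if_cong)
  define Rs where "Rs = (\<Sum>\<gamma>\<in>UNIV. \<Sum>\<delta>\<in>UNIV. ?i \<gamma> \<delta> * riemann g (Some \<alpha>) (Some \<gamma>) (Some \<delta>) (Some \<beta>) x)"
  have gNS: "gi None (Some \<gamma>) x = 0" for \<gamma> using gi_SN[OF x] gi_sym[OF x] by metis
  have 1: "ricci g (Some \<alpha>) (Some \<beta>) x = (pd None f x + (f x)\<^sup>2) * ?G \<alpha> \<beta> - Rs"
    unfolding ricci_def by (simp add: sum_option gi_SN[OF x] gi_NN[OF x] gNS N Rs_def)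
  have 2: "(\<Sum>\<gamma>\<in>UNIV. \<Sum>\<delta>\<in>UNIV. ?i \<gamma> \<delta> * (?G \<alpha> \<delta> * ?G \<gamma> \<beta>)) = ?G \<alpha> \<beta>"
  proof -
    have "(\<Sum>\<gamma>\<in>UNIV. \<Sum>\<delta>\<in>UNIV. ?i \<gamma> \<delta> * (?G \<alpha> \<delta> * ?G \<gamma> \<beta>)) = (\<Sum>\<gamma>\<in>UNIV. ?G \<gamma> \<beta> * (\<Sum>\<delta>\<in>UNIV. ?i \<gamma> \<delta> * ?G \<delta> \<alpha>))"
      by (simp add: sum_distrib_left g_sym[OF x, of "Some \<alpha>"] mult_ac)
    then show ?thesis unfolding inv by (simp add: sum_delta)
  qed
  have 3: "(\<Sum>\<gamma>\<in>UNIV. \<Sum>\<delta>\<in>UNIV. ?i \<gamma> \<delta> * (?G \<gamma> \<delta> * ?G \<alpha> \<beta>)) = (n - 1) * ?G \<alpha> \<beta>"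
  proof -
    have "(\<Sum>\<gamma>\<in>UNIV. \<Sum>\<delta>\<in>UNIV. ?i \<gamma> \<delta> * (?G \<gamma> \<delta> * ?G \<alpha> \<beta>)) = (\<Sum>\<gamma>\<in>UNIV. (\<Sum>\<delta>\<in>UNIV. ?i \<gamma> \<delta> * ?G \<delta> \<gamma>)) * ?G \<alpha> \<beta>"
      by (simp add: sum_distrib_left g_sym[OF x, of "Some \<alpha>"] mult_ac)
        (simp add: g_sym[OF x] mult_ac)
    then show ?thesis unfolding inv m by simp
  qed
  have "ricci h \<alpha> \<beta> y = - (Rs - (f x)\<^sup>2 * ((\<Sum>\<gamma>\<in>UNIV. \<Sum>\<delta>\<in>UNIV. ?i \<gamma> \<delta> * (?G \<alpha> \<delta> * ?G \<gamma> \<beta>))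
      - (\<Sum>\<gamma>\<in>UNIV. \<Sum>\<delta>\<in>UNIV. ?i \<gamma> \<delta> * (?G \<gamma> \<delta> * ?G \<alpha> \<beta>))))"
    unfolding ricci_def ginv_h[OF y] riemann_h[OF y] x_def[symmetric] Rs_def
    by (simp add: right_diff_distrib sum_subtractf sum_distrib_left mult_ac)
  then have "ricci h \<alpha> \<beta> y = ricci g (Some \<alpha>) (Some \<beta>) x - (pd None f x + (f x)\<^sup>2) * ?G \<alpha> \<beta> + (f x)\<^sup>2 * (?G \<alpha> \<beta> - (n - 1) * ?G \<alpha> \<beta>)"
    unfolding 1 2 3 by simp
  then show ?thesis
    unfolding ricci_fluid[OF x] u_Some[OF x] by (simp add: h_def x_def algebra_simps)
qed

text \<open>The factor in \<open>ricci_h\<close> is constant on the slice: the gradients of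
  \<open>A\<close> and \<open>f\<close> are multiples of \<open>u\<close>, and the space derivatives
  of \<open>pd None f\<close> vanish by exchanging the order of differentiation.\<close>

lemma einstein_h: "einstein_on (cube r) h"
proof -
  define \<mu> where "\<mu> = (\<lambda>x. A x - pd None f x - (n - 1) * (f x)\<^sup>2)"
  have sf: "smooth_on C f" "smooth_on C (pd None f)" by (intro smooth_f smooth_on_pd)+
  have d: "A differentiable (at x)" "pd None f differentiable (at x)" "f differentiable (at x)" if "x \<in> C" for x
    using smooth_on_differentiable[OF _ that] A_smooth sf by blast+
  have "\<mu> (emb y) = \<mu> (emb 0)" if "y \<in> cube r" for y
  proof -
    have e: "emb y \<in> C" "emb 0 \<in> C" using emb_C[OF that] emb_C[of 0] r_pos by (auto simp: cube_def)
    have "pd (Some \<alpha>) (pd None f) x = 0" if "x \<in> C" for x \<alpha>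
      unfolding pd_commute[OF open_cube that smooth_f, of "Some \<alpha>"] by (rule pd_const_on[OF that pd_Some_f])
    note pp = this
    have "A (emb y) = A (emb 0)" by (rule const_on_slices[OF d(1) pd_Some_A e]) auto
    moreover have "pd None f (emb y) = pd None f (emb 0)" by (rule const_on_slices[OF d(2) pp e]) auto
    moreover have "f (emb y) = f (emb 0)" by (rule const_on_slices[OF d(3) pd_Some_f e]) auto
    ultimately show ?thesis by (simp add: \<mu>_def)
  qed
  then have "\<forall>y\<in>cube r. \<forall>\<alpha> \<beta>. ricci h \<alpha> \<beta> y = \<mu> (emb 0) * h y $ \<alpha> $ \<beta>"
    using ricci_h by (simp add: \<mu>_def)
  then show ?thesis unfolding einstein_on_def by blast
qed

lemma smooth_q: "smooth_real_on {-r<..<r} q"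
  unfolding q_def by (rule smooth_real_on_line[OF smooth_on_exp[OF open_cube smooth_log_warp]])

end

section \<open>Charts of the space-time\<close>

text \<open>Congruence by an invertible \<open>P\<close> transports both properties from the
  diagonal matrix \<open>E\<close>, which is symmetric and its own inverse.\<close>

lemma
  fixes G :: "real^'n::finite^'n"
  assumes "lorentzian_form G"
  shows lorentzian_form_sym: "G $ i $ j = G $ j $ i" and lorentzian_form_invertible: "invertible G"
proof -
  obtain P :: "real^'n^'n" and t where P: "invertible P"
    and D: "transpose P ** G ** P = (\<chi> i j. if i = j then (if i = t then -1 else 1) else 0)"
    using assms unfolding lorentzian_form_def by blast
  define E :: "real^'n^'n" where "E = (\<chi> i j. if i = j then (if i = t then -1 else 1) else 0)"
  have "transpose E = E" by (auto simp: E_def transpose_def vec_eq_iff)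
  then have e: "transpose P ** transpose G ** P = transpose P ** G ** P"
    unfolding D[folded E_def] by (metis D E_def matrix_mul_assoc matrix_transpose_mul transpose_transpose)
  have "transpose G = transpose (matrix_inv P) ** (transpose P ** transpose G ** P) ** matrix_inv P"
    by (metis matrix_inv_mult(1)[OF P] matrix_mul_assoc matrix_mul_lid matrix_mul_rid matrix_transpose_mul transpose_mat)
  also have "\<dots> = G" unfolding e
    by (metis matrix_inv_mult(1)[OF P] matrix_mul_assoc matrix_mul_lid matrix_mul_rid matrix_transpose_mul transpose_mat)
  finally have "transpose G $ j $ i = G $ j $ i" by simp
  then show "G $ i $ j = G $ j $ i" by (simp add: transpose_def)
  have "E ** E = mat 1"
    by (auto simp: E_def matrix_matrix_mult_def mat_def vec_eq_iff if_distrib[of "\<lambda>c. c * _"] cong: if_cong)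
  then have "det E \<noteq> 0" by (metis det_I det_mul mult_zero_left zero_neq_one)
  then have "det (transpose P ** G ** P) \<noteq> 0" unfolding D E_def .
  then show "invertible G" by (simp add: det_mul invertible_det_nz)
qed

lemma cinv_cmap: "is_chart c \<Longrightarrow> p \<in> cdom c \<Longrightarrow> cinv c (cmap c p) = p"
  by (simp add: is_chart_def homeomorphism_def)

lemma cmap_cinv: "is_chart c \<Longrightarrow> x \<in> cmap c ` cdom c \<Longrightarrow> cmap c (cinv c x) = x \<and> cinv c x \<in> cdom c"
  by (auto simp: is_chart_def homeomorphism_def)

lemma cmap_image_eq: "is_chart c \<Longrightarrow> cmap c ` (cdom c \<inter> N) = (cmap c ` cdom c) \<inter> cinv c -` N"
  using cinv_cmap cmap_cinv by fastforce

lemma open_cmap_image: "is_chart c \<Longrightarrow> open N \<Longrightarrow> open (cmap c ` (cdom c \<inter> N))"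
  unfolding cmap_image_eq
  by (rule continuous_open_preimage) (auto simp: is_chart_def homeomorphism_def)

lemma open_cmap_preimage: "is_chart c \<Longrightarrow> open W \<Longrightarrow> open (cdom c \<inter> cmap c -` W)"
  by (rule continuous_open_preimage) (auto simp: is_chart_def homeomorphism_def)

locale smooth_manifold =
  fixes atl :: "('a::topological_space, 'n::finite) chart set"
  assumes smooth_str: "smooth_structure atl"
begin

lemma chart: "c \<in> atl \<Longrightarrow> is_chart c" using smooth_str by (simp add: smooth_structure_def)

lemma chart_at: obtains c where "c \<in> atl" "p \<in> cdom c"
  using smooth_str unfolding smooth_structure_def by blast

lemma smooth_transition:
  assumes "c \<in> atl" "c' \<in> atl"
  shows "smooth_on (cmap c ` (cdom c \<inter> cdom c')) (\<lambda>x. transition c c' x $ a)"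
  using smooth_str assms unfolding smooth_structure_def compatible_def smooth_map_on_def by blast

lemma open_overlap: "c \<in> atl \<Longrightarrow> c' \<in> atl \<Longrightarrow> open N \<Longrightarrow> open (cmap c ` (cdom c \<inter> cdom c' \<inter> N))"
  using open_cmap_image[of c "cdom c' \<inter> N"] chart by (simp add: Int_assoc is_chart_def open_Int)

lemma transition_eq:
  assumes "c \<in> atl" "p \<in> cdom c"
  shows "transition c c' (cmap c p) = cmap c' p"
  using cinv_cmap[OF chart] assms by (simp add: transition_def)

lemma pd_transition:
  assumes c: "c \<in> atl" "c' \<in> atl" and p: "p \<in> cdom c" "p \<in> cdom c'" and d: "\<sigma> differentiable (at (cmap c' p))"
  shows "pd k (\<lambda>y. \<sigma> (transition c c' y)) (cmap c p) = (\<Sum>a\<in>UNIV. pd a \<sigma> (cmap c' p) * jacobian c c' (cmap c p) $ a $ k)"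
proof -
  have "(\<lambda>y. transition c c' y $ a) differentiable (at (cmap c p))" for a
    by (rule smooth_on_differentiable[OF smooth_transition[OF c]]) (use p in auto)
  from pd_chain[OF this, of \<sigma> k] d show ?thesis by (simp add: transition_eq[OF c(1) p(1)] jacobian_def)
qed

lemma pd_crep:
  assumes c: "c \<in> atl" "c' \<in> atl" and p: "p \<in> cdom c" "p \<in> cdom c'" and d: "crep c' s differentiable (at (cmap c' p))"
  shows "pd k (crep c s) (cmap c p) = (\<Sum>a\<in>UNIV. pd a (crep c' s) (cmap c' p) * jacobian c c' (cmap c p) $ a $ k)"
proof -
  have "pd k (crep c s) (cmap c p) = pd k (\<lambda>y. crep c' s (transition c c' y)) (cmap c p)"
  proof (rule pd_cong_open)
    show "open (cmap c ` (cdom c \<inter> cdom c'))" using open_overlap[OF c open_UNIV] by simp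
    show "cmap c p \<in> cmap c ` (cdom c \<inter> cdom c')" using p by blast
    fix y assume "y \<in> cmap c ` (cdom c \<inter> cdom c')"
    then obtain z where "y = cmap c z" "z \<in> cdom c" "z \<in> cdom c'" by blast
    then show "crep c s y = crep c' s (transition c c' y)"
      using cinv_cmap[OF chart] c by (simp add: crep_def transition_def)
  qed
  then show ?thesis using pd_transition[OF c p d] by simp
qed

lemma one_form_transform:
  assumes "one_form_on atl N w" "c \<in> atl" "c' \<in> atl" "p \<in> cdom c" "p \<in> cdom c'" "p \<in> N"
  shows "w c (cmap c p) $ k = (\<Sum>a\<in>UNIV. w c' (cmap c' p) $ a * jacobian c c' (cmap c p) $ a $ k)"
proof -
  have "w c (cmap c p) = transpose (jacobian c c' (cmap c p)) *v w c' (cmap c' p)"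
    using assms unfolding one_form_on_def by blast
  then show ?thesis by (simp add: matrix_vector_mult_def transpose_def mult.commute)
qed

lemma one_form_rescale:
  assumes "open N" "scalar_field_on atl N s" "one_form_on atl N w"
  shows "one_form_on atl N (rescale s w)"
  unfolding one_form_on_def
proof (intro conjI ballI)
  fix c assume c: "c \<in> atl"
  show "smooth_map_on (cmap c ` (cdom c \<inter> N)) (rescale s w c)"
    using assms c unfolding smooth_map_on_def rescale_def scalar_field_on_def one_form_on_def
    by (auto intro!: smooth_on_mult open_cmap_image chart)
  fix c' p assume c': "c' \<in> atl" and p: "p \<in> cdom c \<inter> cdom c' \<inter> N"
  have "w c (cmap c p) = transpose (jacobian c c' (cmap c p)) *v w c' (cmap c' p)"
    using assms(3) c c' p unfolding one_form_on_def by blast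
  moreover have "crep c s (cmap c p) = crep c' s (cmap c' p)"
    using cinv_cmap[OF chart] c c' p by (simp add: crep_def)
  ultimately show "rescale s w c (cmap c p) = transpose (jacobian c c' (cmap c p)) *v rescale s w c' (cmap c' p)"
    by (simp add: rescale_def matrix_vector_mult_scaleR)
qed

lemma one_form_on_mono:
  assumes "one_form_on atl UNIV w" shows "one_form_on atl N w"
  unfolding one_form_on_def smooth_map_on_def
proof (intro conjI ballI allI)
  fix c i assume "c \<in> atl"
  then have "smooth_on (cmap c ` (cdom c \<inter> UNIV)) (\<lambda>x. w c x $ i)"
    using assms unfolding one_form_on_def smooth_map_on_def by blast
  then show "smooth_on (cmap c ` (cdom c \<inter> N)) (\<lambda>x. w c x $ i)" by (rule smooth_on_subset) auto
qed (use assms in \<open>unfold one_form_on_def, blast\<close>)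

lemma scalar_field_on_mono:
  assumes "scalar_field_on atl UNIV s" shows "scalar_field_on atl N s"
  unfolding scalar_field_on_def
proof
  fix c assume "c \<in> atl"
  then have "smooth_on (cmap c ` (cdom c \<inter> UNIV)) (crep c s)"
    using assms unfolding scalar_field_on_def by blast
  then show "smooth_on (cmap c ` (cdom c \<inter> N)) (crep c s)" by (rule smooth_on_subset) auto
qed

text \<open>The Poincare lemma gives a potential in one chart. Carried to other charts by the
  transition maps, its gradient obeys the transformation law of one-forms and so agrees with
  \<open>w\<close> there too.\<close>

lemma closed_imp_locally_gradient:
  assumes w: "one_form_on atl UNIV w"
    and closed: "\<And>c x i j. c \<in> atl \<Longrightarrow> x \<in> cmap c ` cdom c \<Longrightarrow> pd i (\<lambda>x. w c x $ j) x = pd j (\<lambda>x. w c x $ i) x"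
  shows "locally_gradient atl w"
  unfolding locally_gradient_def
proof
  fix p
  obtain c where c: "c \<in> atl" "p \<in> cdom c" by (rule chart_at)
  have "open (cmap c ` cdom c)" using chart[OF c(1)] by (simp add: is_chart_def)
  then obtain e where e: "e > 0" "ball (cmap c p) e \<subseteq> cmap c ` cdom c" using c(2) openE by blast
  define U where "U = ball (cmap c p) e"
  have sw: "smooth_on U (\<lambda>x. w c x $ i)" for i
    using w c(1) smooth_on_subset[OF _ e(2)] unfolding one_form_on_def smooth_map_on_def U_def by auto
  have U: "open U" "convex U" "cmap c p \<in> U" using e(1) by (simp_all add: U_def)
  have cl: "pd i (\<lambda>x. w c x $ j) x = pd j (\<lambda>x. w c x $ i) x" if "x \<in> U" for x i j
    using closed[OF c(1)] e(2) that unfolding U_def by blast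
  obtain \<sigma> where \<sigma>: "smooth_on U \<sigma>" "\<And>x i. x \<in> U \<Longrightarrow> pd i \<sigma> x = w c x $ i" "\<sigma> (cmap c p) = 0"
    using closed_form_exact[where w = "\<lambda>i x. w c x $ i", OF U sw cl] by blast
  define N where "N = cdom c \<inter> cmap c -` U"
  have N: "open N" unfolding N_def by (rule open_cmap_preimage[OF chart[OF c(1)]]) (simp add: U_def)
  define s where "s = \<sigma> \<circ> cmap c"
  have crep_s: "crep c' s = (\<lambda>y. \<sigma> (transition c' c y))" for c'
    by (simp add: crep_def s_def transition_def fun_eq_iff)
  have "scalar_field_on atl N s" unfolding scalar_field_on_def crep_s
  proof
    fix c' assume c': "c' \<in> atl"
    have Neq: "cdom c' \<inter> N = cdom c' \<inter> cdom c \<inter> N" by (auto simp: N_def)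
    show "smooth_on (cmap c' ` (cdom c' \<inter> N)) (\<lambda>y. \<sigma> (transition c' c y))"
    proof (rule smooth_on_compose[OF _ _ \<sigma>(1)])
      show "open (cmap c' ` (cdom c' \<inter> N))" unfolding Neq by (rule open_overlap[OF c' c(1) N])
      show "smooth_on (cmap c' ` (cdom c' \<inter> N)) (\<lambda>y. transition c' c y $ a)" for a
        by (rule smooth_on_subset[OF smooth_transition[OF c' c(1)]]) (auto simp: N_def)
      show "transition c' c y \<in> U" if "y \<in> cmap c' ` (cdom c' \<inter> N)" for y
      proof -
        obtain p' where "y = cmap c' p'" "p' \<in> cdom c'" "p' \<in> N" using \<open>y \<in> _\<close> by blast
        then show ?thesis using transition_eq[OF c', of p' c] by (simp add: N_def)
      qed
    qed
  qed
  moreover have "gradient_on atl N s w" unfolding gradient_on_def crep_s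
  proof (intro ballI allI)
    fix c' x k assume c': "c' \<in> atl" and "x \<in> cmap c' ` (cdom c' \<inter> N)"
    then obtain p' where p': "x = cmap c' p'" "p' \<in> cdom c'" "p' \<in> cdom c" "cmap c p' \<in> U" by (auto simp: N_def)
    have "pd k (\<lambda>y. \<sigma> (transition c' c y)) x = (\<Sum>a\<in>UNIV. w c (cmap c p') $ a * jacobian c' c x $ a $ k)"
      unfolding p'(1) using pd_transition[OF c' c(1) p'(2,3) smooth_on_differentiable[OF \<sigma>(1) p'(4)]] \<sigma>(2)[OF p'(4)] by simp
    then show "pd k (\<lambda>y. \<sigma> (transition c' c y)) x = w c' x $ k"
      using one_form_transform[OF w c' c(1) p'(2,3)] p'(1) by simp
  qed
  moreover have "p \<in> N" using c(2) e(1) by (simp add: N_def U_def)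
  ultimately show "\<exists>N s. open N \<and> p \<in> N \<and> scalar_field_on atl N s \<and> gradient_on atl N s w" using N by blast
qed

text \<open>Maximality of the atlas is what admits new coordinates: a chart composed with a
  diffeomorphism remains compatible with the other charts.\<close>

lemma reparametrised_chart:
  assumes c: "c \<in> atl" and W: "open W" "W \<subseteq> cmap c ` cdom c" and Z: "open Z"
    and hom: "homeomorphism Z W \<psi> \<theta>" and s\<psi>: "\<And>i. smooth_on Z (\<lambda>z. \<psi> z $ i)" and s\<theta>: "\<And>i. smooth_on W (\<lambda>x. \<theta> x $ i)"
  defines "c' \<equiv> (cdom c \<inter> cmap c -` W, \<theta> \<circ> cmap c)"
  shows "c' \<in> atl" and "cmap c' ` cdom c' = Z" and "\<And>z. z \<in> Z \<Longrightarrow> transition c' c z = \<psi> z"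
proof -
  note ch = chart[OF c]
  have H: "\<And>z. z \<in> Z \<Longrightarrow> \<theta> (\<psi> z) = z" "\<And>x. x \<in> W \<Longrightarrow> \<psi> (\<theta> x) = x" "\<psi> ` Z = W" "\<theta> ` W = Z"
    "continuous_on Z \<psi>" "continuous_on W \<theta>"
    using hom by (auto simp: homeomorphism_def)
  have dom: "cdom c' = cdom c \<inter> cmap c -` W" and map: "cmap c' p = \<theta> (cmap c p)" for p
    by (simp_all add: c'_def cdom_def cmap_def)
  have cW: "cmap c ` cdom c' = W"
    unfolding dom using W(2) by auto
  show im: "cmap c' ` cdom c' = Z"
  proof -
    have "cmap c' ` cdom c' = \<theta> ` (cmap c ` cdom c')" by (auto simp: map)
    then show ?thesis using cW H(4) by simp
  qed
  have zc: "cinv c (\<psi> z) \<in> cdom c'" "cmap c' (cinv c (\<psi> z)) = z" if "z \<in> Z" for z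
  proof -
    have "\<psi> z \<in> W" using that H(3) by blast
    then show "cinv c (\<psi> z) \<in> cdom c'" "cmap c' (cinv c (\<psi> z)) = z"
      using cmap_cinv[OF ch, of "\<psi> z"] W(2) H(1)[OF that] by (auto simp: dom map)
  qed
  have inj: "inj_on (cmap c') (cdom c')"
  proof (rule inj_onI)
    fix p p' assume h: "p \<in> cdom c'" "p' \<in> cdom c'" "cmap c' p = cmap c' p'"
    then have "cmap c p = cmap c p'" using H(2) by (metis Int_iff dom map vimage_eq)
    then show "p = p'" using h cinv_cmap[OF ch] by (metis Int_iff dom)
  qed
  have cinv': "cinv c' z = cinv c (\<psi> z)" if "z \<in> Z" for z
    unfolding cinv_def[of c'] by (rule inv_into_f_eq[OF inj zc[OF that]])
  show tr: "transition c' c z = \<psi> z" if "z \<in> Z" for z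
  proof -
    have "\<psi> z \<in> cmap c ` cdom c" using that H(3) W(2) by blast
    then show ?thesis using cmap_cinv[OF ch] by (simp add: transition_def cinv'[OF that])
  qed
  have ic: "is_chart c'"
    unfolding is_chart_def im homeomorphism_def
  proof (intro conjI ballI)
    show "open (cdom c')" unfolding dom by (rule open_cmap_preimage[OF ch W(1)])
    show "open Z" by (rule Z)
    show "Z = Z" ..
    show "cinv c' (cmap c' p) = p" if "p \<in> cdom c'" for p
      using inj that by (simp add: cinv_def)
    then show "cinv c' ` Z = cdom c'" using im by force
    show "cmap c' (cinv c' z) = z" if "z \<in> Z" for z using zc[OF that] cinv'[OF that] by simp
    have "continuous_on (cdom c') (cmap c)"
      using ch continuous_on_subset[of "cdom c" "cmap c" "cdom c'"] by (auto simp: is_chart_def homeomorphism_def dom)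
    then have "continuous_on (cdom c') (\<lambda>p. \<theta> (cmap c p))"
      by (rule continuous_on_compose2[OF H(6)]) (use cW in auto)
    then show "continuous_on (cdom c') (cmap c')" by (simp add: map cong: continuous_on_cong)
    have "continuous_on Z (\<lambda>z. cinv c (\<psi> z))"
      by (rule continuous_on_compose2[OF _ H(5), of "cmap c ` cdom c"])
        (use ch H(3) W(2) in \<open>auto simp: is_chart_def homeomorphism_def\<close>)
    then show "continuous_on Z (cinv c')" by (rule continuous_on_eq) (simp add: cinv')
  qed
  have "compatible c' c''" if c'': "c'' \<in> atl" for c''
    unfolding compatible_def smooth_map_on_def
  proof (intro conjI allI)
    have o: "open (cdom c'')" "open (cdom c')" using chart[OF c''] ic by (auto simp: is_chart_def)
    have sub: "cmap c' ` (cdom c' \<inter> cdom c'') \<subseteq> Z" using im by blast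
    have op: "open (cmap c' ` (cdom c' \<inter> cdom c''))" by (rule open_cmap_image[OF ic o(1)])
    fix i
    have into: "\<psi> z \<in> cmap c ` (cdom c \<inter> cdom c'')" if "z \<in> cmap c' ` (cdom c' \<inter> cdom c'')" for z
    proof -
      obtain p where p: "z = cmap c' p" "p \<in> cdom c'" "p \<in> cdom c''"
        using \<open>z \<in> cmap c' ` (cdom c' \<inter> cdom c'')\<close> by blast
      then have "p \<in> cdom c" "\<psi> z = cmap c p" using H(2)[of "cmap c p"] by (simp_all add: dom map)
      then show ?thesis using p(3) by blast
    qed
    have "smooth_on (cmap c' ` (cdom c' \<inter> cdom c'')) (\<lambda>z. transition c c'' (\<psi> z) $ i)"
      by (rule smooth_on_compose[OF op smooth_on_subset[OF s\<psi> sub] smooth_transition[OF c c''] into])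
    then show "smooth_on (cmap c' ` (cdom c' \<inter> cdom c'')) (\<lambda>z. transition c' c'' z $ i)"
      by (subst smooth_on_cong[OF op, where g = "\<lambda>z. transition c c'' (\<psi> z) $ i"])
        (use sub cinv' in \<open>auto simp: transition_def subset_iff\<close>)
    have op2: "open (cmap c'' ` (cdom c' \<inter> cdom c''))"
      using open_cmap_image[OF chart[OF c''] o(2)] by (simp add: Int_commute)
    have sub2: "cmap c'' ` (cdom c' \<inter> cdom c'') \<subseteq> cmap c'' ` (cdom c'' \<inter> cdom c)" by (auto simp: dom)
    have into2: "transition c'' c y \<in> W" if "y \<in> cmap c'' ` (cdom c' \<inter> cdom c'')" for y
    proof -
      obtain p where "y = cmap c'' p" "p \<in> cdom c''" "p \<in> cdom c'" using \<open>y \<in> _\<close> by blast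
      then show ?thesis using transition_eq[OF c'', of p c] by (simp add: dom)
    qed
    have "smooth_on (cmap c'' ` (cdom c' \<inter> cdom c'')) (\<lambda>y. \<theta> (transition c'' c y) $ i)"
      by (rule smooth_on_compose[OF op2 smooth_on_subset[OF smooth_transition[OF c'' c] sub2] s\<theta> into2])
    then show "smooth_on (cmap c'' ` (cdom c' \<inter> cdom c'')) (\<lambda>y. transition c'' c' y $ i)"
      by (simp add: transition_def map)
  qed
  then show "c' \<in> atl" using smooth_str ic unfolding smooth_structure_def by blast
qed

end

text \<open>A point with \<open>F p \<noteq> 0\<close> would have a neighbourhood of such points,
  which meets the dense set where \<open>B\<close> is nonzero.\<close>

lemma continuous_zero_of_dense:
  fixes F :: "'a::topological_space \<Rightarrow> real"
  assumes "open U" "continuous_on U F" "\<And>p. p \<in> U \<Longrightarrow> B p \<noteq> 0 \<Longrightarrow> F p = 0" "closure {p. B p \<noteq> (0::real)} = UNIV" "p \<in> U"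
  shows "F p = 0"
proof (rule ccontr)
  assume "F p \<noteq> 0"
  have "open (U \<inter> F -` (- {0}))" by (rule continuous_open_preimage[OF assms(2,1)]) auto
  moreover have "U \<inter> F -` (- {0}) \<inter> {p. B p \<noteq> 0} = {}" using assms(3) by auto
  ultimately have "U \<inter> F -` (- {0}) \<inter> closure {p. B p \<noteq> 0} = {}" by (simp add: open_Int_closure_eq_empty)
  then show False using assms(4,5) \<open>F p \<noteq> 0\<close> by auto
qed

section \<open>The fluid space-time as a whole\<close>

locale fluid_spacetime = smooth_manifold atl for atl :: "('a::topological_space, 'n::finite) chart set" +
  fixes g :: "('a, 'n) two_tensor" and u :: "('a, 'n) one_form" and A B :: "'a \<Rightarrow> real" and n :: real
  assumes n_def: "n = real CARD('n)" and dim: "n > 3"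
    and lorentz: "lorentzian_manifold atl g"
    and fluid: "perfect_fluid atl g A B u"
    and nondegenerate: "closure {p. B p \<noteq> 0} = UNIV"
    and closed: "closed_one_form atl g u"
    and weyl: "div_free_weyl atl g"
begin

abbreviation "rng c \<equiv> cmap c ` cdom c"

lemma u_form: "one_form_on atl UNIV u" and A_field: "scalar_field_on atl UNIV A" and B_field: "scalar_field_on atl UNIV B"
  using fluid by (auto simp: perfect_fluid_def)

lemma fluid_chart:
  assumes c: "c \<in> atl"
  shows "chart_fluid (rng c) (g c) (u c) (crep c A) (crep c B) n"
proof -
  have lf: "lorentzian_form (g c x)" if "x \<in> rng c" for x
    using lorentz c that unfolding lorentzian_manifold_def by blast
  show ?thesis
  proof unfold_locales
    show "open (rng c)" using chart[OF c] by (simp add: is_chart_def)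
    show "smooth_on (rng c) (\<lambda>x. g c x $ i $ j)" for i j
      using lorentz c unfolding lorentzian_manifold_def two_tensor_on_def smooth_matrix_on_def by auto
    show "g c x $ i $ j = g c x $ j $ i" if "x \<in> rng c" for x i j by (rule lorentzian_form_sym[OF lf[OF that]])
    show "invertible (g c x)" if "x \<in> rng c" for x by (rule lorentzian_form_invertible[OF lf[OF that]])
    show "smooth_on (rng c) (\<lambda>x. u c x $ i)" for i
      using u_form c unfolding one_form_on_def smooth_map_on_def by auto
    show "smooth_on (rng c) (crep c A)" "smooth_on (rng c) (crep c B)"
      using A_field B_field c unfolding scalar_field_on_def by auto
    show "sq_norm (g c) (u c) x = -1" "ricci (g c) k l x = crep c A x * g c x $ k $ l + crep c B x * u c x $ k * u c x $ l"
      if "x \<in> rng c" for x k l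
      using fluid c that unfolding perfect_fluid_def by blast+
    show "cov1 (g c) k (u c) j x - cov1 (g c) j (u c) k x = 0" if "x \<in> rng c" for x k j
      using closed c that unfolding closed_one_form_def by blast
    show "div_weyl (g c) j k l x = 0" if "x \<in> rng c" for x j k l
      using weyl c that unfolding div_free_weyl_def by blast
    show "n = real CARD('n)" "n > 3" by (rule n_def dim)+
  qed
qed

abbreviation "fc c \<equiv> chart_fluid.f (g c) (u c) n"

lemma continuous_chart: "c \<in> atl \<Longrightarrow> smooth_on (rng c) F \<Longrightarrow> continuous_on (cdom c) (\<lambda>p. F (cmap c p))"
  using chart[of c] by (auto simp: is_chart_def homeomorphism_def intro!: continuous_on_compose2[OF smooth_on_continuous])

lemma torse_chart:
  assumes c: "c \<in> atl"
  shows "chart_torse (rng c) (g c) (u c) (crep c A) (crep c B) n"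
proof -
  interpret ch: chart_fluid "rng c" "g c" "u c" "crep c A" "crep c B" n by (rule fluid_chart[OF c])
  show ?thesis
  proof unfold_locales
    fix x j l assume "x \<in> rng c"
    then obtain p where p: "p \<in> cdom c" "x = cmap c p" by blast
    let ?F = "\<lambda>x. cov1 (g c) j (u c) l x - fc c x * (g c x $ j $ l + u c x $ j * u c x $ l)"
    have "?F (cmap c p) = 0"
    proof (rule continuous_zero_of_dense[OF _ _ _ nondegenerate p(1)])
      show "open (cdom c)" using chart[OF c] by (simp add: is_chart_def)
      show "continuous_on (cdom c) (\<lambda>p. ?F (cmap c p))"
        by (intro continuous_chart[OF c] smooth_intros ch.D_open ch.smooth_cov1 ch.smooth_f ch.g_smooth ch.u_smooth)
      fix p' assume p': "p' \<in> cdom c" "B p' \<noteq> 0"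
      then have "crep c B (cmap c p') \<noteq> 0" using cinv_cmap[OF chart[OF c]] by (simp add: crep_def)
      then show "?F (cmap c p') = 0" using ch.B_cov_u[of "cmap c p'" j l] p'(1) by simp
    qed
    then show "cov1 (g c) j (u c) l x = fc c x * (g c x $ j $ l + u c x $ j * u c x $ l)" by (simp add: p(2))
  qed
qed

text \<open>
  By \<open>grad_S\<close> the product \<open>B f\<close> is the ratio of two covectors, so the transformation law of the
  Christoffel symbols is not needed here.
\<close>
lemma fc_overlap:
  assumes c: "c \<in> atl" "c' \<in> atl" and p: "p \<in> cdom c" "p \<in> cdom c'"
  shows "fc c (cmap c p) = fc c' (cmap c' p)"
proof -
  interpret ch: chart_fluid "rng c" "g c" "u c" "crep c A" "crep c B" n by (rule fluid_chart[OF c(1)])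
  interpret ch': chart_fluid "rng c'" "g c'" "u c'" "crep c' A" "crep c' B" n by (rule fluid_chart[OF c(2)])
  have "fc c (cmap c p) - fc c' (cmap c' p) = 0"
  proof (rule continuous_zero_of_dense[where U = "cdom c \<inter> cdom c'", OF _ _ _ nondegenerate])
    show "open (cdom c \<inter> cdom c')" using chart[OF c(1)] chart[OF c(2)] by (auto simp: is_chart_def)
    show "continuous_on (cdom c \<inter> cdom c') (\<lambda>p. fc c (cmap c p) - fc c' (cmap c' p))"
      using continuous_chart[OF c(1) ch.smooth_f] continuous_chart[OF c(2) ch'.smooth_f]
      by (intro continuous_on_diff) (auto intro: continuous_on_subset)
    fix p assume "p \<in> cdom c \<inter> cdom c'" and B: "B p \<noteq> 0"
    then have p: "p \<in> cdom c" "p \<in> cdom c'" and x: "cmap c p \<in> rng c" "cmap c' p \<in> rng c'" by auto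
    have cB: "crep c B (cmap c p) = B p" "crep c' B (cmap c' p) = B p"
      using cinv_cmap[OF chart] c p by (auto simp: crep_def)
    have d: "crep c' A differentiable (at (cmap c' p))" "crep c' B differentiable (at (cmap c' p))"
      using smooth_on_differentiable[OF ch'.A_smooth x(2)] smooth_on_differentiable[OF ch'.B_smooth x(2)] by auto
    let ?J = "jacobian c c' (cmap c p)"
    have "B p * fc c (cmap c p) * u c (cmap c p) $ k = B p * fc c' (cmap c' p) * u c (cmap c p) $ k" for k
    proof -
      have "B p * fc c (cmap c p) * u c (cmap c p) $ k = ((n - 2) * pd k (crep c A) (cmap c p) + pd k (crep c B) (cmap c p)) / (2 * (n - 1))"
        using ch.grad_S[OF x(1), of k] cB by simp
      also have "\<dots> = (\<Sum>a\<in>UNIV. ((n - 2) * pd a (crep c' A) (cmap c' p) + pd a (crep c' B) (cmap c' p)) / (2 * (n - 1)) * ?J $ a $ k)"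
        unfolding pd_crep[OF c p d(1)] pd_crep[OF c p d(2)]
        by (simp add: sum_distrib_left sum_divide_distrib sum.distrib add_divide_distrib distrib_right mult.assoc)
      also have "\<dots> = B p * fc c' (cmap c' p) * (\<Sum>a\<in>UNIV. u c' (cmap c' p) $ a * ?J $ a $ k)"
        unfolding ch'.grad_S[OF x(2)] cB by (simp add: sum_distrib_left mult_ac)
      also have "\<dots> = B p * fc c' (cmap c' p) * u c (cmap c p) $ k"
        using one_form_transform[OF u_form c p, of k] by simp
      finally show ?thesis .
    qed
    \<comment> \<open>A covector of norm -1 has a nonzero component; the equation can be divided by
      it and by \<open>B p\<close>.\<close>
    moreover have "\<exists>k. u c (cmap c p) $ k \<noteq> 0"
    proof (rule ccontr)
      assume "\<not> ?thesis"
      then show False using ch.norm_u[OF x(1)] by (simp add: sq_norm_def)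
    qed
    ultimately show "fc c (cmap c p) - fc c' (cmap c' p) = 0" using B by auto
  qed (use p in auto)
  then show ?thesis by simp
qed

text \<open>By \<open>fc_overlap\<close> any chart around the point serves; the choice only turns
  the chartwise scalars into a function on the manifold.\<close>

definition F :: "'a \<Rightarrow> real" where
  "F p = (let c = SOME c. c \<in> atl \<and> p \<in> cdom c in fc c (cmap c p))"

lemma F_eq: assumes "c \<in> atl" "p \<in> cdom c" shows "F p = fc c (cmap c p)"
proof -
  have "(SOME c. c \<in> atl \<and> p \<in> cdom c) \<in> atl \<and> p \<in> cdom (SOME c. c \<in> atl \<and> p \<in> cdom c)"
    by (rule someI[of _ c]) (use assms in blast)
  then show ?thesis unfolding F_def Let_def using fc_overlap assms by blast
qed

lemma crep_F: "c \<in> atl \<Longrightarrow> x \<in> rng c \<Longrightarrow> crep c F x = fc c x"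
  using cmap_cinv[OF chart, of c x] F_eq[of c "cinv c x"] by (simp add: crep_def)

lemma F_field: "scalar_field_on atl UNIV F"
  unfolding scalar_field_on_def
proof
  fix c assume c: "c \<in> atl"
  interpret ch: chart_fluid "rng c" "g c" "u c" "crep c A" "crep c B" n by (rule fluid_chart[OF c])
  show "smooth_on (cmap c ` (cdom c \<inter> UNIV)) (crep c F)"
    using smooth_on_cong[OF ch.D_open crep_F[OF c]] ch.smooth_f by simp
qed

definition \<omega> :: "('a, 'n) one_form" where "\<omega> = rescale F u"

lemma \<omega>_eq: "c \<in> atl \<Longrightarrow> x \<in> rng c \<Longrightarrow> \<omega> c x $ k = fc c x * u c x $ k"
  by (simp add: \<omega>_def rescale_def crep_F)

lemma \<omega>_form: "one_form_on atl UNIV \<omega>"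
  unfolding \<omega>_def by (rule one_form_rescale[OF open_UNIV F_field u_form])

lemma pd_u_sym:
  assumes "c \<in> atl" "x \<in> rng c"
  shows "pd i (\<lambda>x. u c x $ j) x = pd j (\<lambda>x. u c x $ i) x"
proof -
  interpret ch: chart_fluid "rng c" "g c" "u c" "crep c A" "crep c B" n by (rule fluid_chart[OF assms(1)])
  show ?thesis using ch.cov_u_sym[OF assms(2), of i j] by (simp add: cov1_def ch.\<Gamma>_sym[OF assms(2), of _ i j])
qed

text \<open>For \<open>\<omega> = f u\<close> the torse-forming equation is \<open>cov_u\<close>
  rearranged. The form is closed since \<open>u\<close> is and since the gradient of
  \<open>f\<close> is a multiple of \<open>u\<close>, so that its antisymmetrised product with
  \<open>u\<close> vanishes.\<close>

lemma concircular_u: "concircular atl g u \<omega> F"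
  unfolding concircular_def torse_forming_def
proof (intro conjI ballI allI u_form \<omega>_form F_field closed_imp_locally_gradient)
  fix c x assume c: "c \<in> atl" and x: "x \<in> rng c"
  interpret ch: chart_torse "rng c" "g c" "u c" "crep c A" "crep c B" n by (rule torse_chart[OF c])
  show "cov1 (g c) k (u c) j x = \<omega> c x $ k * u c x $ j + crep c F x * g c x $ j $ k" for k j
    by (simp add: \<omega>_eq[OF c x] crep_F[OF c x] ch.cov_u[OF x] ch.g_sym[OF x, of k] algebra_simps)
  have fd: "fc c differentiable (at x)" by (rule smooth_on_differentiable[OF ch.smooth_f x])
  have p: "pd i (\<lambda>x. \<omega> c x $ j) x = pd i (fc c) x * u c x $ j + fc c x * pd i (\<lambda>x. u c x $ j) x" for i j
  proof -
    have "pd i (\<lambda>x. \<omega> c x $ j) x = pd i (\<lambda>x. fc c x * u c x $ j) x"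
      by (rule pd_cong_open[OF ch.D_open x \<omega>_eq[OF c]])
    then show ?thesis by (simp add: pd_mult[OF fd ch.udiff[OF x]])
  qed
  show "pd i (\<lambda>x. \<omega> c x $ j) x = pd j (\<lambda>x. \<omega> c x $ i) x" for i j
    unfolding p ch.grad_f[OF x] pd_u_sym[OF c x, of i j] by simp
qed

context
  fixes N :: "'a set" and \<sigma> :: "'a \<Rightarrow> real"
  assumes N: "open N" and \<sigma>: "scalar_field_on atl N \<sigma>" "gradient_on atl N \<sigma> \<omega>"
begin

abbreviation "X \<equiv> rescale (\<lambda>p. exp (- \<sigma> p)) u"
abbreviation "\<rho> \<equiv> \<lambda>p. exp (- \<sigma> p) * F p"

lemma crep_exp: "crep c (\<lambda>p. exp (- \<sigma> p)) = (\<lambda>x. exp (- crep c \<sigma> x))"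
  by (simp add: crep_def fun_eq_iff)

lemma exp_field: "scalar_field_on atl N (\<lambda>p. exp (- \<sigma> p))"
  using \<sigma>(1) unfolding scalar_field_on_def crep_exp
  by (auto intro!: smooth_on_exp smooth_on_minus open_cmap_image chart N)

lemma X_form: "one_form_on atl N X"
  by (rule one_form_rescale[OF N exp_field one_form_on_mono[OF u_form]])

lemma \<rho>_field: "scalar_field_on atl N \<rho>"
  unfolding scalar_field_on_def
proof
  fix c assume c: "c \<in> atl"
  have "smooth_on (cmap c ` (cdom c \<inter> N)) (\<lambda>x. crep c (\<lambda>p. exp (- \<sigma> p)) x * crep c F x)"
    using exp_field scalar_field_on_mono[OF F_field, of N] c unfolding scalar_field_on_def
    by (intro smooth_on_mult open_cmap_image chart N) auto
  then show "smooth_on (cmap c ` (cdom c \<inter> N)) (crep c \<rho>)"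
    by (simp add: crep_def comp_def)
qed

text \<open>The gradient of \<open>exp (- \<sigma>)\<close> cancels the part of
  \<open>\<nabla>u\<close> along \<open>u\<close> and leaves a multiple of \<open>g\<close>; in the
  gradient of \<open>\<rho>\<close> it cancels the quadratic term in \<open>f\<close> from
  \<open>grad_f\<close>.\<close>

lemma
  assumes c: "c \<in> atl" and x: "x \<in> cmap c ` (cdom c \<inter> N)"
  shows cov_X: "cov1 (g c) k (X c) j x = crep c \<rho> x * g c x $ k $ j"
    and grad_\<rho>: "pd k (crep c \<rho>) x = (crep c A x - crep c B x) / (1 - n) * X c x $ k"
    and norm_X: "sq_norm (g c) (X c) x < 0"
proof -
  interpret ch: chart_torse "rng c" "g c" "u c" "crep c A" "crep c B" n by (rule torse_chart[OF c])
  have xr: "x \<in> rng c" using x by blast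
  let ?e = "\<lambda>x. exp (- crep c \<sigma> x)"
  have \<sigma>d: "crep c \<sigma> differentiable (at x)"
    using \<sigma>(1) c x unfolding scalar_field_on_def by (blast intro: smooth_on_differentiable)
  have \<sigma>p: "pd k (crep c \<sigma>) x = fc c x * u c x $ k" for k
  proof -
    have "pd k (crep c \<sigma>) x = \<omega> c x $ k" using \<sigma>(2) c x unfolding gradient_on_def by blast
    then show ?thesis by (simp add: \<omega>_eq[OF c xr])
  qed
  have ed: "?e differentiable (at x)" by (intro differentiable_exp differentiable_minus \<sigma>d)
  have ep: "pd k ?e x = - ?e x * (fc c x * u c x $ k)" for k
    using pd_exp[OF differentiable_minus[OF \<sigma>d], of k] by (simp add: pd_minus[OF \<sigma>d] \<sigma>p)
  have Xc: "X c = (\<lambda>x. ?e x *\<^sub>R u c x)" by (simp add: rescale_def crep_exp fun_eq_iff)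
  have \<rho>x: "crep c \<rho> y = ?e y * fc c y" if "y \<in> rng c" for y
    using crep_F[OF c that] by (simp add: crep_def)
  have pm: "pd k (\<lambda>y. (?e y *\<^sub>R u c y) $ j) x = pd k ?e x * u c x $ j + ?e x * pd k (\<lambda>y. u c y $ j) x"
    using pd_mult[OF ed ch.udiff[OF xr]] by simp
  have "cov1 (g c) k (X c) j x = pd k ?e x * u c x $ j + ?e x * cov1 (g c) k (u c) j x"
    unfolding cov1_def Xc pm by (simp add: right_diff_distrib sum_distrib_left mult_ac)
  also have "\<dots> = crep c \<rho> x * g c x $ k $ j"
    unfolding ep ch.cov_u[OF xr] \<rho>x[OF xr] by (simp add: algebra_simps)
  finally show "cov1 (g c) k (X c) j x = crep c \<rho> x * g c x $ k $ j" .
  have fd: "fc c differentiable (at x)" by (rule smooth_on_differentiable[OF ch.smooth_f xr])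
  have "pd k (crep c \<rho>) x = pd k (\<lambda>x. ?e x * fc c x) x" by (rule pd_cong_open[OF ch.D_open xr \<rho>x])
  also have "\<dots> = (crep c A x - crep c B x) / (1 - n) * (?e x * u c x $ k)"
    unfolding pd_mult[OF ed fd] ep ch.grad_f[OF xr] by (simp add: power2_eq_square algebra_simps)
  finally show "pd k (crep c \<rho>) x = (crep c A x - crep c B x) / (1 - n) * X c x $ k" by (simp add: Xc)
  have "sq_norm (g c) (X c) x = ?e x * ?e x * sq_norm (g c) (u c) x"
    unfolding sq_norm_def Xc by (simp add: sum_distrib_left mult_ac)
  then show "sq_norm (g c) (X c) x < 0" unfolding ch.norm_u[OF xr] by simp
qed

lemma conformal_killing_X:
  "\<exists>\<rho>. timelike_on atl g N X \<and> conformal_killing_on atl g N X \<rho> \<and>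
     (\<forall>c\<in>atl. \<forall>x \<in> cmap c ` (cdom c \<inter> N). \<forall>k j. cov1 (g c) k (X c) j x = crep c \<rho> x * g c x $ k $ j) \<and>
     gradient_on atl N \<rho> (rescale (\<lambda>p. (A p - B p) / (1 - n)) X)"
proof (intro exI[of _ \<rho>] conjI)
  show "timelike_on atl g N X" unfolding timelike_on_def using norm_X by blast
  show "\<forall>c\<in>atl. \<forall>x \<in> cmap c ` (cdom c \<inter> N). \<forall>k j. cov1 (g c) k (X c) j x = crep c \<rho> x * g c x $ k $ j"
    using cov_X by blast
  show "conformal_killing_on atl g N X \<rho>" unfolding conformal_killing_on_def
  proof (intro conjI X_form \<rho>_field ballI allI)
    fix c x i j assume c: "c \<in> atl" and x: "x \<in> cmap c ` (cdom c \<inter> N)"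
    interpret ch: chart_fluid "rng c" "g c" "u c" "crep c A" "crep c B" n by (rule fluid_chart[OF c])
    have "g c x $ j $ i = g c x $ i $ j" by (rule ch.g_sym) (use x in blast)
    then show "cov1 (g c) i (X c) j x + cov1 (g c) j (X c) i x = 2 * crep c \<rho> x * g c x $ i $ j"
      by (simp add: cov_X[OF c x])
  qed
  show "gradient_on atl N \<rho> (rescale (\<lambda>p. (A p - B p) / (1 - n)) X)"
    unfolding gradient_on_def
  proof (intro ballI allI)
    fix c x k assume c: "c \<in> atl" and x: "x \<in> cmap c ` (cdom c \<inter> N)"
    have "rescale (\<lambda>p. (A p - B p) / (1 - n)) X c x $ k = (crep c A x - crep c B x) / (1 - n) * X c x $ k"
      unfolding rescale_def[of _ X] by (simp add: crep_def)
    then show "pd k (crep c \<rho>) x = rescale (\<lambda>p. (A p - B p) / (1 - n)) X c x $ k"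
      using grad_\<rho>[OF c x] by simp
  qed
qed

end

end

locale fluid_spacetime_split = fluid_spacetime atl g u A B n
  for atl :: "('a::topological_space, 'm::finite option) chart set" and g u A B n
begin

text \<open>The field to be straightened is the raised \<open>u\<close>, and the time function is a
  potential of \<open>- u\<close>, which exists on a ball because \<open>u\<close> is closed. Unit
  norm makes the time function grow at rate 1, as \<open>flow_box\<close> requires.\<close>

lemma grw_einstein: "grw_with_fiber atl g einstein_on"
  unfolding grw_with_fiber_def
proof
  fix p
  obtain c where c: "c \<in> atl" "p \<in> cdom c" by (rule chart_at)
  interpret ch: chart_torse "rng c" "g c" "u c" "crep c A" "crep c B" n by (rule torse_chart[OF c(1)])
  define x0 where "x0 = cmap c p"
  have "x0 \<in> rng c" using c(2) by (simp add: x0_def)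
  then obtain e where e: "e > 0" "ball x0 e \<subseteq> rng c" using ch.D_open openE by blast
  define U where "U = ball x0 e"
  have U: "open U" "convex U" "x0 \<in> U" "U \<subseteq> rng c" using e by (auto simp: U_def)
  have us: "smooth_on U (\<lambda>x. - u c x $ i)" for i
    by (intro smooth_on_minus U(1) smooth_on_subset[OF ch.u_smooth U(4)])
  have ucl: "pd i (\<lambda>x. - u c x $ j) x = pd j (\<lambda>x. - u c x $ i) x" if "x \<in> U" for x i j
    using pd_u_sym[OF c(1) subsetD[OF U(4) that], of i j] ch.udiff[OF subsetD[OF U(4) that]] by (simp add: pd_minus)
  obtain \<tau> where \<tau>: "smooth_on U \<tau>" "\<And>x i. x \<in> U \<Longrightarrow> pd i \<tau> x = - u c x $ i" "\<tau> x0 = 0"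
    using closed_form_exact[where w = "\<lambda>i x. - u c x $ i", OF U(1-3) us ucl] by blast
  have V\<tau>: "(\<Sum>i\<in>UNIV. ch.uu i x * pd i \<tau> x) = 1" if "x \<in> U" for x
    using ch.uu_u[OF subsetD[OF U(4) that]] by (simp add: \<tau>(2)[OF that] sum_negf)
  show "\<exists>c\<in>atl. p \<in> cdom c \<and> (\<exists>I V q h. warped_chart g c I V q h \<and> einstein_on V h)"
  proof (rule flow_box[where V = ch.uu and ix = None and \<tau> = \<tau>, OF U(1,3) smooth_on_subset[OF ch.smooth_uu U(4)] \<tau>(1,3) V\<tau>])
    fix r and \<psi> \<theta> :: "real^'m option \<Rightarrow> real^'m option"
    assume r: "r > 0" and s\<psi>: "\<And>i. smooth_on (cube r) (\<lambda>z. \<psi> z $ i)" and \<psi>U: "\<psi> ` cube r \<subseteq> U" and \<psi>0: "\<psi> 0 = x0"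
      and op: "open (\<psi> ` cube r)" and hom: "homeomorphism (cube r) (\<psi> ` cube r) \<psi> \<theta>"
      and s\<theta>: "\<And>i. smooth_on (\<psi> ` cube r) (\<lambda>y. \<theta> y $ i)"
      and \<psi>V: "\<And>z i. z \<in> cube r \<Longrightarrow> pd None (\<lambda>z. \<psi> z $ i) z = ch.uu i (\<psi> z)"
      and \<psi>\<tau>: "\<And>z. z \<in> cube r \<Longrightarrow> \<tau> (\<psi> z) = z $ None"
    have \<psi>sub: "\<psi> ` cube r \<subseteq> rng c" using \<psi>U U(4) by blast
    define c' where "c' = (cdom c \<inter> cmap c -` (\<psi> ` cube r), \<theta> \<circ> cmap c)"
    note rep = reparametrised_chart[OF c(1) op \<psi>sub open_cube hom s\<psi> s\<theta>, folded c'_def]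
    have c': "c' \<in> atl" and im: "rng c' = cube r" and tr: "\<And>z. z \<in> cube r \<Longrightarrow> transition c' c z = \<psi> z"
      by (rule rep; assumption)+
    have "0 \<in> (cube r :: (real^'m option) set)" using r by (simp add: cube_def)
    then have pc': "p \<in> cdom c'" using c(2) \<psi>0 by (force simp: c'_def cdom_def x0_def[symmetric])
    interpret t: chart_torse "cube r" "g c'" "u c'" "crep c' A" "crep c' B" n
      using torse_chart[OF c'] unfolding im .
    have jac: "jacobian c' c z $ a $ i = pd i (\<lambda>z. \<psi> z $ a) z" if "z \<in> cube r" for z a i
      unfolding jacobian_def by (simp, rule pd_cong_open[OF open_cube that]) (simp add: tr)
    have pt: "\<exists>p'. p' \<in> cdom c' \<and> p' \<in> cdom c \<and> z = cmap c' p' \<and> cmap c p' = \<psi> z" if "z \<in> cube r" for z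
    proof -
      obtain p' where p': "p' \<in> cdom c'" "z = cmap c' p'" using \<open>z \<in> cube r\<close> im by blast
      then have "p' \<in> cdom c" by (simp add: c'_def cdom_def)
      then show ?thesis using p' tr[OF that] transition_eq[OF c' p'(1), of c] by auto
    qed
    have \<psi>in: "\<psi> z \<in> U" if "z \<in> cube r" for z using that \<psi>U by blast
    have u': "u c' z $ i = (\<Sum>a\<in>UNIV. u c (\<psi> z) $ a * pd i (\<lambda>z. \<psi> z $ a) z)" if "z \<in> cube r" for z i
    proof -
      obtain p' where p': "p' \<in> cdom c'" "p' \<in> cdom c" "z = cmap c' p'" "cmap c p' = \<psi> z" using pt[OF \<open>z \<in> cube r\<close>] by blast
      then show ?thesis using one_form_transform[OF u_form c' c(1) p'(1,2), of i] jac[OF that] by simp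
    qed
    \<comment> \<open>\<open>u\<close> is minus the differential of \<tau>, and \<tau> is the
      coordinate \<open>None\<close> of the new chart.\<close>
    have u'_eq: "u c' z $ i = (if i = None then -1 else 0)" if "z \<in> cube r" for z i
    proof -
      have "pd i (\<lambda>z. \<tau> (\<psi> z)) z = (\<Sum>a\<in>UNIV. pd a \<tau> (\<psi> z) * pd i (\<lambda>z. \<psi> z $ a) z)"
        by (rule pd_chain[OF smooth_on_differentiable[OF s\<psi> that] smooth_on_differentiable[OF \<tau>(1) \<psi>in[OF that]]])
      then have "u c' z $ i = - pd i (\<lambda>z. \<tau> (\<psi> z)) z"
        by (simp add: u'[OF that] \<tau>(2)[OF \<psi>in[OF that]] sum_negf)
      also have "pd i (\<lambda>z. \<tau> (\<psi> z)) z = pd i (\<lambda>z. z $ None) z"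
        by (rule pd_cong_open[OF open_cube that \<psi>\<tau>])
      finally show ?thesis by (simp add: pd_coord)
    qed
    \<comment> \<open>The column \<open>None\<close> of the Jacobian is the raised \<open>u\<close>;
      contracting the metric with it lowers the index again.\<close>
    have g': "g c' z $ None $ i = u c' z $ i" if "z \<in> cube r" for z i
    proof -
      obtain p' where p': "p' \<in> cdom c'" "p' \<in> cdom c" "z = cmap c' p'" "cmap c p' = \<psi> z" using pt[OF \<open>z \<in> cube r\<close>] by blast
      let ?J = "jacobian c' c z"
      have "g c' z = transpose ?J ** g c (\<psi> z) ** ?J"
        using lorentz c' c(1) p' unfolding lorentzian_manifold_def two_tensor_on_def by (metis IntI UNIV_I)
      then have "g c' z $ None $ i = (\<Sum>b\<in>UNIV. (\<Sum>a\<in>UNIV. ?J $ a $ None * g c (\<psi> z) $ a $ b) * ?J $ b $ i)"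
        by (simp add: matrix_matrix_mult_def transpose_def)
      also have "\<dots> = (\<Sum>b\<in>UNIV. (\<Sum>a\<in>UNIV. g c (\<psi> z) $ b $ a * ch.uu a (\<psi> z)) * pd i (\<lambda>z. \<psi> z $ b) z)"
        by (simp add: jac[OF that] \<psi>V[OF that] ch.g_sym[OF subsetD[OF U(4) \<psi>in[OF that]], of _ "_ :: 'm option"] mult.commute)
      also have "\<dots> = u c' z $ i"
        unfolding ch.lower_uu[OF subsetD[OF U(4) \<psi>in[OF that]]] u'[OF that] ..
      finally show ?thesis .
    qed
    interpret w: chart_warped r "g c'" "u c'" "crep c' A" "crep c' B" n
    proof unfold_locales
      show "lorentzian_form (g c' x)" if "x \<in> cube r" for x
      proof -
        have "x \<in> rng c'" using that im by simp
        then show ?thesis using lorentz c' unfolding lorentzian_manifold_def by blast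
      qed
    qed (use r u'_eq g' in auto)
    have "warped_chart g c' {-r<..<r} (cube r) w.q w.h"
      unfolding warped_chart_def im
    proof (intro conjI ballI allI)
      show "cube r = {x :: real^'m option. x $ None \<in> {-r<..<r} \<and> space_part x \<in> cube r}"
        using cube_option by blast
      show "0 < w.q t" for t by (simp add: w.q_def)
    qed (use w.smooth_q w.riemannian_h w.g_NN w.g_NS w.g_SN w.g_warped in \<open>auto simp: open_cube convex_connected[OF convex_cube]\<close>)
    then show "\<exists>c\<in>atl. p \<in> cdom c \<and> (\<exists>I V q h. warped_chart g c I V q h \<and> einstein_on V h)"
      using c' pc' w.einstein_h by blast
  qed
qed

end

text \<open>The conformal Killing vector is given for every local potential \<sigma> of \<omega>;
  \<open>concircular\<close> supplies such a potential around each point.\<close>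

theorem theorem2p1:
  fixes atl :: "('a::{t2_space,second_countable_topology}, 'm::finite option) chart set"
    and g :: "('a, 'm option) two_tensor"
    and u :: "('a, 'm option) one_form"
    and A B :: "'a \<Rightarrow> real"
  assumes dim: "CARD('m option) > 3"
    and lorentz: "lorentzian_manifold atl g"
    and fluid: "perfect_fluid atl g A B u"
    and nondegenerate: "closure {p. B p \<noteq> 0} = UNIV"
    and closed: "closed_one_form atl g u"
    and weyl: "div_free_weyl atl g"
  shows
    "(\<exists>\<omega> f. concircular atl g u \<omega> f \<and>
        (\<forall>N \<sigma>. open N \<and> scalar_field_on atl N \<sigma> \<and> gradient_on atl N \<sigma> \<omega> \<longrightarrow>
          (let X = rescale (\<lambda>p. exp (- \<sigma> p)) u in
            \<exists>\<rho>. timelike_on atl g N X \<and> conformal_killing_on atl g N X \<rho> \<and>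
              (\<forall>c\<in>atl. \<forall>x \<in> cmap c ` (cdom c \<inter> N). \<forall>k j.
                 cov1 (g c) k (X c) j x = crep c \<rho> x * g c x $ k $ j) \<and>
              gradient_on atl N \<rho> (rescale (\<lambda>p. (A p - B p) / (1 - real CARD('m option))) X))))
     \<and> grw_with_fiber atl g einstein_on
     \<and> (\<forall>c\<in>atl. \<forall>x \<in> cmap c ` cdom c. \<forall>j k l.
          (\<Sum>m\<in>UNIV. \<Sum>s\<in>UNIV. weyl (g c) j k l m x * ginv (g c) m s x * u c x $ s) = 0)"
proof -
  define n where "n = real CARD('m option)"
  interpret fluid_spacetime_split atl g u A B n
    by unfold_locales (use assms in \<open>auto simp: lorentzian_manifold_def n_def\<close>)
  have "concircular atl g u \<omega> F" by (rule concircular_u)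
  moreover have "let X = rescale (\<lambda>p. exp (- \<sigma> p)) u in
      \<exists>\<rho>. timelike_on atl g N X \<and> conformal_killing_on atl g N X \<rho> \<and>
        (\<forall>c\<in>atl. \<forall>x \<in> cmap c ` (cdom c \<inter> N). \<forall>k j. cov1 (g c) k (X c) j x = crep c \<rho> x * g c x $ k $ j) \<and>
        gradient_on atl N \<rho> (rescale (\<lambda>p. (A p - B p) / (1 - n)) X)"
    if "open N \<and> scalar_field_on atl N \<sigma> \<and> gradient_on atl N \<sigma> \<omega>" for N \<sigma>
    using conformal_killing_X[of N \<sigma>] that unfolding Let_def by blast
  moreover have "(\<Sum>m\<in>UNIV. \<Sum>s\<in>UNIV. weyl (g c) j k l m x * ginv (g c) m s x * u c x $ s) = 0"
    if "c \<in> atl" "x \<in> cmap c ` cdom c" for c x j k l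
    by (rule chart_torse.weyl_u[OF torse_chart[OF that(1)] that(2)])
  ultimately show ?thesis using grw_einstein unfolding n_def by blast
qed

end
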